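(* Let $\mathcal A$ be a connected graded algebra which is finitely generated in degree 1, finitely presented with relations of degrees $\geq 2$, and which is of global dimension $D=3$ and Gorenstein. Then there are an integer $N\geq 2$ and, with $s+1=\dim\mathcal A_1$, a 3-regular $(N+1)$-linear form $w$ on $\mathbb K^{s+1}$ such that $\mathcal A=\mathcal A(w,N)$.
   Context: $\mathbb K$ is an algebraically closed field of characteristic zero; all algebras are unital associative over $\mathbb K$. Connected graded: $\mathcal A=\oplus_{n\geq 0}\mathcal A_n$, $\mathcal A_0=\mathbb K$. Finitely generated in degree 1 and finitely presented with relations of degrees $\geq 2$: $\mathcal A\cong T(E)/I$ as graded algebra, with $E$ finite-dimensional in degree 1 and $I$ a two-sided ideal generated by finitely many homogeneous elements of degrees $\geq 2$. Gorenstein: $\mathcal A$ of finite global dimension $D$ is Gorenstein if, for the trivial left module $\mathbb K$, $\mathrm{Ext}^i_{\mathcal A}(\mathbb K,\mathcal A)=0$ for $i\neq D$ and $\mathrm{Ext}^D_{\mathcal A}(\mathbb K,\mathcal A)\cong\mathbb K$ (the trivial right module, up to a shift of grading). Preregular: an $m$-linear form $w$ on a vector space $V$ ($\dim V\geq 2$, $m\geq 2$) is preregular if (i) $w(X,X_1,\dots,X_{m-1})=0$ for all $X_1,\dots,X_{m-1}\in V$ implies $X=0$, and (ii) there is $Q_w\in GL(V)$ with $w(X_1,\dots,X_m)=w(Q_wX_m,X_1,\dots,X_{m-1})$ for all $X_i\in V$. 3-regular: an $(N+1)$-linear form $w$ on $V$ ($N\geq 2$) is 3-regular if it is preregular and (iii)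 whenever endomorphisms $L_0,L_1$ of $V$ satisfy $w(L_0X_0,X_1,X_2,\dots,X_N)=w(X_0,L_1X_1,X_2,\dots,X_N)$ for all $X_0,\dots,X_N\in V$, then $L_0=L_1=\lambda\,\mathrm{Id}$ for some $\lambda\in\mathbb K$. $\mathcal A(w,N)$: for a preregular $(N+1)$-linear form $w$ on $\mathbb K^{s+1}$ with components $W_{\lambda_0\dots\lambda_N}=w(e_{\lambda_0},\dots,e_{\lambda_N})$ in the canonical basis, $\mathcal A(w,N)$ is the graded algebra generated by $x^0,\dots,x^s$ in degree 1 with the relations $\sum_{\lambda_1,\dots,\lambda_N}W_{\lambda\lambda_1\dots\lambda_N}x^{\lambda_1}\cdots x^{\lambda_N}=0$ for $\lambda\in\{0,\dots,s\}$. The equality $\mathcal A=\mathcal A(w,N)$ means that, for a basis $(x^\lambda)$ of $\mathcal A_1$, $\mathcal A$ is presented by these generators and relations. *)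

theory Defs
  imports
    "HOL-Computational_Algebra.Polynomial"
    "HOL-Library.Poly_Mapping"
    "HOL-Library.Extended_Nat"
    "HOL-Algebra.QuotRing"
    "HOL-Algebra.Module"
    "Jordan_Normal_Form.Matrix"
begin

section \<open>Connected graded algebras\<close>

locale assoc_algebra = vector_space scale
  for scale :: "'k::field \<Rightarrow> 'a::ring_1 \<Rightarrow> 'a" +
  assumes scale_mult_left: "scale c (x * y) = scale c x * y"
    and scale_mult_right: "scale c (x * y) = x * scale c y"

definition homogeneous_decomposition :: "(nat \<Rightarrow> 'a::comm_monoid_add set) \<Rightarrow> 'a \<Rightarrow> (nat \<Rightarrow> 'a) \<Rightarrow> bool"
  where "homogeneous_decomposition gr a f \<longleftrightarrow>
    (\<forall>n. f n \<in> gr n) \<and> finite {n. f n \<noteq> 0} \<and> a = (\<Sum>n | f n \<noteq> 0. f n)"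

text \<open>A graded algebra is the whole type \<^typ>\<open>'a\<close> together with its homogeneous subspaces
  \<^term>\<open>gr n\<close>; it is connected if the degree-0 part is the line spanned by the unit.\<close>

locale connected_graded_algebra = assoc_algebra scale
  for scale :: "'k::field \<Rightarrow> 'a::ring_1 \<Rightarrow> 'a" +
  fixes gr :: "nat \<Rightarrow> 'a set"
  assumes gr_subspace: "subspace (gr n)"
    and gr_direct_sum: "\<exists>!f. homogeneous_decomposition gr a f"
    and gr_mult: "x \<in> gr m \<Longrightarrow> y \<in> gr n \<Longrightarrow> x * y \<in> gr (m + n)"
    and gr_0: "gr 0 = range (\<lambda>c. scale c 1)"

definition augmentation :: "('k \<Rightarrow> 'a::ring_1 \<Rightarrow> 'a) \<Rightarrow> (nat \<Rightarrow> 'a set) \<Rightarrow> 'a \<Rightarrow> 'k"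
  where "augmentation scale gr a =
    (THE c. scale c 1 = (THE f. homogeneous_decomposition gr a f) 0)"


section \<open>Free algebras and presentations\<close>

datatype 'x nc_word = NC_Word (letters: "'x list")

instantiation nc_word :: (type) monoid_add
begin

definition "0 = NC_Word []"
definition "u + v = NC_Word (letters u @ letters v)"

instance
  by standard (auto simp: zero_nc_word_def plus_nc_word_def)

end

text \<open>The words over an alphabet form a monoid under concatenation, written additively so that the
  convolution product of \<^typ>\<open>'x nc_word \<Rightarrow>\<^sub>0 'k\<close> makes this type the free algebra. The tensor
  algebra of an \<^term>\<open>n\<close>-dimensional space with a chosen basis is the subring of those elements
  whose words only use the letters \<^term>\<open>0\<close>, ..., \<^term>\<open>n - 1\<close>.\<close>

definition free_algebra :: "nat \<Rightarrow> (nat nc_word \<Rightarrow>\<^sub>0 'k::field) ring"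
  where "free_algebra n =
    \<lparr>carrier = {p. \<forall>u \<in> Poly_Mapping.keys p. set (letters u) \<subseteq> {..<n}},
     mult = (*), one = 1, zero = 0, add = (+)\<rparr>"

definition homogeneous :: "nat \<Rightarrow> ('x nc_word \<Rightarrow>\<^sub>0 'k::zero) \<Rightarrow> bool"
  where "homogeneous d p \<longleftrightarrow> (\<forall>u \<in> Poly_Mapping.keys p. length (letters u) = d)"

definition free_eval ::
  "('k::zero \<Rightarrow> 'a::ring_1 \<Rightarrow> 'a) \<Rightarrow> ('x \<Rightarrow> 'a) \<Rightarrow> ('x nc_word \<Rightarrow>\<^sub>0 'k) \<Rightarrow> 'a"
  where "free_eval scale x p =
    (\<Sum>u \<in> Poly_Mapping.keys p. scale (Poly_Mapping.lookup p u) (prod_list (map x (letters u))))"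

text \<open>The algebra is the quotient of the free algebra on \<^term>\<open>n\<close> generators by the two-sided
  ideal generated by \<^term>\<open>R\<close>, the class of the \<^term>\<open>i\<close>-th generator being \<^term>\<open>x i\<close>.\<close>

definition presented_by ::
  "('k::field \<Rightarrow> 'a::ring_1 \<Rightarrow> 'a) \<Rightarrow> nat \<Rightarrow> (nat \<Rightarrow> 'a) \<Rightarrow> (nat nc_word \<Rightarrow>\<^sub>0 'k) set \<Rightarrow> bool"
  where "presented_by scale n x R \<longleftrightarrow>
    R \<subseteq> carrier (free_algebra n) \<and>
    free_eval scale x ` carrier (free_algebra n) = UNIV \<and>
    {p \<in> carrier (free_algebra n). free_eval scale x p = 0} = Idl\<^bsub>free_algebra n\<^esub> R"

definition finitely_presented_in_degree_one ::
  "('k::field \<Rightarrow> 'a::ring_1 \<Rightarrow> 'a) \<Rightarrow> (nat \<Rightarrow> 'a set) \<Rightarrow> bool"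
  where "finitely_presented_in_degree_one scale gr \<longleftrightarrow>
    (\<exists>n x R. (\<forall>i<n. x i \<in> gr 1) \<and> finite R \<and> (\<forall>r\<in>R. \<exists>d\<ge>2. homogeneous d r) \<and>
      presented_by scale n x R)"


section \<open>Modules and global dimension\<close>

text \<open>The modules of \<^theory>\<open>HOL-Algebra.Module\<close> are over commutative rings, so left modules over
  \<^typ>\<open>'a::ring_1\<close> are introduced here, reusing the record; its multiplication and unit fields
  play no role.\<close>

locale left_module = abelian_group M
  for M :: "('a::ring_1, 'm) module" (structure) +
  assumes smult_closed: "x \<in> carrier M \<Longrightarrow> a \<odot> x \<in> carrier M"
    and smult_l_distr: "x \<in> carrier M \<Longrightarrow> (a + b) \<odot> x = a \<odot> x \<oplus> b \<odot> x"
    and smult_r_distr: "x \<in> carrier M \<Longrightarrow> y \<in> carrier M \<Longrightarrow> a \<odot> (x \<oplus> y) = a \<odot> x \<oplus> a \<odot> y"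
    and smult_assoc: "x \<in> carrier M \<Longrightarrow> (a * b) \<odot> x = a \<odot> (b \<odot> x)"
    and smult_one: "x \<in> carrier M \<Longrightarrow> 1 \<odot> x = x"

definition module_homs :: "('a, 'm) module \<Rightarrow> ('a, 'n) module \<Rightarrow> ('m \<Rightarrow> 'n) set"
  where "module_homs M N = {f \<in> carrier M \<rightarrow> carrier N.
    (\<forall>x\<in>carrier M. \<forall>y\<in>carrier M. f (x \<oplus>\<^bsub>M\<^esub> y) = f x \<oplus>\<^bsub>N\<^esub> f y) \<and>
    (\<forall>a. \<forall>x\<in>carrier M. f (a \<odot>\<^bsub>M\<^esub> x) = a \<odot>\<^bsub>N\<^esub> f x)}"

definition modules_isomorphic :: "('a, 'm) module \<Rightarrow> ('a, 'n) module \<Rightarrow> bool"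
  where "modules_isomorphic M N \<longleftrightarrow> (\<exists>f \<in> module_homs M N. bij_betw f (carrier M) (carrier N))"

definition regular_module :: "('a::ring_1, 'a) module"
  where "regular_module =
    \<lparr>carrier = UNIV, mult = (*), one = 1, zero = 0, add = (+), smult = (*)\<rparr>"

definition free_module :: "'x set \<Rightarrow> ('a::ring_1, 'x \<Rightarrow>\<^sub>0 'a) module"
  where "free_module X =
    \<lparr>carrier = {f. Poly_Mapping.keys f \<subseteq> X}, mult = undefined, one = undefined,
     zero = 0, add = (+), smult = (\<lambda>a. Poly_Mapping.map ((*) a))\<rparr>"

text \<open>Projective modules are the direct summands of free modules; a set of generators can always be
  taken inside the carrier type, so the index set may be a subset of it.\<close>

definition projective :: "('a::ring_1, 'm) module \<Rightarrow> bool"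
  where "projective P \<longleftrightarrow> left_module P \<and>
    (\<exists>(X :: 'm set) i p. i \<in> module_homs P (free_module X) \<and> p \<in> module_homs (free_module X) P \<and>
      (\<forall>x\<in>carrier P. p (i x) = x))"

definition projective_resolution ::
  "('a::ring_1, 'm) module \<Rightarrow> (nat \<Rightarrow> ('a, 'u) module) \<Rightarrow> (nat \<Rightarrow> 'u \<Rightarrow> 'u) \<Rightarrow> ('u \<Rightarrow> 'm) \<Rightarrow> bool"
  where "projective_resolution M P d e \<longleftrightarrow>
    (\<forall>i. projective (P i)) \<and>
    e \<in> module_homs (P 0) M \<and>
    (\<forall>i. d i \<in> module_homs (P (Suc i)) (P i)) \<and>
    e ` carrier (P 0) = carrier M \<and>
    {x \<in> carrier (P 0). e x = \<zero>\<^bsub>M\<^esub>} = d 0 ` carrier (P (Suc 0)) \<and>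
    (\<forall>i. {x \<in> carrier (P (Suc i)). d i x = \<zero>\<^bsub>P i\<^esub>} = d (Suc i) ` carrier (P (Suc (Suc i))))"

text \<open>HOL cannot quantify over modules of all sizes, so modules are taken with carriers in a universe
  type \<^typ>\<open>'u\<close>. If \<^typ>\<open>'u\<close> is infinite and at least as large as the ring, then, up to
  isomorphism, the modules in \<^typ>\<open>'u\<close> include all cyclic modules and are closed under
  submodules, quotients and the free modules on their underlying sets. The projective and the global
  dimension below are then the usual ones.\<close>

definition projective_dimension :: "('a::ring_1, 'u) module \<Rightarrow> enat"
  where "projective_dimension M = Inf {enat n | n.
    \<exists>(P :: nat \<Rightarrow> ('a, 'u) module) d e.
      projective_resolution M P d e \<and> (\<forall>i>n. carrier (P i) = {\<zero>\<^bsub>P i\<^esub>})}"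

definition left_global_dimension :: "'a::ring_1 itself \<Rightarrow> 'u itself \<Rightarrow> enat"
  where "left_global_dimension _ _ =
    Sup (projective_dimension ` {M :: ('a, 'u) module. left_module M})"


section \<open>Ext with values in the algebra and the Gorenstein property\<close>

definition some_projective_resolution ::
  "('a::ring_1, 'm) module \<Rightarrow> (nat \<Rightarrow> ('a, 'u) module) \<times> (nat \<Rightarrow> 'u \<Rightarrow> 'u)"
  where "some_projective_resolution M = (SOME (P, d). \<exists>e. projective_resolution M P d e)"

text \<open>Right modules are given by the same record, with \<^term>\<open>smult M a x\<close> standing for
  the action of \<^term>\<open>a\<close> on \<^term>\<open>x\<close> from the right. The right action on homomorphisms from a left
  module into the algebra is the one on values. Homomorphisms are made extensional, so that each is
  represented once.\<close>

definition dual_module :: "('a::ring_1, 'm) module \<Rightarrow> ('a, 'm \<Rightarrow> 'a) module"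
  where "dual_module P =
    \<lparr>carrier = module_homs P regular_module \<inter> extensional (carrier P),
     mult = undefined, one = undefined,
     zero = (\<lambda>x\<in>carrier P. 0),
     add = (\<lambda>f g. \<lambda>x\<in>carrier P. f x + g x),
     smult = (\<lambda>a f. \<lambda>x\<in>carrier P. f x * a)\<rparr>"

definition quotient_module :: "('a, 'm) module \<Rightarrow> 'm set \<Rightarrow> ('a, 'm set) module"
  where "quotient_module M B =
    \<lparr>carrier = a_rcosets\<^bsub>M\<^esub> B, mult = undefined, one = undefined,
     zero = B,
     add = set_add M,
     smult = (\<lambda>a X. \<Union>x\<in>X. B +>\<^bsub>M\<^esub> (a \<odot>\<^bsub>M\<^esub> x))\<rparr>"

definition cocycles ::
  "(nat \<Rightarrow> ('a::ring_1, 'u) module) \<Rightarrow> (nat \<Rightarrow> 'u \<Rightarrow> 'u) \<Rightarrow> nat \<Rightarrow> ('u \<Rightarrow> 'a) set"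
  where "cocycles P d i =
    {f \<in> carrier (dual_module (P i)). \<forall>x\<in>carrier (P (Suc i)). f (d i x) = 0}"

fun coboundaries ::
  "(nat \<Rightarrow> ('a::ring_1, 'u) module) \<Rightarrow> (nat \<Rightarrow> 'u \<Rightarrow> 'u) \<Rightarrow> nat \<Rightarrow> ('u \<Rightarrow> 'a) set"
  where
    "coboundaries P d 0 = {\<zero>\<^bsub>dual_module (P 0)\<^esub>}"
  | "coboundaries P d (Suc i) =
      (\<lambda>f. \<lambda>x\<in>carrier (P (Suc i)). f (d i x)) ` carrier (dual_module (P i))"

text \<open>\<open>Ext_self i M\<close> is the right module $\mathrm{Ext}^i(M, A)$, where $A$ is the ring
  \<^typ>\<open>'a\<close> as a left module over itself.\<close>

definition Ext_self :: "nat \<Rightarrow> ('a::ring_1, 'm) module \<Rightarrow> ('a, ('u \<Rightarrow> 'a) set) module"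
  where "Ext_self i M =
    (case some_projective_resolution M of (P :: nat \<Rightarrow> ('a, 'u) module, d) \<Rightarrow>
      quotient_module ((dual_module (P i))\<lparr>carrier := cocycles P d i\<rparr>) (coboundaries P d i))"

text \<open>As the augmentation takes values in a commutative ring, the same record is both the trivial
  left and the trivial right module.\<close>

definition trivial_module ::
  "('k::field \<Rightarrow> 'a::ring_1 \<Rightarrow> 'a) \<Rightarrow> (nat \<Rightarrow> 'a set) \<Rightarrow> ('a, 'k) module"
  where "trivial_module scale gr =
    \<lparr>carrier = UNIV, mult = (*), one = 1, zero = 0, add = (+),
     smult = (\<lambda>a c. augmentation scale gr a * c)\<rparr>"

definition gorenstein ::
  "'u itself \<Rightarrow> ('k::field \<Rightarrow> 'a::ring_1 \<Rightarrow> 'a) \<Rightarrow> (nat \<Rightarrow> 'a set) \<Rightarrow> nat \<Rightarrow> bool"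
  where "gorenstein _ scale gr D \<longleftrightarrow>
    (let E = (\<lambda>i. Ext_self i (trivial_module scale gr) :: ('a, ('u \<Rightarrow> 'a) set) module) in
      (\<forall>i. i \<noteq> D \<longrightarrow> carrier (E i) = {\<zero>\<^bsub>E i\<^esub>}) \<and>
      modules_isomorphic (E D) (trivial_module scale gr))"


section \<open>Multilinear forms\<close>

text \<open>An \<^term>\<open>m\<close>-linear form on $K^n$ is a function on lists of vectors, of which only the values
  on lists of length \<^term>\<open>m\<close> over \<^term>\<open>carrier_vec n\<close> matter.\<close>

definition multilinear_form :: "nat \<Rightarrow> nat \<Rightarrow> ('k::field vec list \<Rightarrow> 'k) \<Rightarrow> bool"
  where "multilinear_form n m w \<longleftrightarrow>
    (\<forall>us x y vs a b.
      length us + 1 + length vs = m \<and> set us \<subseteq> carrier_vec n \<and> set vs \<subseteq> carrier_vec n \<and>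
      x \<in> carrier_vec n \<and> y \<in> carrier_vec n \<longrightarrow>
      w (us @ (a \<cdot>\<^sub>v x + b \<cdot>\<^sub>v y) # vs) = a * w (us @ x # vs) + b * w (us @ y # vs))"

definition preregular :: "nat \<Rightarrow> nat \<Rightarrow> ('k::field vec list \<Rightarrow> 'k) \<Rightarrow> bool"
  where "preregular n m w \<longleftrightarrow> n \<ge> 2 \<and> m \<ge> 2 \<and> multilinear_form n m w \<and>
    (\<forall>x \<in> carrier_vec n.
      (\<forall>us. length us = m - 1 \<and> set us \<subseteq> carrier_vec n \<longrightarrow> w (x # us) = 0) \<longrightarrow> x = 0\<^sub>v n) \<and>
    (\<exists>Q \<in> carrier_mat n n. invertible_mat Q \<and>
      (\<forall>us. \<forall>x \<in> carrier_vec n. length us = m - 1 \<and> set us \<subseteq> carrier_vec n \<longrightarrow>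
        w (us @ [x]) = w ((Q *\<^sub>v x) # us)))"

definition three_regular :: "nat \<Rightarrow> nat \<Rightarrow> ('k::field vec list \<Rightarrow> 'k) \<Rightarrow> bool"
  where "three_regular n N w \<longleftrightarrow> N \<ge> 2 \<and> preregular n (N + 1) w \<and>
    (\<forall>L0 \<in> carrier_mat n n. \<forall>L1 \<in> carrier_mat n n.
      (\<forall>x0 \<in> carrier_vec n. \<forall>x1 \<in> carrier_vec n. \<forall>us.
        length us = N - 1 \<and> set us \<subseteq> carrier_vec n \<longrightarrow>
        w ((L0 *\<^sub>v x0) # x1 # us) = w (x0 # (L1 *\<^sub>v x1) # us)) \<longrightarrow>
      (\<exists>c. L0 = c \<cdot>\<^sub>m 1\<^sub>m n \<and> L1 = c \<cdot>\<^sub>m 1\<^sub>m n))"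


section \<open>The algebra of a multilinear form\<close>

definition form_relation ::
  "nat \<Rightarrow> nat \<Rightarrow> ('k::field vec list \<Rightarrow> 'k) \<Rightarrow> nat \<Rightarrow> (nat nc_word \<Rightarrow>\<^sub>0 'k)"
  where "form_relation n N w l =
    (\<Sum>u | length u = N \<and> set u \<subseteq> {..<n}.
      Poly_Mapping.single (NC_Word u) (w (map (unit_vec n) (l # u))))"

text \<open>The algebra is $\mathcal A(w,N)$: it is presented by generators forming a basis of the degree-1
  part, subject to the relations above.\<close>

definition is_form_algebra ::
  "('k::field \<Rightarrow> 'a::ring_1 \<Rightarrow> 'a) \<Rightarrow> (nat \<Rightarrow> 'a set) \<Rightarrow> nat \<Rightarrow> nat \<Rightarrow> ('k vec list \<Rightarrow> 'k) \<Rightarrow> bool"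
  where "is_form_algebra scale gr n N w \<longleftrightarrow>
    (\<exists>x. inj_on x {..<n} \<and> \<not> module.dependent scale (x ` {..<n}) \<and>
      module.span scale (x ` {..<n}) = gr 1 \<and>
      presented_by scale n x (form_relation n N w ` {..<n}))"

end

theory Submission
  imports Defs "Jordan_Normal_Form.Determinant"
begin

text \<open>
  The relations, viewed as $r = \sum_i (\partial_i r)\, x_i$, give the beginning
  $A^m \to A^n \to A \to K$ of a minimal free resolution, whose matrix $M$ has the entries
  $\partial_i r_j$. The global dimension makes the kernel $\Omega$ of $A^m \to A^n$ projective, so
  every functional on $\Omega / A_+ \Omega$ lifts to a homomorphism $\Omega \to A$; as $\Omega$ lies
  in $A_+^m$ and $\mathrm{Ext}^3(K, A)$ is one-dimensional, $\Omega$ is free on one homogeneous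
  vector $v$, and $A_+ = \sum_j v_j A$. The vanishing of $\mathrm{Ext}^2(K, A)$ makes the $v_j$ a
  minimal set of generators of $A_+$, hence a basis of $A_1$, so all relations have the same degree
  $N$ and may be chosen such that $v = x$. Then $\sum_i x_i\, \partial_k r_i = 0$ says that
  $\sum_i x_i \otimes \partial_k r_i$ is a combination of the relations, which is the twisted
  cyclicity of the form with components $W_{i u}$, the coefficients of $r_i$. In the lowest degrees,
  exactness of the resolution at the relations gives nondegeneracy and 3-regularity, and exactness of
  the dual complex at the generators gives the invertibility of the twist.
\<close>

section \<open>Module homomorphisms and lifting\<close>

text \<open>Ext is read off one projective resolution, picked by choice among those in the universe,
  whereas the bound on the length belongs to another one. Neither is minimal or graded, so neither
  shows degrees. The explicit complex of free modules is therefore compared with both by chain maps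
  and homotopies: one comparison turns the Ext groups into statements about rows and columns over A,
  the other turns the length bound into the lifting property of \<Omega>. The homotopies stop at
  A^m, where a defect with values in \<Omega> remains; it is carried along explicitly.

  The isomorphism of Ext^3 with K is one of ungraded modules. Degrees enter through the grading of
  A^m that puts the j-th basis vector in the degree of the j-th relation, and a graded Nakayama
  argument by induction on the degree finds v. Exactness of the resolution concerns rows acted on
  from the left, exactness of the dual complex columns acted on from the right; the entries of v
  link the two.\<close>

abbreviation "lookup \<equiv> Poly_Mapping.lookup"
abbreviation "keys \<equiv> Poly_Mapping.keys"
abbreviation "single \<equiv> Poly_Mapping.single"

lemma lookup_map_mult [simp]:
  fixes a :: "'a::mult_zero"
  shows "lookup (Poly_Mapping.map ((*) a) p) k = a * lookup p k"
  by (simp add: Poly_Mapping.map.rep_eq "when_def")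

lemma map_mult_zero [simp]: "Poly_Mapping.map ((*) (a :: 'a::mult_zero)) 0 = 0"
  by (rule poly_mapping_eqI) simp

lemma keys_map_mult_subset:
  fixes a :: "'a::mult_zero"
  shows "keys (Poly_Mapping.map ((*) a) p) \<subseteq> keys p"
  by (auto simp: in_keys_iff)

lemma free_module_simps [simp]:
  "carrier (free_module X) = {f. keys f \<subseteq> X}"
  "zero (free_module X) = 0"
  "add (free_module X) = (+)"
  "smult (free_module X) = (\<lambda>a. Poly_Mapping.map ((*) a))"
  by (simp_all add: free_module_def)

lemma regular_module_simps [simp]:
  "carrier regular_module = UNIV" "zero regular_module = 0" "add regular_module = (+)"
  "smult regular_module = (*)"
  by (simp_all add: regular_module_def)

lemma left_module_free_module: "left_module (free_module X :: ('a::ring_1, 'x \<Rightarrow>\<^sub>0 'a) module)"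
proof -
  have "abelian_group (free_module X :: ('a, 'x \<Rightarrow>\<^sub>0 'a) module)"
  proof (rule abelian_groupI)
    fix x :: "'x \<Rightarrow>\<^sub>0 'a"
    assume "x \<in> carrier (free_module X)"
    then show "\<exists>y\<in>carrier (free_module X). y \<oplus>\<^bsub>free_module X\<^esub> x = \<zero>\<^bsub>free_module X\<^esub>"
      by (intro bexI[of _ "- x"]) (auto simp: in_keys_iff)
  next
    fix x y :: "'x \<Rightarrow>\<^sub>0 'a"
    assume "x \<in> carrier (free_module X)" "y \<in> carrier (free_module X)"
    then show "x \<oplus>\<^bsub>free_module X\<^esub> y \<in> carrier (free_module X)"
      using keys_add[of x y] by auto
  qed (auto simp: algebra_simps)
  then show ?thesis
    by (intro left_module.intro left_module_axioms.intro)
      (auto intro!: poly_mapping_eqI simp: lookup_add algebra_simps in_keys_iff subset_iff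
        dest: mult_not_zero)
qed

lemma left_module_regular_module: "left_module (regular_module :: ('a::ring_1, 'a) module)"
proof -
  have "abelian_group (regular_module :: ('a, 'a) module)"
    by (rule abelian_groupI) (auto simp: algebra_simps intro: right_minus)
  then show ?thesis
    by (intro left_module.intro left_module_axioms.intro) (auto simp: algebra_simps)
qed

lemma module_homsI:
  assumes "\<And>x. x \<in> carrier M \<Longrightarrow> f x \<in> carrier N"
    and "\<And>x y. x \<in> carrier M \<Longrightarrow> y \<in> carrier M \<Longrightarrow> f (x \<oplus>\<^bsub>M\<^esub> y) = f x \<oplus>\<^bsub>N\<^esub> f y"
    and "\<And>a x. x \<in> carrier M \<Longrightarrow> f (a \<odot>\<^bsub>M\<^esub> x) = a \<odot>\<^bsub>N\<^esub> f x"
  shows "f \<in> module_homs M N"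
  using assms by (auto simp: module_homs_def)

lemma module_homsD:
  assumes "f \<in> module_homs M N" "x \<in> carrier M"
  shows "f x \<in> carrier N"
    and "y \<in> carrier M \<Longrightarrow> f (x \<oplus>\<^bsub>M\<^esub> y) = f x \<oplus>\<^bsub>N\<^esub> f y"
    and "f (a \<odot>\<^bsub>M\<^esub> x) = a \<odot>\<^bsub>N\<^esub> f x"
  using assms by (auto simp: module_homs_def)

lemma module_homs_comp:
  assumes "f \<in> module_homs L M" "g \<in> module_homs M N"
  shows "(\<lambda>x. g (f x)) \<in> module_homs L N"
  using assms by (intro module_homsI) (simp_all add: module_homsD)

lemma (in left_module) smult_zero_left: "x \<in> carrier M \<Longrightarrow> 0 \<odot> x = \<zero>"
  using smult_l_distr[of x 0 0] smult_closed[of x 0] by simp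

lemma module_homs_zero:
  assumes "left_module M" "left_module N" "f \<in> module_homs M N"
  shows "f \<zero>\<^bsub>M\<^esub> = \<zero>\<^bsub>N\<^esub>"
proof -
  interpret M: left_module M by fact
  interpret N: left_module N by fact
  have "f (0 \<odot>\<^bsub>M\<^esub> \<zero>\<^bsub>M\<^esub>) = 0 \<odot>\<^bsub>N\<^esub> f \<zero>\<^bsub>M\<^esub>"
    by (rule module_homsD(3)[OF assms(3)]) simp
  then show ?thesis
    using M.smult_zero_left[of "\<zero>\<^bsub>M\<^esub>"] N.smult_zero_left module_homsD(1)[OF assms(3)] by simp
qed

lemma module_homs_free_eqI:
  fixes f g :: "('x \<Rightarrow>\<^sub>0 'a::ring_1) \<Rightarrow> 'm"
  assumes N: "left_module N"
    and f: "f \<in> module_homs (free_module X) N" and g: "g \<in> module_homs (free_module X) N"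
    and eq: "\<And>x. x \<in> X \<Longrightarrow> f (single x 1) = g (single x 1)"
    and q: "q \<in> carrier (free_module X)"
  shows "f q = g q"
proof -
  have "f q = g q" if "finite S" "S \<subseteq> X" "keys q \<subseteq> S" for S q
    using that
  proof (induction S arbitrary: q rule: finite_induct)
    case empty
    then have "q = 0"
      by simp
    then show ?case
      using module_homs_zero[OF left_module_free_module N f]
        module_homs_zero[OF left_module_free_module N g] by simp
  next
    case (insert x S)
    define c where "c = lookup q x"
    define q' where "q' = q - single x c"
    have k: "keys q' \<subseteq> S"
      using insert.prems unfolding q'_def c_def
      by (auto simp: in_keys_iff lookup_minus lookup_single "when_def" split: if_splits)
    have s: "keys (single x (1::'a)) \<subseteq> X"
      using insert.prems by auto
    have s': "keys (Poly_Mapping.map ((*) c) (single x 1)) \<subseteq> X"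
      using insert.prems by (auto simp: in_keys_iff lookup_single "when_def" split: if_splits)
    have q: "q = q' + Poly_Mapping.map ((*) c) (single x 1)"
      by (auto intro!: poly_mapping_eqI simp: q'_def lookup_add lookup_minus lookup_single "when_def")
    have k': "keys q' \<subseteq> X"
      using k insert.prems by auto
    have "h q = h q' \<oplus>\<^bsub>N\<^esub> c \<odot>\<^bsub>N\<^esub> h (single x 1)"
      if h: "h \<in> module_homs (free_module X) N" for h
      using module_homsD(2)[OF h, of q' "Poly_Mapping.map ((*) c) (single x 1)"]
        module_homsD(3)[OF h, of "single x 1" c] k' s s' q by simp
    from this[OF f] this[OF g] show ?case
      using eq[of x] insert.IH[OF _ k] insert.prems by simp
  qed
  then show ?thesis
    using q by (auto intro: finite_keys)
qed

text \<open>Preimages under \<open>p\<close> are chosen for the basis vectors and extended linearly.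
  Only the image of \<open>\<phi>\<close> has to lie in that of \<open>p\<close>, so the lemma also
  lifts along a differential onto the kernel of the next one, which is how chain maps and homotopies
  arise.\<close>

lemma free_module_lift:
  fixes \<phi> :: "('x \<Rightarrow>\<^sub>0 'a::ring_1) \<Rightarrow> 'n"
  assumes M: "left_module M" and N: "left_module N" and p: "p \<in> module_homs M N"
    and phi: "\<phi> \<in> module_homs (free_module X) N"
    and sub: "\<phi> ` carrier (free_module X) \<subseteq> p ` carrier M"
  obtains \<psi> where "\<psi> \<in> module_homs (free_module X) M"
    "\<And>q. q \<in> carrier (free_module X) \<Longrightarrow> p (\<psi> q) = \<phi> q"
proof -
  interpret M: left_module M by fact
  have "\<forall>x\<in>X. \<exists>y\<in>carrier M. p y = \<phi> (single x 1)"
  proof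
    fix x assume "x \<in> X"
    then have "\<phi> (single x 1) \<in> p ` carrier M"
      using sub by (intro subsetD[OF sub] imageI) auto
    then show "\<exists>y\<in>carrier M. p y = \<phi> (single x 1)"
      by force
  qed
  then obtain y where y: "\<And>x. x \<in> X \<Longrightarrow> y x \<in> carrier M"
    and py: "\<And>x. x \<in> X \<Longrightarrow> p (y x) = \<phi> (single x 1)"
    by metis
  define \<psi> where "\<psi> q = (\<Oplus>\<^bsub>M\<^esub>x\<in>keys q. lookup q x \<odot>\<^bsub>M\<^esub> y x)"
    for q :: "'x \<Rightarrow>\<^sub>0 'a"
  \<comment> \<open>Any finite set containing the support gives the same value; a common set makes
    \<open>\<psi>\<close> additive although the supports of two vectors differ.\<close>
  have psi: "\<psi> q = (\<Oplus>\<^bsub>M\<^esub>x\<in>S. lookup q x \<odot>\<^bsub>M\<^esub> y x)"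
    if "finite S" "S \<subseteq> X" "keys q \<subseteq> S" for S q
    unfolding \<psi>_def using that y M.smult_closed M.smult_zero_left
    by (intro M.add.finprod_mono_neutral_cong_left) (auto simp: in_keys_iff subset_iff)
  have psi_hom: "\<psi> \<in> module_homs (free_module X) M"
  proof (rule module_homsI)
    fix q :: "'x \<Rightarrow>\<^sub>0 'a" assume q: "q \<in> carrier (free_module X)"
    then show "\<psi> q \<in> carrier M"
      unfolding \<psi>_def using y M.smult_closed by (intro M.finsum_closed) auto
    fix a
    have "keys (Poly_Mapping.map ((*) a) q) \<subseteq> keys q"
      by (rule keys_map_mult_subset)
    then have "\<psi> (Poly_Mapping.map ((*) a) q) =
      (\<Oplus>\<^bsub>M\<^esub>x\<in>keys q. (a * lookup q x) \<odot>\<^bsub>M\<^esub> y x)"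
      using psi[of "keys q"] q by simp
    also have "\<dots> = (\<Oplus>\<^bsub>M\<^esub>x\<in>keys q. a \<odot>\<^bsub>M\<^esub> (lookup q x \<odot>\<^bsub>M\<^esub> y x))"
      using q y M.smult_closed by (intro M.finsum_cong') (auto simp: M.smult_assoc subset_iff)
    also have "\<dots> = a \<odot>\<^bsub>M\<^esub> \<psi> q"
    proof -
      have "(\<Oplus>\<^bsub>M\<^esub>x\<in>S. a \<odot>\<^bsub>M\<^esub> (lookup q x \<odot>\<^bsub>M\<^esub> y x)) =
        a \<odot>\<^bsub>M\<^esub> (\<Oplus>\<^bsub>M\<^esub>x\<in>S. lookup q x \<odot>\<^bsub>M\<^esub> y x)" if "finite S" "S \<subseteq> X" for S
        using that
      proof (induction S rule: finite_induct)
        case empty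
        have "a \<odot>\<^bsub>M\<^esub> \<zero>\<^bsub>M\<^esub> \<oplus>\<^bsub>M\<^esub> a \<odot>\<^bsub>M\<^esub> \<zero>\<^bsub>M\<^esub> = a \<odot>\<^bsub>M\<^esub> \<zero>\<^bsub>M\<^esub>"
          using M.smult_r_distr[of "\<zero>\<^bsub>M\<^esub>" "\<zero>\<^bsub>M\<^esub>" a] by simp
        then show ?case
          using M.smult_closed[of "\<zero>\<^bsub>M\<^esub>" a] by simp
      next
        case (insert x S)
        have c: "(\<lambda>x. lookup q x \<odot>\<^bsub>M\<^esub> y x) \<in> S \<rightarrow> carrier M"
          "(\<lambda>x. a \<odot>\<^bsub>M\<^esub> (lookup q x \<odot>\<^bsub>M\<^esub> y x)) \<in> S \<rightarrow> carrier M"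
          "lookup q x \<odot>\<^bsub>M\<^esub> y x \<in> carrier M"
          "a \<odot>\<^bsub>M\<^esub> (lookup q x \<odot>\<^bsub>M\<^esub> y x) \<in> carrier M"
          using insert.prems y M.smult_closed by (auto simp: subset_iff)
        show ?case
          using insert c by (simp add: M.smult_r_distr)
      qed
      then show ?thesis
        using q by (simp add: \<psi>_def)
    qed
    finally show "\<psi> (a \<odot>\<^bsub>free_module X\<^esub> q) = a \<odot>\<^bsub>M\<^esub> \<psi> q"
      by simp
    fix q' :: "'x \<Rightarrow>\<^sub>0 'a" assume q': "q' \<in> carrier (free_module X)"
    let ?S = "keys q \<union> keys q'"
    have S: "finite ?S" "?S \<subseteq> X"
      using q q' by auto
    have "\<psi> (q + q') = (\<Oplus>\<^bsub>M\<^esub>x\<in>?S. lookup (q + q') x \<odot>\<^bsub>M\<^esub> y x)"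
      using S keys_add[of q q'] by (intro psi) auto
    also have "\<dots> = (\<Oplus>\<^bsub>M\<^esub>x\<in>?S. lookup q x \<odot>\<^bsub>M\<^esub> y x \<oplus>\<^bsub>M\<^esub> lookup q' x \<odot>\<^bsub>M\<^esub> y x)"
      using S(2) y M.smult_closed by (intro M.finsum_cong') (auto simp: lookup_add M.smult_l_distr subset_iff)
    also have "\<dots> = (\<Oplus>\<^bsub>M\<^esub>x\<in>?S. lookup q x \<odot>\<^bsub>M\<^esub> y x) \<oplus>\<^bsub>M\<^esub> (\<Oplus>\<^bsub>M\<^esub>x\<in>?S. lookup q' x \<odot>\<^bsub>M\<^esub> y x)"
      using S(2) y M.smult_closed by (intro M.finsum_addf) (auto simp: subset_iff)
    also have "\<dots> = \<psi> q \<oplus>\<^bsub>M\<^esub> \<psi> q'"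
      using S psi[of ?S q] psi[of ?S q'] by simp
    finally show "\<psi> (q \<oplus>\<^bsub>free_module X\<^esub> q') = \<psi> q \<oplus>\<^bsub>M\<^esub> \<psi> q'"
      by simp
  qed
  have "p (\<psi> q) = \<phi> q" if q: "q \<in> carrier (free_module X)" for q
  proof (rule module_homs_free_eqI[OF N module_homs_comp[OF psi_hom p] phi _ q])
    fix x assume x: "x \<in> X"
    show "p (\<psi> (single x 1)) = \<phi> (single x 1)"
      using py[OF x] y[OF x] by (simp add: \<psi>_def M.smult_one)
  qed
  with psi_hom show ?thesis
    using that by blast
qed

text \<open>\<open>P\<close> is a retract of a free module: \<open>\<phi>\<close> composed with the
  retraction \<open>r\<close> is lifted on the free module, and the lift is restricted along
  \<open>i\<close>.\<close>

lemma projective_lift: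
  fixes P :: "('a::ring_1, 'm) module"
  assumes P: "projective P" and M: "left_module M" and N: "left_module N"
    and p: "p \<in> module_homs M N" and phi: "\<phi> \<in> module_homs P N"
    and sub: "\<phi> ` carrier P \<subseteq> p ` carrier M"
  obtains \<psi> where "\<psi> \<in> module_homs P M" "\<And>x. x \<in> carrier P \<Longrightarrow> p (\<psi> x) = \<phi> x"
proof -
  from P obtain X :: "'m set" and i r where i: "i \<in> module_homs P (free_module X)"
    and r: "r \<in> module_homs (free_module X) P" and ri: "\<And>x. x \<in> carrier P \<Longrightarrow> r (i x) = x"
    unfolding projective_def by blast
  have phir: "(\<lambda>x. \<phi> (r x)) \<in> module_homs (free_module X) N"
    using r phi by (rule module_homs_comp)
  have "(\<lambda>x. \<phi> (r x)) ` carrier (free_module X) \<subseteq> p ` carrier M"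
    using sub module_homsD(1)[OF r] by (auto simp: image_subset_iff)
  from free_module_lift[OF M N p phir this] obtain \<psi> where
    psi: "\<psi> \<in> module_homs (free_module X) M"
      "\<And>q. q \<in> carrier (free_module X) \<Longrightarrow> p (\<psi> q) = \<phi> (r q)"
    by blast
  show ?thesis
  proof (rule that)
    show "(\<lambda>x. \<psi> (i x)) \<in> module_homs P M"
      using i psi(1) by (rule module_homs_comp)
    show "p (\<psi> (i x)) = \<phi> x" if "x \<in> carrier P" for x
      using psi(2)[OF module_homsD(1)[OF i that]] ri[OF that] by simp
  qed
qed

section \<open>Comparison with a free resolution\<close>

lemma module_homs_diff_free:
  assumes "f \<in> module_homs M (free_module X)" "g \<in> module_homs M (free_module X)"
  shows "(\<lambda>x. f x - g x) \<in> module_homs M (free_module X)"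
proof (rule module_homsI)
  fix x assume "x \<in> carrier M"
  with assms[THEN module_homsD(1), of x] show "f x - g x \<in> carrier (free_module X)"
    using keys_diff[of "f x" "g x"] by (auto simp: in_keys_iff lookup_minus)
qed (use assms in \<open>auto simp: module_homsD lookup_minus lookup_add algebra_simps intro!: poly_mapping_eqI\<close>)

lemma module_homs_add_regular:
  assumes "f \<in> module_homs M regular_module" "g \<in> module_homs M regular_module"
  shows "(\<lambda>x. f x + g x) \<in> module_homs M regular_module"
  using assms by (auto simp: module_homs_def algebra_simps)

lemma module_homs_mult_regular:
  assumes "f \<in> module_homs M regular_module"
  shows "(\<lambda>x. f x * a) \<in> module_homs M regular_module"
  using assms by (auto simp: module_homs_def algebra_simps)

lemma module_homs_carrier_update:
  assumes "S \<subseteq> carrier M" "f \<in> module_homs M N"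
  shows "f \<in> module_homs (M\<lparr>carrier := S\<rparr>) N"
  using assms by (intro module_homsI) (auto simp: module_homsD subset_iff)

section \<open>Dual modules and cohomology classes\<close>

lemma dual_module_simps:
  "f \<in> carrier (dual_module P) \<longleftrightarrow> f \<in> module_homs P regular_module \<and> f \<in> extensional (carrier P)"
  "zero (dual_module P) = (\<lambda>x\<in>carrier P. 0)"
  "add (dual_module P) = (\<lambda>f g. \<lambda>x\<in>carrier P. f x + g x)"
  "smult (dual_module P) = (\<lambda>a f. \<lambda>x\<in>carrier P. f x * a)"
  by (simp_all add: dual_module_def)

lemma restrict_in_dual_module:
  assumes "left_module P" "f \<in> module_homs P regular_module"
  shows "restrict f (carrier P) \<in> carrier (dual_module P)"
proof -
  interpret left_module P by fact
  show ?thesis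
    using assms(2) smult_closed by (auto simp: dual_module_simps module_homs_def)
qed

text \<open>In a trivial quotient the coset of \<open>f\<close> is \<open>B\<close> itself; since
  \<open>B\<close> contains zero, \<open>f\<close> lies in its own coset.\<close>

lemma coset_unique_imp_mem:
  assumes "carrier (quotient_module M B) = {B}" "f \<in> carrier M" "\<zero>\<^bsub>M\<^esub> \<in> B" "\<zero>\<^bsub>M\<^esub> \<oplus>\<^bsub>M\<^esub> f = f"
  shows "f \<in> B"
proof -
  have "B +>\<^bsub>M\<^esub> f \<in> carrier (quotient_module M B)"
    using assms(2) by (auto simp: quotient_module_def A_RCOSETS_def')
  then show ?thesis
    using assms by (force simp: a_r_coset_def')
qed

text \<open>\<open>F\<close> is composed with the quotient map. The laws of \<open>M\<close> are
  listed one by one because the intended \<open>M\<close> consists of homomorphisms into the algebra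
  with the right action; over a noncommutative algebra this violates \<open>smult_assoc\<close> in
  general, so \<open>M\<close> is no \<open>left_module\<close>.\<close>

lemma quotient_module_hom_lift:
  assumes F: "F \<in> module_homs (quotient_module M B) N" "inj_on F (carrier (quotient_module M B))"
    and N: "left_module N"
    and B0: "\<zero>\<^bsub>M\<^esub> \<in> B"
    and Badd: "\<And>b b'. b \<in> B \<Longrightarrow> b' \<in> B \<Longrightarrow> b \<oplus>\<^bsub>M\<^esub> b' \<in> B"
    and Bsmult: "\<And>b a. b \<in> B \<Longrightarrow> a \<odot>\<^bsub>M\<^esub> b \<in> B"
    and M0: "\<zero>\<^bsub>M\<^esub> \<in> carrier M" "\<And>f. f \<in> carrier M \<Longrightarrow> \<zero>\<^bsub>M\<^esub> \<oplus>\<^bsub>M\<^esub> f = f"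
      "\<And>b. b \<in> B \<Longrightarrow> b \<oplus>\<^bsub>M\<^esub> \<zero>\<^bsub>M\<^esub> = b"
    and Madd: "\<And>f g. f \<in> carrier M \<Longrightarrow> g \<in> carrier M \<Longrightarrow> f \<oplus>\<^bsub>M\<^esub> g \<in> carrier M"
    and Msmult: "\<And>f a. f \<in> carrier M \<Longrightarrow> a \<odot>\<^bsub>M\<^esub> f \<in> carrier M"
    and shuffle: "\<And>b f b' g. b \<in> B \<Longrightarrow> f \<in> carrier M \<Longrightarrow> b' \<in> B \<Longrightarrow> g \<in> carrier M \<Longrightarrow>
      (b \<oplus>\<^bsub>M\<^esub> f) \<oplus>\<^bsub>M\<^esub> (b' \<oplus>\<^bsub>M\<^esub> g) = (b \<oplus>\<^bsub>M\<^esub> b') \<oplus>\<^bsub>M\<^esub> (f \<oplus>\<^bsub>M\<^esub> g)"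
    and distr: "\<And>b f b' a. b \<in> B \<Longrightarrow> b' \<in> B \<Longrightarrow> f \<in> carrier M \<Longrightarrow>
      b' \<oplus>\<^bsub>M\<^esub> a \<odot>\<^bsub>M\<^esub> (b \<oplus>\<^bsub>M\<^esub> f) = (b' \<oplus>\<^bsub>M\<^esub> a \<odot>\<^bsub>M\<^esub> b) \<oplus>\<^bsub>M\<^esub> a \<odot>\<^bsub>M\<^esub> f"
  obtains \<phi> where "\<phi> \<in> module_homs M N" "\<And>f. f \<in> carrier M \<Longrightarrow> \<phi> f = \<zero>\<^bsub>N\<^esub> \<Longrightarrow> f \<in> B"
proof (rule that[of "\<lambda>f. F (B +>\<^bsub>M\<^esub> f)"])
  interpret N: left_module N by fact
  have mem: "B +>\<^bsub>M\<^esub> f \<in> carrier (quotient_module M B)" if "f \<in> carrier M" for f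
    using that by (auto simp: quotient_module_def A_RCOSETS_def')
  have B: "B +>\<^bsub>M\<^esub> \<zero>\<^bsub>M\<^esub> = B"
    using M0 by (auto simp: a_r_coset_def')
  show hom: "(\<lambda>f. F (B +>\<^bsub>M\<^esub> f)) \<in> module_homs M N"
  proof (rule module_homsI)
    fix f assume f: "f \<in> carrier M"
    then show "F (B +>\<^bsub>M\<^esub> f) \<in> carrier N"
      using mem module_homsD(1)[OF F(1)] by blast
    fix a
    have "(\<Union>x\<in>B +>\<^bsub>M\<^esub> f. B +>\<^bsub>M\<^esub> (a \<odot>\<^bsub>M\<^esub> x)) = B +>\<^bsub>M\<^esub> (a \<odot>\<^bsub>M\<^esub> f)"
    proof (intro equalityI subsetI)
      fix y assume "y \<in> (\<Union>x\<in>B +>\<^bsub>M\<^esub> f. B +>\<^bsub>M\<^esub> (a \<odot>\<^bsub>M\<^esub> x))"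
      then obtain b b' where "b \<in> B" "b' \<in> B" "y = b' \<oplus>\<^bsub>M\<^esub> a \<odot>\<^bsub>M\<^esub> (b \<oplus>\<^bsub>M\<^esub> f)"
        by (auto simp: a_r_coset_def')
      then show "y \<in> B +>\<^bsub>M\<^esub> (a \<odot>\<^bsub>M\<^esub> f)"
        using distr f Badd Bsmult by (auto simp: a_r_coset_def')
    next
      fix y assume "y \<in> B +>\<^bsub>M\<^esub> (a \<odot>\<^bsub>M\<^esub> f)"
      moreover have "f \<in> B +>\<^bsub>M\<^esub> f"
        using B0 M0(2)[OF f] by (force simp: a_r_coset_def')
      ultimately show "y \<in> (\<Union>x\<in>B +>\<^bsub>M\<^esub> f. B +>\<^bsub>M\<^esub> (a \<odot>\<^bsub>M\<^esub> x))"
        by blast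
    qed
    then show "F (B +>\<^bsub>M\<^esub> (a \<odot>\<^bsub>M\<^esub> f)) = a \<odot>\<^bsub>N\<^esub> F (B +>\<^bsub>M\<^esub> f)"
      using module_homsD(3)[OF F(1) mem[OF f], of a] by (simp add: quotient_module_def)
    fix g assume g: "g \<in> carrier M"
    have "(B +>\<^bsub>M\<^esub> f) <+>\<^bsub>M\<^esub> (B +>\<^bsub>M\<^esub> g) = B +>\<^bsub>M\<^esub> (f \<oplus>\<^bsub>M\<^esub> g)"
    proof (intro equalityI subsetI)
      fix y assume "y \<in> (B +>\<^bsub>M\<^esub> f) <+>\<^bsub>M\<^esub> (B +>\<^bsub>M\<^esub> g)"
      then obtain b b' where "b \<in> B" "b' \<in> B" "y = (b \<oplus>\<^bsub>M\<^esub> f) \<oplus>\<^bsub>M\<^esub> (b' \<oplus>\<^bsub>M\<^esub> g)"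
        by (auto simp: a_r_coset_def' set_add_def')
      then show "y \<in> B +>\<^bsub>M\<^esub> (f \<oplus>\<^bsub>M\<^esub> g)"
        using shuffle f g Badd by (auto simp: a_r_coset_def')
    next
      fix y assume "y \<in> B +>\<^bsub>M\<^esub> (f \<oplus>\<^bsub>M\<^esub> g)"
      then obtain b where b: "b \<in> B" "y = b \<oplus>\<^bsub>M\<^esub> (f \<oplus>\<^bsub>M\<^esub> g)"
        by (auto simp: a_r_coset_def')
      then have "y = (b \<oplus>\<^bsub>M\<^esub> f) \<oplus>\<^bsub>M\<^esub> (\<zero>\<^bsub>M\<^esub> \<oplus>\<^bsub>M\<^esub> g)"
        using shuffle[OF b(1) f B0 g] M0(3) by simp
      then show "y \<in> (B +>\<^bsub>M\<^esub> f) <+>\<^bsub>M\<^esub> (B +>\<^bsub>M\<^esub> g)"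
        using b B0 unfolding a_r_coset_def' set_add_def' by blast
    qed
    then show "F (B +>\<^bsub>M\<^esub> (f \<oplus>\<^bsub>M\<^esub> g)) = F (B +>\<^bsub>M\<^esub> f) \<oplus>\<^bsub>N\<^esub> F (B +>\<^bsub>M\<^esub> g)"
      using module_homsD(2)[OF F(1) mem[OF f] mem[OF g]] by (simp add: quotient_module_def)
  qed
  fix f assume f: "f \<in> carrier M" and "F (B +>\<^bsub>M\<^esub> f) = \<zero>\<^bsub>N\<^esub>"
  \<comment> \<open>\<open>B\<close> is the coset of zero, so \<open>F B\<close> added to itself is
    \<open>F B\<close>, which forces it to be zero; injectivity of \<open>F\<close> then compares
    cosets.\<close>
  moreover have "F B \<oplus>\<^bsub>N\<^esub> F B = F B" "F B \<in> carrier N"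
    using module_homsD(2)[OF hom M0(1) M0(1)] module_homsD(1)[OF hom M0(1)] M0 by (simp_all add: B)
  then have "F B = \<zero>\<^bsub>N\<^esub>"
    by simp
  ultimately have "B +>\<^bsub>M\<^esub> f = B"
    using inj_onD[OF F(2), of "B +>\<^bsub>M\<^esub> f" B] mem[OF f] mem[OF M0(1)] by (simp add: B)
  then show "f \<in> B"
    using B0 M0(2)[OF f] by (force simp: a_r_coset_def')
qed

lemma projective_imp_left_module: "projective P \<Longrightarrow> left_module P"
  by (simp add: projective_def)

lemma cocycle_is_coboundary:
  assumes P: "left_module (P i)"
    and triv: "carrier (quotient_module ((dual_module (P i))\<lparr>carrier := cocycles P d i\<rparr>) (coboundaries P d i)) =
      {coboundaries P d i}"
    and zero: "(\<lambda>x\<in>carrier (P i). 0) \<in> coboundaries P d i"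
    and f: "f \<in> cocycles P d i"
  shows "f \<in> coboundaries P d i"
proof (rule coset_unique_imp_mem[OF triv])
  show "f \<in> carrier (dual_module (P i)\<lparr>carrier := cocycles P d i\<rparr>)"
    using f by simp
  show "\<zero>\<^bsub>dual_module (P i)\<lparr>carrier := cocycles P d i\<rparr>\<^esub> \<in> coboundaries P d i"
    using zero by (simp add: dual_module_simps)
  have "f \<in> extensional (carrier (P i))"
    using f by (simp add: cocycles_def dual_module_simps)
  then show "\<zero>\<^bsub>dual_module (P i)\<lparr>carrier := cocycles P d i\<rparr>\<^esub> \<oplus>\<^bsub>dual_module (P i)\<lparr>carrier := cocycles P d i\<rparr>\<^esub> f = f"
    by (auto simp: dual_module_simps extensional_def fun_eq_iff)
qed

lemma coboundaries_Suc_iff: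
  "c \<in> coboundaries P d (Suc i) \<longleftrightarrow>
    (\<exists>b \<in> carrier (dual_module (P i)). c = (\<lambda>x\<in>carrier (P (Suc i)). b (d i x)))"
  by auto

declare coboundaries.simps(2) [simp del]

lemma zero_in_coboundaries:
  assumes "\<And>i. left_module (P i)" "\<And>i. d i \<in> module_homs (P (Suc i)) (P i)"
  shows "(\<lambda>x\<in>carrier (P i). 0) \<in> coboundaries P d i"
proof (cases i)
  case 0
  then show ?thesis
    by (simp add: dual_module_simps)
next
  case (Suc j)
  have "(\<lambda>x\<in>carrier (P j). 0) \<in> carrier (dual_module (P j))"
    by (rule restrict_in_dual_module[OF assms(1)]) (auto simp: module_homs_def)
  moreover have "(\<lambda>x\<in>carrier (P (Suc j)). 0) = (\<lambda>x\<in>carrier (P (Suc j)). (\<lambda>x\<in>carrier (P j). 0) (d j x))"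
    using module_homsD(1)[OF assms(2)[of j]] by (auto simp: fun_eq_iff)
  ultimately show ?thesis
    unfolding Suc coboundaries_Suc_iff by blast
qed

text \<open>The isomorphism of the Ext quotient becomes a map on cocycles whose kernel consists of
  coboundaries. Working with representatives keeps cosets out of the rest of the proof.\<close>

lemma Ext_class_map:
  fixes P :: "nat \<Rightarrow> ('a::ring_1, 'u) module" and N :: "('a, 'n) module"
  assumes P: "\<And>i. left_module (P i)" and d: "\<And>i. d i \<in> module_homs (P (Suc i)) (P i)"
    and F: "modules_isomorphic
      (quotient_module ((dual_module (P (Suc i)))\<lparr>carrier := cocycles P d (Suc i)\<rparr>) (coboundaries P d (Suc i))) N"
    and N: "left_module N"
  obtains \<phi> where "\<phi> \<in> module_homs ((dual_module (P (Suc i)))\<lparr>carrier := cocycles P d (Suc i)\<rparr>) N"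
    "\<And>f. f \<in> cocycles P d (Suc i) \<Longrightarrow> \<phi> f = \<zero>\<^bsub>N\<^esub> \<Longrightarrow> f \<in> coboundaries P d (Suc i)"
proof -
  let ?Z = "cocycles P d (Suc i)" and ?B = "coboundaries P d (Suc i)"
  let ?M = "(dual_module (P (Suc i)))\<lparr>carrier := ?Z\<rparr>"
  interpret P: left_module "P (Suc i)"
    by (rule P)
  interpret P2: left_module "P (Suc (Suc i))"
    by (rule P)
  interpret P0: left_module "P i"
    by (rule P)
  note dc = module_homsD(1)[OF d]
  have extB: "b \<in> extensional (carrier (P (Suc i)))" if "b \<in> ?B" for b
    using that by (auto simp: coboundaries_Suc_iff)
  have extZ: "b \<in> extensional (carrier (P (Suc i)))" if "b \<in> ?Z" for b
    using that by (auto simp: cocycles_def dual_module_simps)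
  obtain F where F: "F \<in> module_homs (quotient_module ?M ?B) N" "inj_on F (carrier (quotient_module ?M ?B))"
    using F by (auto simp: modules_isomorphic_def bij_betw_def)
  have Badd: "b \<oplus>\<^bsub>?M\<^esub> b' \<in> ?B" if b: "b \<in> ?B" "b' \<in> ?B" for b b'
  proof -
    obtain c c' where c: "c \<in> carrier (dual_module (P i))" "b = (\<lambda>x\<in>carrier (P (Suc i)). c (d i x))"
      "c' \<in> carrier (dual_module (P i))" "b' = (\<lambda>x\<in>carrier (P (Suc i)). c' (d i x))"
      using b unfolding coboundaries_Suc_iff by blast
    then show ?thesis
      unfolding coboundaries_Suc_iff
      by (intro bexI[of _ "restrict (\<lambda>x. c x + c' x) (carrier (P i))"]
          restrict_in_dual_module module_homs_add_regular P)
        (auto simp: dual_module_simps dc)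
  qed
  have Bsm: "a \<odot>\<^bsub>?M\<^esub> b \<in> ?B" if b: "b \<in> ?B" for b a
  proof -
    obtain c where c: "c \<in> carrier (dual_module (P i))" "b = (\<lambda>x\<in>carrier (P (Suc i)). c (d i x))"
      using b unfolding coboundaries_Suc_iff by blast
    then show ?thesis
      unfolding coboundaries_Suc_iff
      by (intro bexI[of _ "restrict (\<lambda>x. c x * a) (carrier (P i))"]
          restrict_in_dual_module module_homs_mult_regular P)
        (auto simp: dual_module_simps dc)
  qed
  have Zadd: "f \<oplus>\<^bsub>?M\<^esub> g \<in> ?Z" if "f \<in> ?Z" "g \<in> ?Z" for f g
    using that restrict_in_dual_module[OF P[of "Suc i"] module_homs_add_regular[of f _ g]]
    by (auto simp: cocycles_def dual_module_simps dc)
  have Zsm: "a \<odot>\<^bsub>?M\<^esub> f \<in> ?Z" if "f \<in> ?Z" for f a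
    using that restrict_in_dual_module[OF P[of "Suc i"] module_homs_mult_regular[of f]]
    by (auto simp: cocycles_def dual_module_simps dc)
  have Z0: "\<zero>\<^bsub>?M\<^esub> \<in> ?Z"
  proof -
    have "(\<lambda>x\<in>carrier (P (Suc i)). 0) \<in> carrier (dual_module (P (Suc i)))"
      by (rule restrict_in_dual_module[OF P]) (auto simp: module_homs_def)
    then show ?thesis
      by (simp add: cocycles_def dual_module_simps dc)
  qed
  show ?thesis
  proof (rule quotient_module_hom_lift[OF F N])
    show "\<zero>\<^bsub>?M\<^esub> \<in> ?B"
      using zero_in_coboundaries[of P d "Suc i", OF P d] by (simp add: dual_module_simps)
    show "b \<oplus>\<^bsub>?M\<^esub> \<zero>\<^bsub>?M\<^esub> = b" if "b \<in> ?B" for b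
      using extB[OF that] by (auto simp: dual_module_simps extensional_def fun_eq_iff)
    show "\<zero>\<^bsub>?M\<^esub> \<oplus>\<^bsub>?M\<^esub> f = f" if "f \<in> carrier ?M" for f
      using extZ[of f] that by (auto simp: dual_module_simps extensional_def fun_eq_iff)
    fix b f b' g a
    show "(b \<oplus>\<^bsub>?M\<^esub> f) \<oplus>\<^bsub>?M\<^esub> (b' \<oplus>\<^bsub>?M\<^esub> g) = (b \<oplus>\<^bsub>?M\<^esub> b') \<oplus>\<^bsub>?M\<^esub> (f \<oplus>\<^bsub>?M\<^esub> g)"
      by (auto simp: dual_module_simps fun_eq_iff algebra_simps)
    show "b' \<oplus>\<^bsub>?M\<^esub> a \<odot>\<^bsub>?M\<^esub> (b \<oplus>\<^bsub>?M\<^esub> f) = (b' \<oplus>\<^bsub>?M\<^esub> a \<odot>\<^bsub>?M\<^esub> b) \<oplus>\<^bsub>?M\<^esub> a \<odot>\<^bsub>?M\<^esub> f"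
      by (auto simp: dual_module_simps fun_eq_iff algebra_simps)
  qed (use Badd Bsm Zadd Zsm Z0 that in auto)
qed

section \<open>Chain maps and homotopies between two resolutions\<close>

locale free_resolution =
  fixes M :: "('a::ring_1, 'm) module" and X0 X1 X2 :: "'x set"
    and d1 d2 :: "('x \<Rightarrow>\<^sub>0 'a) \<Rightarrow> ('x \<Rightarrow>\<^sub>0 'a)" and e :: "('x \<Rightarrow>\<^sub>0 'a) \<Rightarrow> 'm"
  assumes M: "left_module M"
    and e: "e \<in> module_homs (free_module X0) M"
    and d1: "d1 \<in> module_homs (free_module X1) (free_module X0)"
    and d2: "d2 \<in> module_homs (free_module X2) (free_module X1)"
    and e_onto: "e ` carrier (free_module X0) = carrier M"
    and exact0: "{q \<in> carrier (free_module X0). e q = \<zero>\<^bsub>M\<^esub>} = d1 ` carrier (free_module X1)"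
    and exact1: "{q \<in> carrier (free_module X1). d1 q = 0} = d2 ` carrier (free_module X2)"
begin

abbreviation F0 :: "('a, 'x \<Rightarrow>\<^sub>0 'a) module" where "F0 \<equiv> free_module X0"
abbreviation F1 :: "('a, 'x \<Rightarrow>\<^sub>0 'a) module" where "F1 \<equiv> free_module X1"
abbreviation F2 :: "('a, 'x \<Rightarrow>\<^sub>0 'a) module" where "F2 \<equiv> free_module X2"

text \<open>The module \<Omega>, the kernel at which the free complex stops.\<close>

definition syzygies :: "('x \<Rightarrow>\<^sub>0 'a) set" where
  "syzygies = {q \<in> carrier F2. d2 q = 0}"

abbreviation syzygy_module :: "('a, 'x \<Rightarrow>\<^sub>0 'a) module" where
  "syzygy_module \<equiv> F2\<lparr>carrier := syzygies\<rparr>"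

lemma e_d1 [simp]: "q \<in> carrier F1 \<Longrightarrow> e (d1 q) = \<zero>\<^bsub>M\<^esub>"
  using exact0 by blast

lemma d1_d2 [simp]: "q \<in> carrier F2 \<Longrightarrow> d1 (d2 q) = 0"
  using exact1 by blast

end

text \<open>The \<open>f\<close> and \<open>g\<close> are chain maps over the identity of
  \<open>M\<close>; \<open>h0\<close> and \<open>h1\<close> are a homotopy between the identity and
  \<open>f\<close> after \<open>g\<close> on the free side. A cochain on the free modules is pulled
  back along \<open>f\<close>, treated in \<open>P\<close> and brought back along \<open>g\<close>;
  the homotopy accounts for the difference from the original.\<close>

locale resolution_comparison = free_resolution M X0 X1 X2 d1 d2 e
  for M :: "('a::ring_1, 'm) module" and X0 X1 X2 :: "'x set"
    and d1 d2 :: "('x \<Rightarrow>\<^sub>0 'a) \<Rightarrow> ('x \<Rightarrow>\<^sub>0 'a)" and e :: "('x \<Rightarrow>\<^sub>0 'a) \<Rightarrow> 'm" +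
  fixes P :: "nat \<Rightarrow> ('a, 'u) module" and d :: "nat \<Rightarrow> 'u \<Rightarrow> 'u" and eP :: "'u \<Rightarrow> 'm"
    and f0 f1 f2 :: "'u \<Rightarrow> ('x \<Rightarrow>\<^sub>0 'a)" and g0 g1 g2 :: "('x \<Rightarrow>\<^sub>0 'a) \<Rightarrow> 'u"
    and h0 h1 :: "('x \<Rightarrow>\<^sub>0 'a) \<Rightarrow> ('x \<Rightarrow>\<^sub>0 'a)"
  assumes res: "projective_resolution M P d eP"
    and f0: "f0 \<in> module_homs (P 0) F0"
    and f1: "f1 \<in> module_homs (P 1) F1"
    and f2: "f2 \<in> module_homs (P 2) F2"
    and g0: "g0 \<in> module_homs F0 (P 0)"
    and g1: "g1 \<in> module_homs F1 (P 1)"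
    and g2: "g2 \<in> module_homs F2 (P 2)"
    and h0: "h0 \<in> module_homs F0 F1"
    and h1: "h1 \<in> module_homs F1 F2"
    and e_f0: "\<And>x. x \<in> carrier (P 0) \<Longrightarrow> e (f0 x) = eP x"
    and d1_f1: "\<And>x. x \<in> carrier (P 1) \<Longrightarrow> d1 (f1 x) = f0 (d 0 x)"
    and d2_f2: "\<And>x. x \<in> carrier (P 2) \<Longrightarrow> d2 (f2 x) = f1 (d 1 x)"
    and d_g1: "\<And>q. q \<in> carrier F1 \<Longrightarrow> d 0 (g1 q) = g0 (d1 q)"
    and d_g2: "\<And>q. q \<in> carrier F2 \<Longrightarrow> d 1 (g2 q) = g1 (d2 q)"
    and d1_h0: "\<And>q. q \<in> carrier F0 \<Longrightarrow> d1 (h0 q) = q - f0 (g0 q)"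
    and d2_h1: "\<And>q. q \<in> carrier F1 \<Longrightarrow> d2 (h1 q) = q - f1 (g1 q) - h0 (d1 q)"

text \<open>Each map is lifted along the next differential: what has to be lifted lands in a kernel,
  and exactness identifies that kernel with an image. The sources are projective for the
  \<open>f\<close> and free for the \<open>g\<close> and \<open>h\<close>.\<close>

lemma (in free_resolution) comparison_exists:
  fixes P :: "nat \<Rightarrow> ('a, 'u) module"
  assumes res: "projective_resolution M P d eP"
  obtains f0 f1 f2 g0 g1 g2 h0 h1 where
    "resolution_comparison M X0 X1 X2 d1 d2 e P d eP f0 f1 f2 g0 g1 g2 h0 h1"
proof -
  note F = left_module_free_module
  have proj: "projective (P i)" for i
    using res by (simp add: projective_resolution_def)
  note P = projective_imp_left_module[OF proj]
  have eP: "eP \<in> module_homs (P 0) M" and eP_onto: "eP ` carrier (P 0) = carrier M"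
    using res by (simp_all add: projective_resolution_def)
  have d0: "d 0 \<in> module_homs (P 1) (P 0)" and dd1: "d 1 \<in> module_homs (P 2) (P 1)"
    using res by (simp_all add: projective_resolution_def numeral_2_eq_2)
  have k0: "{x \<in> carrier (P 0). eP x = \<zero>\<^bsub>M\<^esub>} = d 0 ` carrier (P 1)"
    using res by (simp add: projective_resolution_def)
  have k1: "{x \<in> carrier (P 1). d 0 x = \<zero>\<^bsub>P 0\<^esub>} = d 1 ` carrier (P 2)"
    using res unfolding projective_resolution_def by (auto simp: numeral_2_eq_2)
  obtain f0 where f0: "f0 \<in> module_homs (P 0) F0" "\<And>x. x \<in> carrier (P 0) \<Longrightarrow> e (f0 x) = eP x"
    by (rule projective_lift[OF proj F M e eP]) (use e_onto eP_onto in auto)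
  have "f0 (d 0 x) \<in> d1 ` carrier F1" if "x \<in> carrier (P 1)" for x
  proof -
    have "d 0 x \<in> {x \<in> carrier (P 0). eP x = \<zero>\<^bsub>M\<^esub>}"
      using k0 that by blast
    then have "f0 (d 0 x) \<in> {q \<in> carrier F0. e q = \<zero>\<^bsub>M\<^esub>}"
      using f0(2) module_homsD(1)[OF f0(1)] by auto
    then show ?thesis
      unfolding exact0 .
  qed
  then obtain f1 where f1: "f1 \<in> module_homs (P 1) F1" "\<And>x. x \<in> carrier (P 1) \<Longrightarrow> d1 (f1 x) = f0 (d 0 x)"
    using projective_lift[OF proj F F d1 module_homs_comp[OF d0 f0(1)]] by (metis image_subsetI)
  have "f1 (d 1 x) \<in> d2 ` carrier F2" if "x \<in> carrier (P 2)" for x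
  proof -
    have "d 1 x \<in> {x \<in> carrier (P 1). d 0 x = \<zero>\<^bsub>P 0\<^esub>}"
      using k1 that by blast
    then have "f1 (d 1 x) \<in> {q \<in> carrier F1. d1 q = 0}"
      using f1(2) module_homsD(1)[OF f1(1)] module_homs_zero[OF P F f0(1)] by auto
    then show ?thesis
      unfolding exact1 .
  qed
  then obtain f2 where f2: "f2 \<in> module_homs (P 2) F2" "\<And>x. x \<in> carrier (P 2) \<Longrightarrow> d2 (f2 x) = f1 (d 1 x)"
    using projective_lift[OF proj F F d2 module_homs_comp[OF dd1 f1(1)]] by (metis image_subsetI)
  obtain g0 where g0: "g0 \<in> module_homs F0 (P 0)" "\<And>q. q \<in> carrier F0 \<Longrightarrow> eP (g0 q) = e q"
    by (rule free_module_lift[OF P M eP e]) (use e_onto eP_onto in auto)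
  have "g0 (d1 q) \<in> d 0 ` carrier (P 1)" if "q \<in> carrier F1" for q
    using g0(2)[OF module_homsD(1)[OF d1 that]] e_d1[OF that]
      module_homsD(1)[OF g0(1) module_homsD(1)[OF d1 that]] unfolding k0[symmetric] by simp
  then obtain g1 where g1: "g1 \<in> module_homs F1 (P 1)" "\<And>q. q \<in> carrier F1 \<Longrightarrow> d 0 (g1 q) = g0 (d1 q)"
    using free_module_lift[OF P P d0 module_homs_comp[OF d1 g0(1)]] by (metis image_subsetI)
  have "g1 (d2 q) \<in> d 1 ` carrier (P 2)" if "q \<in> carrier F2" for q
    using g1(2)[OF module_homsD(1)[OF d2 that]] d1_d2[OF that] module_homs_zero[OF F P g0(1)]
      module_homsD(1)[OF g1(1) module_homsD(1)[OF d2 that]] unfolding k1[symmetric] by simp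
  then obtain g2 where g2: "g2 \<in> module_homs F2 (P 2)" "\<And>q. q \<in> carrier F2 \<Longrightarrow> d 1 (g2 q) = g1 (d2 q)"
    using free_module_lift[OF P P dd1 module_homs_comp[OF d2 g1(1)]] by (metis image_subsetI)
  have id: "(\<lambda>q. q) \<in> module_homs (free_module X) (free_module X :: ('a, 'x \<Rightarrow>\<^sub>0 'a) module)" for X
    by (simp add: module_homs_def)
  have zero: "f (x - y) = 0" if "f x = f y" "f \<in> module_homs (free_module X) (free_module Y)"
    "x \<in> carrier (free_module X)" "y \<in> carrier (free_module X)"
    for f :: "('x \<Rightarrow>\<^sub>0 'a) \<Rightarrow> ('x \<Rightarrow>\<^sub>0 'a)" and x y X Y
  proof -
    have m: "x - y \<in> carrier (free_module X)"
      using that(3,4) keys_diff[of x y] by auto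
    have "f ((x - y) + y) = f (x - y) + f y"
      using module_homsD(2)[OF that(2) m that(4)] by simp
    then show ?thesis
      using that(1) by simp
  qed
  have m0: "q - f0 (g0 q) \<in> carrier F0" if "q \<in> carrier F0" for q
    using module_homsD(1)[OF module_homs_diff_free[OF id module_homs_comp[OF g0(1) f0(1)]] that] .
  have "q - f0 (g0 q) \<in> d1 ` carrier F1" if q: "q \<in> carrier F0" for q
  proof -
    have fg: "f0 (g0 q) \<in> carrier F0"
      using module_homsD(1)[OF f0(1)] module_homsD(1)[OF g0(1) q] by blast
    have eq: "e (f0 (g0 q)) = e q"
      using f0 g0 q module_homsD(1)[OF g0(1) q] by simp
    interpret M: left_module M
      by (rule M)
    have "e ((q - f0 (g0 q)) + f0 (g0 q)) = e (q - f0 (g0 q)) \<oplus>\<^bsub>M\<^esub> e (f0 (g0 q))"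
      using module_homsD(2)[OF e m0[OF q] fg] by simp
    then have "e q = e (q - f0 (g0 q)) \<oplus>\<^bsub>M\<^esub> e q"
      by (simp add: eq)
    then have "e (q - f0 (g0 q)) = \<zero>\<^bsub>M\<^esub>"
      using module_homsD(1)[OF e] q m0[OF q] by (metis M.add.r_cancel_one')
    then show ?thesis
      using m0[OF q] unfolding exact0[symmetric] by simp
  qed
  then have "(\<lambda>q. q - f0 (g0 q)) ` carrier F0 \<subseteq> d1 ` carrier F1"
    by (rule image_subsetI)
  from free_module_lift[OF F F d1 module_homs_diff_free[OF id module_homs_comp[OF g0(1) f0(1)]] this]
  obtain h0 where h0: "h0 \<in> module_homs F0 F1"
    "\<And>q. q \<in> carrier F0 \<Longrightarrow> d1 (h0 q) = q - f0 (g0 q)"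
    by blast
  \<comment> \<open>The part of the identity not explained by \<open>f1\<close>, \<open>g1\<close>
    and \<open>h0\<close>. Its values are cycles, since \<open>d1\<close> turns
    \<open>h0 (d1 q)\<close> into \<open>d1 q - f0 (g0 (d1 q))\<close>.\<close>
  let ?k = "\<lambda>q. q - f1 (g1 q) - h0 (d1 q)"
  have k: "?k \<in> module_homs F1 F1"
    by (intro module_homs_diff_free id module_homs_comp[OF g1(1) f1(1)] module_homs_comp[OF d1 h0(1)])
  have "?k q \<in> d2 ` carrier F2" if q: "q \<in> carrier F1" for q
  proof -
    have g: "g1 q \<in> carrier (P 1)"
      using module_homsD(1)[OF g1(1) q] .
    have fg: "f1 (g1 q) \<in> carrier F1"
      using module_homsD(1)[OF f1(1) g] .
    have dq: "d1 q \<in> carrier F0" "h0 (d1 q) \<in> carrier F1"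
      using module_homsD(1)[OF d1 q] module_homsD(1)[OF h0(1)] by blast+
    have m: "q - f1 (g1 q) \<in> carrier F1"
      using q fg keys_diff[of q "f1 (g1 q)"] by auto
    have "d1 (q - f1 (g1 q)) + d1 (f1 (g1 q)) = d1 ((q - f1 (g1 q)) + f1 (g1 q))"
      using module_homsD(2)[OF d1 m fg] by simp
    then have "d1 (q - f1 (g1 q)) = d1 q - f0 (g0 (d1 q))"
      using f1(2)[OF g] g1(2)[OF q] by (simp add: algebra_simps)
    then have "d1 (?k q) = 0"
      using h0(2)[OF dq(1)] by (intro zero[OF _ d1 m dq(2)]) simp
    then show ?thesis
      using module_homsD(1)[OF k q] unfolding exact1[symmetric] by simp
  qed
  then have "?k ` carrier F1 \<subseteq> d2 ` carrier F2"
    by (rule image_subsetI)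
  from free_module_lift[OF F F d2 k this]
  obtain h1 where h1: "h1 \<in> module_homs F1 F2" "\<And>q. q \<in> carrier F1 \<Longrightarrow> d2 (h1 q) = ?k q"
    by blast
  have "resolution_comparison M X0 X1 X2 d1 d2 e P d eP f0 f1 f2 g0 g1 g2 h0 h1"
    by (intro resolution_comparison.intro resolution_comparison_axioms.intro free_resolution_axioms res
        f0 f1 f2 g0 g1 g2 h0 h1)
  then show ?thesis
    by (rule that)
qed

context resolution_comparison
begin

lemma proj: "projective (P i)"
  using res by (simp add: projective_resolution_def)

lemma left_module_P: "left_module (P i)"
  by (rule projective_imp_left_module[OF proj])

lemma d: "d i \<in> module_homs (P (Suc i)) (P i)"
  using res by (simp add: projective_resolution_def)

lemma exact_d: "{x \<in> carrier (P (Suc i)). d i x = \<zero>\<^bsub>P i\<^esub>} = d (Suc i) ` carrier (P (Suc (Suc i)))"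
  using res by (simp add: projective_resolution_def)

lemmas maps_closed = module_homsD(1)[OF f0] module_homsD(1)[OF f1] module_homsD(1)[OF f2]
  module_homsD(1)[OF g0] module_homsD(1)[OF g1] module_homsD(1)[OF g2]
  module_homsD(1)[OF h0] module_homsD(1)[OF h1] module_homsD(1)[OF d1] module_homsD(1)[OF d2]
  module_homsD(1)[OF d]

lemma decomp0: "q \<in> carrier F0 \<Longrightarrow> q = f0 (g0 q) + d1 (h0 q)"
  using d1_h0[of q] by simp

lemma decomp1: "q \<in> carrier F1 \<Longrightarrow> q = f1 (g1 q) + (d2 (h1 q) + h0 (d1 q))"
  using d2_h1[of q] by simp

text \<open>The defect of the homotopy at the last free module. Its values are syzygies
  (\<open>d2_h2\<close>), so it acts as a map from \<open>F2\<close> to \<Omega> that completes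
  every comparison in degree 2.\<close>

definition h2 where "h2 q = q - f2 (g2 q) - h1 (d2 q)"

lemma decomp2: "q = f2 (g2 q) + (h2 q + h1 (d2 q))"
  by (simp add: h2_def)

lemma h2: "h2 \<in> module_homs F2 F2"
proof -
  have "(\<lambda>q. q) \<in> module_homs F2 (free_module X2 :: ('a, 'x \<Rightarrow>\<^sub>0 'a) module)"
    by (simp add: module_homs_def)
  then have "(\<lambda>q. q - f2 (g2 q) - h1 (d2 q)) \<in> module_homs F2 F2"
    by (intro module_homs_diff_free module_homs_comp[OF g2 f2] module_homs_comp[OF d2 h1])
  then show ?thesis
    by (simp add: h2_def[abs_def])
qed

lemma d2_h2: "q \<in> carrier F2 \<Longrightarrow> d2 (h2 q) = 0"
proof -
  assume q: "q \<in> carrier F2"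
  have "d2 (f2 (g2 q) + (h2 q + h1 (d2 q))) = d2 (f2 (g2 q)) + (d2 (h2 q) + d2 (h1 (d2 q)))"
  proof -
    have c: "f2 (g2 q) \<in> carrier F2" "h2 q \<in> carrier F2"
      "h1 (d2 q) \<in> carrier F2"
      by (intro maps_closed q module_homsD(1)[OF h2])+
    then have "h2 q + h1 (d2 q) \<in> carrier F2"
      using keys_add[of "h2 q" "h1 (d2 q)"] by auto
    then show ?thesis
      using module_homsD(2)[OF d2 c(1)] module_homsD(2)[OF d2 c(2,3)] by simp
  qed
  moreover have "h0 (d1 (d2 q)) = 0"
    using q module_homs_zero[OF left_module_free_module left_module_free_module h0] by simp
  moreover have "d2 (f2 (g2 q)) = f1 (g1 (d2 q))"
    using d2_f2[OF maps_closed(6)[OF q]] d_g2[OF q] by simp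
  moreover have "d2 (h1 (d2 q)) = d2 q - f1 (g1 (d2 q)) - h0 (d1 (d2 q))"
    by (rule d2_h1[OF maps_closed(10)[OF q]])
  ultimately show ?thesis
    by (simp flip: decomp2)
qed

lemma f2_d_in_syzygies: "x \<in> carrier (P 3) \<Longrightarrow> f2 (d 2 x) \<in> syzygies"
proof -
  assume x: "x \<in> carrier (P 3)"
  then have "d 2 x \<in> carrier (P 2)" "d 1 (d 2 x) = \<zero>\<^bsub>P 1\<^esub>"
    using exact_d[of 1] by (auto simp: numeral_2_eq_2 numeral_3_eq_3)
  then show ?thesis
    using maps_closed(3) d2_f2 module_homs_zero[OF left_module_P left_module_free_module f1] by (simp add: syzygies_def)
qed

lemma g2_syzygies: "q \<in> syzygies \<Longrightarrow> \<exists>y\<in>carrier (P 3). g2 q = d 2 y"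
proof -
  assume q: "q \<in> syzygies"
  then have "g2 q \<in> carrier (P 2)" "d 1 (g2 q) = \<zero>\<^bsub>P 1\<^esub>"
    using maps_closed(6)[of q] d_g2[of q] module_homs_zero[OF left_module_free_module left_module_P g1]
    by (simp_all add: syzygies_def)
  then show ?thesis
    using exact_d[of 1] by (auto simp: numeral_2_eq_2 numeral_3_eq_3)
qed

lemma syzygies_decomp: "q \<in> syzygies \<Longrightarrow> q = f2 (g2 q) + h2 q"
  using decomp2[of q] module_homs_zero[OF left_module_free_module left_module_free_module h1]
  by (simp add: syzygies_def)

text \<open>\<open>b\<close> after \<open>f0\<close> is a cocycle, hence zero, and by
  \<open>decomp0\<close> the rest of \<open>b q\<close> is a value of \<open>b\<close> on the image
  of \<open>d1\<close>.\<close>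

lemma hom_free_zero:
  assumes "cocycles P d 0 \<subseteq> coboundaries P d 0"
    and b: "b \<in> module_homs F0 regular_module"
    and bd: "\<And>q. q \<in> carrier F1 \<Longrightarrow> b (d1 q) = 0"
    and q: "q \<in> carrier F0"
  shows "b q = 0"
proof -
  let ?c = "restrict (\<lambda>x. b (f0 x)) (carrier (P 0))"
  have "b (f0 (d 0 x)) = 0" if x: "x \<in> carrier (P (Suc 0))" for x
    using bd[OF maps_closed(2), of x] d1_f1[of x] x by simp
  then have "?c \<in> cocycles P d 0"
    using restrict_in_dual_module[OF left_module_P module_homs_comp[OF f0 b]] maps_closed(11)[of _ 0]
    by (auto simp: cocycles_def)
  with assms(1) have "?c = (\<lambda>x\<in>carrier (P 0). 0)"
    by (auto simp: dual_module_simps)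
  then have "b (f0 (g0 q)) = 0"
    using maps_closed(4)[OF q] by (metis restrict_apply')
  moreover have "b q = b (f0 (g0 q)) + b (d1 (h0 q))"
    using decomp0[OF q] module_homsD(2)[OF b maps_closed(1)[OF maps_closed(4)[OF q]] maps_closed(9)[OF maps_closed(7)[OF q]]] by simp
  ultimately show ?thesis
    using bd maps_closed(7)[OF q] by simp
qed

text \<open>\<open>b\<close> after \<open>f1\<close> is a coboundary, say \<open>c\<close> after
  \<open>d 0\<close>. As \<open>b\<close> vanishes on the image of \<open>d2\<close>,
  \<open>decomp1\<close> shows that \<open>c\<close> after \<open>g0\<close> plus \<open>b\<close>
  after \<open>h0\<close> is a factorization.\<close>

lemma hom_free_factor1:
  assumes "cocycles P d 1 \<subseteq> coboundaries P d 1"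
    and b: "b \<in> module_homs F1 regular_module"
    and bd: "\<And>q. q \<in> carrier F2 \<Longrightarrow> b (d2 q) = 0"
  obtains b' where "b' \<in> module_homs F0 regular_module"
    "\<And>q. q \<in> carrier F1 \<Longrightarrow> b q = b' (d1 q)"
proof -
  let ?c = "restrict (\<lambda>x. b (f1 x)) (carrier (P 1))"
  have "b (f1 (d 1 x)) = 0" if x: "x \<in> carrier (P 2)" for x
    using bd[OF maps_closed(3), of x] d2_f2[of x] x by simp
  then have "?c \<in> cocycles P d 1"
    using restrict_in_dual_module[OF left_module_P module_homs_comp[OF f1 b]] maps_closed(11)[of _ 1]
    by (auto simp: cocycles_def numeral_2_eq_2)
  with assms(1) obtain c where c: "c \<in> carrier (dual_module (P 0))"
    "?c = (\<lambda>x\<in>carrier (P 1). c (d 0 x))"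
    unfolding One_nat_def using coboundaries_Suc_iff[of ?c P d 0] by auto
  then have c': "c \<in> module_homs (P 0) regular_module"
    by (simp add: dual_module_simps)
  show ?thesis
  proof (rule that)
    show "(\<lambda>q. c (g0 q) + b (h0 q)) \<in> module_homs F0 regular_module"
      by (intro module_homs_add_regular module_homs_comp[OF g0 c'] module_homs_comp[OF h0 b])
    fix q :: "'x \<Rightarrow>\<^sub>0 'a" assume q: "q \<in> carrier F1"
    have c1: "f1 (g1 q) \<in> carrier F1" "d2 (h1 q) \<in> carrier F1"
      "h0 (d1 q) \<in> carrier F1"
      by (intro maps_closed q)+
    then have c2: "d2 (h1 q) + h0 (d1 q) \<in> carrier F1"
      using keys_add[of "d2 (h1 q)" "h0 (d1 q)"] by auto
    have "b (f1 (g1 q)) = c (d 0 (g1 q))"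
      using fun_cong[OF c(2), of "g1 q"] maps_closed(5)[OF q] by simp
    moreover have "b q = b (f1 (g1 q)) + (b (d2 (h1 q)) + b (h0 (d1 q)))"
      using decomp1[OF q] module_homsD(2)[OF b c1(1) c2] module_homsD(2)[OF b c1(2,3)] by simp
    ultimately show "b q = c (g0 (d1 q)) + b (h0 (d1 q))"
      using bd[OF maps_closed(8)[OF q]] d_g1[OF q] by simp
  qed
qed

text \<open>One degree higher the same formula with \<open>g1\<close> and \<open>h1\<close> works;
  the contribution of the defect \<open>h2\<close> vanishes because \<open>b\<close> is zero on the
  syzygies.\<close>

lemma hom_free_factor2:
  assumes "cocycles P d 2 \<subseteq> coboundaries P d 2"
    and b: "b \<in> module_homs F2 regular_module"
    and bd: "\<And>q. q \<in> syzygies \<Longrightarrow> b q = 0"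
  obtains b' where "b' \<in> module_homs F1 regular_module"
    "\<And>q. q \<in> carrier F2 \<Longrightarrow> b q = b' (d2 q)"
proof -
  let ?c = "restrict (\<lambda>x. b (f2 x)) (carrier (P 2))"
  have "?c \<in> cocycles P d 2"
    using restrict_in_dual_module[OF left_module_P module_homs_comp[OF f2 b]] bd maps_closed(11)[of _ 2] f2_d_in_syzygies
    by (auto simp: cocycles_def numeral_3_eq_3 numeral_2_eq_2)
  with assms(1) have "?c \<in> coboundaries P d (Suc 1)"
    by (auto simp: numeral_2_eq_2)
  then obtain c where c: "c \<in> carrier (dual_module (P 1))"
    "?c = (\<lambda>x\<in>carrier (P 2). c (d 1 x))"
    unfolding coboundaries_Suc_iff by (auto simp: numeral_2_eq_2)
  then have c': "c \<in> module_homs (P 1) regular_module"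
    by (simp add: dual_module_simps)
  show ?thesis
  proof (rule that)
    show "(\<lambda>q. c (g1 q) + b (h1 q)) \<in> module_homs F1 regular_module"
      by (intro module_homs_add_regular module_homs_comp[OF g1 c'] module_homs_comp[OF h1 b])
    fix q :: "'x \<Rightarrow>\<^sub>0 'a" assume q: "q \<in> carrier F2"
    have c1: "f2 (g2 q) \<in> carrier F2" "h2 q \<in> carrier F2"
      "h1 (d2 q) \<in> carrier F2"
      by (intro maps_closed q module_homsD(1)[OF h2])+
    then have c2: "h2 q + h1 (d2 q) \<in> carrier F2"
      using keys_add[of "h2 q" "h1 (d2 q)"] by auto
    have "b (f2 (g2 q)) = c (d 1 (g2 q))"
      using fun_cong[OF c(2), of "g2 q"] maps_closed(6)[OF q] by simp
    moreover have "b q = b (f2 (g2 q)) + (b (h2 q) + b (h1 (d2 q)))"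
      using decomp2[of q] module_homsD(2)[OF b c1(1) c2] module_homsD(2)[OF b c1(2,3)] by simp
    moreover have "b (h2 q) = 0"
      using bd d2_h2[OF q] c1(2) by (simp add: syzygies_def)
    ultimately show "b q = c (g1 (d2 q)) + b (h1 (d2 q))"
      using d_g2[OF q] by simp
  qed
qed

lemma syzygies_subset: "syzygies \<subseteq> carrier F2"
  by (auto simp: syzygies_def)

lemma f2_d_hom: "(\<lambda>x. f2 (d 2 x)) \<in> module_homs (P 3) syzygy_module"
proof (rule module_homsI)
  have c: "(\<lambda>x. f2 (d 2 x)) \<in> module_homs (P 3) F2"
    using module_homs_comp[OF _ f2, of "d 2" "P 3"] d[of 2] by (simp add: eval_nat_numeral)
  fix x y a assume x: "x \<in> carrier (P 3)"
  then show "f2 (d 2 x) \<in> carrier syzygy_module"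
    using f2_d_in_syzygies by simp
  show "f2 (d 2 (a \<odot>\<^bsub>P 3\<^esub> x)) = a \<odot>\<^bsub>syzygy_module\<^esub> f2 (d 2 x)"
    using module_homsD(3)[OF c x] by simp
  assume y: "y \<in> carrier (P 3)"
  show "f2 (d 2 (x \<oplus>\<^bsub>P 3\<^esub> y)) = f2 (d 2 x) \<oplus>\<^bsub>syzygy_module\<^esub> f2 (d 2 y)"
    using module_homsD(2)[OF c x y] by simp
qed

text \<open>Ext^3 in terms of \<Omega>: a homomorphism \<open>b\<close> from \<Omega> to the algebra
  is sent to the class of \<open>b (f2 (d 2 x))\<close> on \<open>P 3\<close>, and if this class is
  zero, \<open>b\<close> extends to all of \<open>F2\<close>.\<close>

lemma syzygy_class_map:
  assumes N: "left_module N"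
    and iso: "modules_isomorphic
      (quotient_module ((dual_module (P 3))\<lparr>carrier := cocycles P d 3\<rparr>) (coboundaries P d 3)) N"
  obtains \<Phi> where
    "\<And>b. b \<in> module_homs syzygy_module regular_module \<Longrightarrow> \<Phi> b \<in> carrier N"
    "\<And>b b'. b \<in> module_homs syzygy_module regular_module \<Longrightarrow> b' \<in> module_homs syzygy_module regular_module \<Longrightarrow>
      \<Phi> (\<lambda>q. b q + b' q) = \<Phi> b \<oplus>\<^bsub>N\<^esub> \<Phi> b'"
    "\<And>b a. b \<in> module_homs syzygy_module regular_module \<Longrightarrow> \<Phi> (\<lambda>q. b q * a) = a \<odot>\<^bsub>N\<^esub> \<Phi> b"
    "\<And>b. b \<in> module_homs syzygy_module regular_module \<Longrightarrow> \<Phi> b = \<zero>\<^bsub>N\<^esub> \<Longrightarrow>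
      \<exists>b'\<in>module_homs F2 regular_module. \<forall>q\<in>syzygies. b' q = b q"
proof -
  let ?Z = "(dual_module (P 3))\<lparr>carrier := cocycles P d 3\<rparr>"
  obtain \<phi> where phi: "\<phi> \<in> module_homs ?Z N"
    "\<And>f. f \<in> cocycles P d 3 \<Longrightarrow> \<phi> f = \<zero>\<^bsub>N\<^esub> \<Longrightarrow> f \<in> coboundaries P d 3"
    using Ext_class_map[of P d 2 N, OF left_module_P d _ N] iso unfolding Suc_numeral by auto
  define c where "c b = restrict (\<lambda>x. b (f2 (d 2 x))) (carrier (P 3))" for b :: "('x \<Rightarrow>\<^sub>0 'a) \<Rightarrow> 'a"
  have cZ: "c b \<in> cocycles P d 3" if b: "b \<in> module_homs syzygy_module regular_module" for b
  proof -
    have "b (f2 (d 2 (d 3 x))) = 0" if "x \<in> carrier (P 4)" for x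
    proof -
      have "d 2 (d 3 x) = \<zero>\<^bsub>P 2\<^esub>" "d 3 x \<in> carrier (P 3)"
        using exact_d[of 2] that by (auto simp: numeral_3_eq_3 numeral_2_eq_2 numeral_eq_Suc)
      then have "f2 (d 2 (d 3 x)) = 0"
        using module_homs_zero[OF left_module_P left_module_free_module f2] by simp
      moreover have "0 \<in> syzygies"
        using module_homs_zero[OF left_module_free_module left_module_free_module d2]
        by (simp add: syzygies_def)
      then have "b 0 = 0"
        using module_homsD(3)[OF b, of 0 0] by simp
      ultimately show ?thesis
        by simp
    qed
    moreover have "d 3 x \<in> carrier (P 3)" if "x \<in> carrier (P 4)" for x
      using maps_closed(11)[of x 3] that by (simp add: numeral_eq_Suc)
    ultimately show ?thesis
      using restrict_in_dual_module[OF left_module_P module_homs_comp[OF f2_d_hom b]]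
      by (auto simp: cocycles_def c_def numeral_eq_Suc)
  qed
  show ?thesis
  proof (rule that[of "\<lambda>b. \<phi> (c b)"])
    fix b assume b: "b \<in> module_homs syzygy_module regular_module"
    show "\<phi> (c b) \<in> carrier N"
      using module_homsD(1)[OF phi(1)] cZ[OF b] by simp
    show "\<phi> (c (\<lambda>q. b q * a)) = a \<odot>\<^bsub>N\<^esub> \<phi> (c b)" for a
    proof -
      have "c (\<lambda>q. b q * a) = a \<odot>\<^bsub>?Z\<^esub> c b"
        by (auto simp: c_def dual_module_simps fun_eq_iff)
      then show ?thesis
        using module_homsD(3)[OF phi(1), of "c b"] cZ[OF b] by simp
    qed
    show "\<phi> (c (\<lambda>q. b q + b' q)) = \<phi> (c b) \<oplus>\<^bsub>N\<^esub> \<phi> (c b')"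
      if b': "b' \<in> module_homs syzygy_module regular_module" for b'
    proof -
      have "c (\<lambda>q. b q + b' q) = c b \<oplus>\<^bsub>?Z\<^esub> c b'"
        by (auto simp: c_def dual_module_simps fun_eq_iff)
      then show ?thesis
        using module_homsD(2)[OF phi(1), of "c b" "c b'"] cZ[OF b] cZ[OF b'] by simp
    qed
    assume "\<phi> (c b) = \<zero>\<^bsub>N\<^esub>"
    then have "c b \<in> coboundaries P d (Suc 2)"
      using phi(2) cZ[OF b] by (simp add: numeral_3_eq_3 numeral_2_eq_2)
    then obtain b' where b': "b' \<in> carrier (dual_module (P 2))"
      "c b = (\<lambda>x\<in>carrier (P 3). b' (d 2 x))"
      unfolding coboundaries_Suc_iff by (auto simp: numeral_3_eq_3 numeral_2_eq_2)
    then have b'h: "b' \<in> module_homs (P 2) regular_module"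
      by (simp add: dual_module_simps)
    have h2s: "h2 \<in> module_homs F2 syzygy_module"
      using h2 d2_h2 by (auto simp: module_homs_def syzygies_def)
    \<comment> \<open>The extension: on a syzygy, \<open>g2 q = d 2 y\<close> makes
      \<open>b' (g2 q)\<close> equal to \<open>b (f2 (g2 q))\<close>, and
      \<open>syzygies_decomp\<close> adds the two parts up to \<open>b q\<close>.\<close>
    have "(\<lambda>q. b' (g2 q) + b (h2 q)) \<in> module_homs F2 regular_module"
      by (intro module_homs_add_regular module_homs_comp[OF g2 b'h] module_homs_comp[OF h2s b])
    moreover have "b' (g2 q) + b (h2 q) = b q" if q: "q \<in> syzygies" for q
    proof -
      obtain y where y: "y \<in> carrier (P 3)" "g2 q = d 2 y"
        using g2_syzygies[OF q] by blast
      have "b (f2 (g2 q)) = b' (g2 q)"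
        using fun_cong[OF b'(2), of y] y by (simp add: c_def)
      moreover have "b q = b (f2 (g2 q)) + b (h2 q)"
        using syzygies_decomp[OF q] module_homsD(2)[OF b, of "f2 (g2 q)" "h2 q"]
          f2_d_in_syzygies[OF y(1)] module_homsD(1)[OF h2s, of q] q syzygies_subset y(2) by auto
      ultimately show ?thesis
        by simp
    qed
    ultimately show "\<exists>b'\<in>module_homs F2 regular_module. \<forall>q\<in>syzygies. b' q = b q"
      by (intro bexI[of _ "\<lambda>q. b' (g2 q) + b (h2 q)"]) auto
  qed
qed

text \<open>If the projective resolution has length at most 3, then the identity of the syzygies factors
  through the projective module \<^term>\<open>P 3\<close> and a free module.\<close>

lemma syzygies_lift:
  assumes P4: "carrier (P 4) = {\<zero>\<^bsub>P 4\<^esub>}"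
    and N: "left_module N" and p: "p \<in> module_homs regular_module N" and onto: "p ` UNIV = carrier N"
    and phi: "\<phi> \<in> module_homs syzygy_module N"
  obtains \<psi> where "\<psi> \<in> module_homs syzygy_module regular_module" "\<And>q. q \<in> syzygies \<Longrightarrow> p (\<psi> q) = \<phi> q"
proof -
  have d2': "d 2 \<in> module_homs (P 3) (P 2)"
    using d[of 2] by (simp add: numeral_3_eq_3 numeral_2_eq_2)
  \<comment> \<open>The kernel of \<open>d 2\<close> is the image of \<open>P 4\<close>, which is
    zero.\<close>
  have inj: "x = y" if "x \<in> carrier (P 3)" "y \<in> carrier (P 3)" "d 2 x = d 2 y" for x y
  proof -
    interpret P3: left_module "P 3"
      by (rule left_module_P)
    interpret P2: left_module "P 2"
      by (rule left_module_P)
    let ?z = "x \<ominus>\<^bsub>P 3\<^esub> y"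
    have z: "?z \<in> carrier (P 3)" "x = ?z \<oplus>\<^bsub>P 3\<^esub> y"
      using that by (simp_all add: P3.minus_eq P3.a_assoc P3.l_neg)
    have "d 2 x = d 2 ?z \<oplus>\<^bsub>P 2\<^esub> d 2 y"
      using module_homsD(2)[OF d2' z(1) that(2)] z(2) by metis
    then have "d 2 ?z = \<zero>\<^bsub>P 2\<^esub>"
      using that module_homsD(1)[OF d2'] z(1) by (metis P2.add.r_cancel_one')
    then have "?z \<in> d 3 ` carrier (P 4)"
      using exact_d[of 2] z(1) by (auto simp: numeral_eq_Suc)
    moreover have "d 3 \<zero>\<^bsub>P 4\<^esub> = \<zero>\<^bsub>P 3\<^esub>"
      using module_homs_zero[OF left_module_P left_module_P d[of 3]] by (simp add: numeral_eq_Suc)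
    ultimately have "?z = \<zero>\<^bsub>P 3\<^esub>"
      using P4 by auto
    then show ?thesis
      using z(2) that(2) by simp
  qed
  \<comment> \<open>\<open>y\<close> inverts \<open>d 2\<close> on the values \<open>g2 q\<close>;
    injectivity of \<open>d 2\<close> is what makes this choice a homomorphism.\<close>
  obtain y where y: "\<And>q. q \<in> syzygies \<Longrightarrow> y q \<in> carrier (P 3)" "\<And>q. q \<in> syzygies \<Longrightarrow> d 2 (y q) = g2 q"
    using g2_syzygies by metis
  interpret P3: left_module "P 3"
    by (rule left_module_P)
  have yh: "y \<in> module_homs syzygy_module (P 3)"
  proof (rule module_homsI)
    fix q q' a assume q: "q \<in> carrier syzygy_module"
    then have q2: "q \<in> carrier F2"
      using syzygies_subset by auto
    show "y q \<in> carrier (P 3)"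
      using y q by simp
    have aq: "Poly_Mapping.map ((*) a) q \<in> syzygies"
      using q module_homsD(3)[OF d2, of q a] left_module.smult_closed[OF left_module_free_module, of q X2 a]
      by (auto simp: syzygies_def)
    show "y (a \<odot>\<^bsub>syzygy_module\<^esub> q) = a \<odot>\<^bsub>P 3\<^esub> y q"
    proof (rule inj)
      show "y (a \<odot>\<^bsub>syzygy_module\<^esub> q) \<in> carrier (P 3)"
        using y(1)[OF aq] by simp
      show "a \<odot>\<^bsub>P 3\<^esub> y q \<in> carrier (P 3)"
        using P3.smult_closed y(1) q by simp
      show "d 2 (y (a \<odot>\<^bsub>syzygy_module\<^esub> q)) = d 2 (a \<odot>\<^bsub>P 3\<^esub> y q)"
        using y(1,2)[of q] y(2)[OF aq] q module_homsD(3)[OF d2', of "y q" a] module_homsD(3)[OF g2 q2, of a]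
        by simp
    qed
    assume q': "q' \<in> carrier syzygy_module"
    then have q2': "q' \<in> carrier F2"
      using syzygies_subset by auto
    have qq: "q + q' \<in> syzygies"
      using q q' q2 q2' module_homsD(2)[OF d2 q2 q2'] keys_add[of q q'] by (auto simp: syzygies_def)
    show "y (q \<oplus>\<^bsub>syzygy_module\<^esub> q') = y q \<oplus>\<^bsub>P 3\<^esub> y q'"
    proof (rule inj)
      show "y (q \<oplus>\<^bsub>syzygy_module\<^esub> q') \<in> carrier (P 3)"
        using y(1)[OF qq] by simp
      show "y q \<oplus>\<^bsub>P 3\<^esub> y q' \<in> carrier (P 3)"
        using y(1)[of q] y(1)[of q'] q q' by simp
      show "d 2 (y (q \<oplus>\<^bsub>syzygy_module\<^esub> q')) = d 2 (y q \<oplus>\<^bsub>P 3\<^esub> y q')"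
        using y(1,2)[of q] y(1,2)[of q'] y(2)[OF qq] q q' module_homsD(2)[OF d2', of "y q" "y q'"]
          module_homsD(2)[OF g2 q2 q2'] by simp
    qed
  qed
  have h2s: "h2 \<in> module_homs F2 syzygy_module"
    using h2 d2_h2 by (auto simp: module_homs_def syzygies_def)
  have R: "left_module (regular_module :: ('a, 'a) module)"
    by (rule left_module_regular_module)
  have onto': "f ` S \<subseteq> p ` carrier regular_module" if "f \<in> module_homs L N" "S \<subseteq> carrier L" for f L S
    using onto that module_homsD(1)[OF that(1)] by auto
  obtain \<psi>1 where p1: "\<psi>1 \<in> module_homs (P 3) regular_module"
    "\<And>x. x \<in> carrier (P 3) \<Longrightarrow> p (\<psi>1 x) = \<phi> (f2 (d 2 x))"
    using projective_lift[OF proj R N p module_homs_comp[OF f2_d_hom phi]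
        onto'[OF module_homs_comp[OF f2_d_hom phi] order_refl]] by blast
  obtain \<psi>2 where p2: "\<psi>2 \<in> module_homs F2 regular_module"
    "\<And>x. x \<in> carrier F2 \<Longrightarrow> p (\<psi>2 x) = \<phi> (h2 x)"
    using free_module_lift[OF R N p module_homs_comp[OF h2s phi]
        onto'[OF module_homs_comp[OF h2s phi] order_refl]] by blast
  show ?thesis
  proof (rule that)
    \<comment> \<open>On \<Omega> one has \<open>q = f2 (d 2 (y q)) + h2 q\<close>. The first
      summand passes through \<open>P 3\<close>, the second through \<open>F2\<close>, and
      \<open>\<phi>\<close> has been lifted on each.\<close>
    show "(\<lambda>q. \<psi>1 (y q) + \<psi>2 q) \<in> module_homs syzygy_module regular_module"
      by (intro module_homs_add_regular module_homs_comp[OF yh p1(1)]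
          module_homs_carrier_update[OF syzygies_subset p2(1)])
    fix q assume q: "q \<in> syzygies"
    have "p (\<psi>1 (y q) + \<psi>2 q) = p (\<psi>1 (y q)) \<oplus>\<^bsub>N\<^esub> p (\<psi>2 q)"
      using module_homsD(2)[OF p, of "\<psi>1 (y q)" "\<psi>2 q"] by simp
    also have "\<dots> = \<phi> (f2 (g2 q)) \<oplus>\<^bsub>N\<^esub> \<phi> (h2 q)"
      using p1(2) p2(2) y q syzygies_subset by auto
    also have "\<dots> = \<phi> q"
      using module_homsD(2)[OF phi, of "f2 (g2 q)" "h2 q"] f2_d_in_syzygies[of "y q"] y q
        module_homsD(1)[OF h2s, of q] syzygies_subset syzygies_decomp[OF q] by auto
    finally show "p (\<psi>1 (y q) + \<psi>2 q) = \<phi> q" .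
  qed
qed

end

section \<open>Homogeneous components and the augmentation\<close>

text \<open>\<open>S\<close> may be larger than the support, which avoids computing the exact set of
  nonzero components of a sum.\<close>

lemma homogeneous_decompositionI:
  assumes "\<And>n. f n \<in> gr n" "finite S" "\<And>n. n \<notin> S \<Longrightarrow> f n = 0" "a = sum f S"
  shows "homogeneous_decomposition gr a f"
proof -
  have "{n. f n \<noteq> 0} \<subseteq> S"
    using assms(3) by blast
  then show ?thesis
    using assms finite_subset[of "{n. f n \<noteq> 0}" S]
    by (auto simp: homogeneous_decomposition_def intro!: sum.mono_neutral_right)
qed

lemma (in assoc_algebra) scale_one_mult [simp]: "scale c 1 * a = scale c a" "a * scale c 1 = scale c a"
  by (simp_all flip: scale_mult_left scale_mult_right)

context connected_graded_algebra
begin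

definition component :: "'a \<Rightarrow> nat \<Rightarrow> 'a" where
  "component a = (THE f. homogeneous_decomposition gr a f)"

lemma homogeneous_decomposition_component: "homogeneous_decomposition gr a (component a)"
  unfolding component_def using gr_direct_sum by (rule theI')

lemma component_unique: "homogeneous_decomposition gr a f \<Longrightarrow> component a = f"
  using gr_direct_sum[of a] homogeneous_decomposition_component[of a] by blast

lemma component_mem: "component a n \<in> gr n"
  using homogeneous_decomposition_component by (simp add: homogeneous_decomposition_def)

lemma finite_component: "finite {n. component a n \<noteq> 0}"
  using homogeneous_decomposition_component by (simp add: homogeneous_decomposition_def)

lemma sum_component: "a = (\<Sum>n | component a n \<noteq> 0. component a n)"
  using homogeneous_decomposition_component by (simp add: homogeneous_decomposition_def)

lemma gr_zero [simp]: "0 \<in> gr n"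
  using gr_subspace by (rule subspace_0)

lemma gr_add: "a \<in> gr n \<Longrightarrow> b \<in> gr n \<Longrightarrow> a + b \<in> gr n"
  using gr_subspace by (rule subspace_add)

lemma gr_scale: "a \<in> gr n \<Longrightarrow> scale c a \<in> gr n"
  using gr_subspace by (rule subspace_scale)

lemma gr_sum: "(\<And>i. i \<in> S \<Longrightarrow> f i \<in> gr n) \<Longrightarrow> sum f S \<in> gr n"
  using gr_subspace by (rule subspace_sum)

lemma component_add: "component (a + b) n = component a n + component b n"
proof -
  let ?S = "{n. component a n \<noteq> 0} \<union> {n. component b n \<noteq> 0}"
  have S: "finite ?S"
    using finite_component by simp
  have "a = sum (component a) ?S" "b = sum (component b) ?S"
    using S by (subst sum_component; auto intro!: sum.mono_neutral_left)+
  then have "homogeneous_decomposition gr (a + b) (\<lambda>n. component a n + component b n)"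
    using S by (intro homogeneous_decompositionI[where S = ?S])
      (auto simp: component_mem gr_add sum.distrib)
  from component_unique[OF this] show ?thesis
    by simp
qed

lemma component_scale: "component (scale c a) n = scale c (component a n)"
proof -
  have "scale c a = (\<Sum>n | component a n \<noteq> 0. scale c (component a n))"
    by (subst sum_component) (simp add: scale_sum_right)
  then have "homogeneous_decomposition gr (scale c a) (\<lambda>n. scale c (component a n))"
    using finite_component[of a]
    by (intro homogeneous_decompositionI[where S = "{n. component a n \<noteq> 0}"])
      (auto simp: component_mem gr_scale)
  from component_unique[OF this] show ?thesis
    by simp
qed

lemma component_zero [simp]: "component 0 n = 0"
  using component_scale[of 0 0 n] by simp

lemma component_sum: "component (sum f S) n = (\<Sum>i\<in>S. component (f i) n)"
  by (induction S rule: infinite_finite_induct) (simp_all add: component_add)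

lemma component_homogeneous: "a \<in> gr m \<Longrightarrow> component a n = (if n = m then a else 0)"
  using component_unique[OF homogeneous_decompositionI[where S = "{m}" and f = "\<lambda>n. if n = m then a else 0"]]
  by simp

lemma component_eqI:
  assumes "\<And>n. component a n = component b n"
  shows "a = b"
proof -
  have "component a = component b"
    using assms by blast
  then show ?thesis
    using sum_component[of a] sum_component[of b] by simp
qed

text \<open>The Cauchy product. For a homogeneous left factor of degree \<open>m\<close> only one
  component of \<open>b\<close> reaches degree \<open>n\<close>; the general case sums over the
  components of \<open>a\<close>.\<close>

lemma component_mult: "component (a * b) n = (\<Sum>i\<le>n. component a i * component b (n - i))"
proof -
  have hom: "component (x * b) n = (if m \<le> n then x * component b (n - m) else 0)" if x: "x \<in> gr m" for x m
  proof -
    let ?S = "{n. component b n \<noteq> 0}"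
    have "x * b = (\<Sum>k\<in>?S. x * component b k)"
      by (subst sum_component) (simp add: sum_distrib_left)
    then have "component (x * b) n = (\<Sum>k\<in>?S. component (x * component b k) n)"
      by (simp add: component_sum)
    also have "\<dots> = (\<Sum>k\<in>?S. if k = n - m then (if m \<le> n then x * component b k else 0) else 0)"
      by (rule sum.cong) (auto simp: component_homogeneous[OF gr_mult[OF x component_mem]])
    also have "\<dots> = (if m \<le> n then x * component b (n - m) else 0)"
      using finite_component by (simp add: sum.delta)
    finally show ?thesis .
  qed
  let ?S = "{n. component a n \<noteq> 0}"
  have "a * b = (\<Sum>i\<in>?S. component a i * b)"
    by (subst sum_component) (simp add: sum_distrib_right)
  then have "component (a * b) n = (\<Sum>i\<in>?S. component (component a i * b) n)"
    by (simp add: component_sum)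
  also have "\<dots> = (\<Sum>i\<in>?S. if i \<le> n then component a i * component b (n - i) else 0)"
    using hom[OF component_mem] by simp
  also have "\<dots> = (\<Sum>i\<in>?S \<inter> {..n}. component a i * component b (n - i))"
    using finite_component by (subst sum.inter_restrict) (auto intro!: sum.cong)
  also have "\<dots> = (\<Sum>i\<le>n. component a i * component b (n - i))"
    by (rule sum.mono_neutral_left) auto
  finally show ?thesis .
qed

lemma component_mult_left: "a \<in> gr m \<Longrightarrow> component (a * b) n = (if m \<le> n then a * component b (n - m) else 0)"
proof -
  assume a: "a \<in> gr m"
  have "component (a * b) n = (\<Sum>i\<le>n. if i = m then a * component b (n - m) else 0)"
    unfolding component_mult by (rule sum.cong) (auto simp: component_homogeneous[OF a])
  then show ?thesis
    by simp
qed

lemma component_mult_right: "b \<in> gr m \<Longrightarrow> component (a * b) n = (if m \<le> n then component a (n - m) * b else 0)"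
proof -
  assume b: "b \<in> gr m"
  have "component (a * b) n = (\<Sum>i\<le>n. if i = n - m then (if m \<le> n then component a (n - m) * b else 0) else 0)"
    unfolding component_mult by (rule sum.cong) (auto simp: component_homogeneous[OF b])
  then show ?thesis
    by simp
qed

abbreviation aug :: "'a \<Rightarrow> 'k" where
  "aug \<equiv> augmentation scale gr"

lemma scale_one_inject [simp]: "scale c 1 = scale c' 1 \<longleftrightarrow> c = c'"
  by (simp add: scale_cancel_right)

text \<open>Since degree 0 is the line of the unit, the definite description in
  \<open>augmentation\<close> denotes the scalar of the component of degree 0. Through this equation
  the laws of \<open>aug\<close> reduce to those of \<open>component\<close>.\<close>

lemma scale_aug: "scale (aug a) 1 = component a 0"
proof -
  obtain c where "component a 0 = scale c 1"
    using component_mem[of a 0] gr_0 by auto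
  then show ?thesis
    unfolding augmentation_def component_def[symmetric] by simp
qed

lemma aug_eqI: "component a 0 = scale c 1 \<Longrightarrow> aug a = c"
  using scale_aug[of a] by simp

lemma aug_add: "aug (a + b) = aug a + aug b"
  by (rule aug_eqI) (simp add: component_add scale_left_distrib scale_aug)

lemma aug_mult: "aug (a * b) = aug a * aug b"
proof (rule aug_eqI)
  have "component (a * b) 0 = scale (aug a) 1 * scale (aug b) 1"
    by (simp only: scale_aug) (simp add: component_mult)
  then show "component (a * b) 0 = scale (aug a * aug b) 1"
    by simp
qed

lemma one_mem_gr_0: "1 \<in> gr 0"
  unfolding gr_0 by (rule range_eqI[of _ _ 1]) simp

lemma scale_one_mem_gr_0: "scale c 1 \<in> gr 0"
  by (intro gr_scale one_mem_gr_0)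

lemma aug_scale: "aug (scale c a) = c * aug a"
proof (rule aug_eqI)
  have "component (scale c a) 0 = scale c (scale (aug a) 1)"
    by (simp only: scale_aug component_scale)
  then show "component (scale c a) 0 = scale (c * aug a) 1"
    by simp
qed

lemma aug_one [simp]: "aug 1 = 1"
  by (rule aug_eqI) (simp add: component_homogeneous[OF one_mem_gr_0])

lemma aug_zero [simp]: "aug 0 = 0"
  by (rule aug_eqI) simp

lemma aug_sum: "aug (sum f S) = (\<Sum>i\<in>S. aug (f i))"
  by (induction S rule: infinite_finite_induct) (simp_all add: aug_add)

lemma aug_homogeneous: "a \<in> gr n \<Longrightarrow> n > 0 \<Longrightarrow> aug a = 0"
  by (rule aug_eqI) (simp add: component_homogeneous)

lemma mem_gr_0: "a \<in> gr 0 \<Longrightarrow> a = scale (aug a) 1"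
  by (simp add: scale_aug component_homogeneous)

section \<open>The trivial module and its projective resolutions\<close>

abbreviation triv :: "('a, 'k) module" where
  "triv \<equiv> trivial_module scale gr"

lemma trivial_module_simps [simp]:
  "carrier triv = UNIV" "zero triv = 0"
  "add triv = (+)" "smult triv = (\<lambda>a c. aug a * c)"
  by (simp_all add: trivial_module_def)

lemma left_module_trivial_module: "left_module triv"
proof -
  have "abelian_group triv"
    by (rule abelian_groupI) (auto simp: algebra_simps intro: right_minus)
  then show ?thesis
    by (intro left_module.intro left_module_axioms.intro) (auto simp: algebra_simps aug_add aug_mult)
qed

lemma aug_module_hom: "aug \<in> module_homs regular_module triv"
  by (rule module_homsI) (simp_all add: aug_add aug_mult)

lemma aug_surj: "range aug = UNIV"
proof -
  have "c \<in> range aug" for c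
    by (rule range_eqI[of _ _ "scale c 1"]) (simp add: aug_scale)
  then show ?thesis
    by blast
qed

text \<open>The trivial module lives in the type \<^typ>\<open>'k\<close>; its copy in the universe is what the bound on
  the global dimension applies to.\<close>

lemma short_projective_resolution:
  fixes emb :: "'a \<Rightarrow> 'u"
  assumes emb: "inj emb" and gldim: "left_global_dimension TYPE('a) TYPE('u) \<le> 3"
  obtains P :: "nat \<Rightarrow> ('a, 'u) module" and d e
  where "projective_resolution triv P d e" "carrier (P 4) = {\<zero>\<^bsub>P 4\<^esub>}"
proof -
  \<comment> \<open>The multiples of the unit are a copy of the field inside the algebra, so
    \<open>emb\<close> carries the field into the universe as well.\<close>
  define j where "j c = emb (scale c 1)" for c
  have inj: "inj j"
    using emb by (auto simp: inj_def j_def dest: scale_one_inject[THEN iffD1])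
  then have invj [simp]: "inv_into UNIV j (j c) = c" for c
    by simp
  define K :: "('a, 'u) module" where "K = \<lparr>carrier = range j, mult = undefined, one = undefined, zero = j 0,
    add = (\<lambda>x y. j (inv_into UNIV j x + inv_into UNIV j y)), smult = (\<lambda>a x. j (aug a * inv_into UNIV j x))\<rparr>"
  have K: "carrier K = range j" "zero K = j 0" "add K = (\<lambda>x y. j (inv_into UNIV j x + inv_into UNIV j y))"
    "smult K = (\<lambda>a x. j (aug a * inv_into UNIV j x))"
    by (simp_all add: K_def)
  have "abelian_group K"
  proof (rule abelian_groupI)
    fix x assume "x \<in> carrier K"
    then show "\<exists>y\<in>carrier K. y \<oplus>\<^bsub>K\<^esub> x = \<zero>\<^bsub>K\<^esub>"
      by (intro bexI[of _ "j (- inv_into UNIV j x)"]) (auto simp: K)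
  qed (auto simp: K algebra_simps)
  then have "left_module K"
    by (intro left_module.intro left_module_axioms.intro) (auto simp: K algebra_simps aug_add aug_mult)
  then have "projective_dimension K \<le> 3"
    using gldim unfolding left_global_dimension_def by (simp add: SUP_le_iff)
  have "\<exists>n\<le>3. \<exists>(P :: nat \<Rightarrow> ('a, 'u) module) d e. projective_resolution K P d e \<and>
    (\<forall>i>n. carrier (P i) = {\<zero>\<^bsub>P i\<^esub>})"
  proof (rule ccontr)
    assume *: "\<not> ?thesis"
    \<comment> \<open>The projective dimension is an infimum of lengths: if all of them were at
      least 4, it could not be at most 3.\<close>
    have "4 \<le> projective_dimension K"
      unfolding projective_dimension_def
    proof (rule Inf_greatest, clarify)
      fix n and P :: "nat \<Rightarrow> ('a, 'u) module" and d e
      assume "projective_resolution K P d e" "\<forall>i>n. carrier (P i) = {\<zero>\<^bsub>P i\<^esub>}"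
      with * have "\<not> n \<le> 3"
        by blast
      then show "4 \<le> enat n"
        by (simp add: numeral_eq_enat)
    qed
    with \<open>projective_dimension K \<le> 3\<close> have "(4::enat) \<le> 3"
      by (rule order.trans[rotated])
    then show False
      by (simp add: numeral_eq_enat)
  qed
  then obtain n P d and e :: "'u \<Rightarrow> 'u" where n: "n \<le> 3" and res: "projective_resolution K P d e"
    and triv: "\<And>i. i > n \<Longrightarrow> carrier (P i) = {\<zero>\<^bsub>P i\<^esub>}"
    by blast
  have "projective_resolution triv P d (\<lambda>x. inv_into UNIV j (e x))"
    unfolding projective_resolution_def
  proof (intro conjI)
    have e: "e \<in> module_homs (P 0) K" and onto: "e ` carrier (P 0) = range j"
      using res by (simp_all add: projective_resolution_def K)
    show "(\<lambda>x. inv_into UNIV j (e x)) \<in> module_homs (P 0) triv"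
      using e by (auto simp: module_homs_def K)
    have "inv_into UNIV j ` (e ` carrier (P 0)) = UNIV"
      unfolding onto using inj by (metis image_inv_f_f inj_imp_surj_inv surj_def image_comp comp_def invj UNIV_eq_I rangeI)
    then show "(\<lambda>x. inv_into UNIV j (e x)) ` carrier (P 0) = carrier triv"
      by (simp add: image_comp comp_def)
    have "inv_into UNIV j (e x) = 0 \<longleftrightarrow> e x = j 0" if "x \<in> carrier (P 0)" for x
      using onto that by (metis f_inv_into_f imageI invj)
    then have "{x \<in> carrier (P 0). inv_into UNIV j (e x) = 0} = {x \<in> carrier (P 0). e x = \<zero>\<^bsub>K\<^esub>}"
      by (auto simp: K)
    then show "{x \<in> carrier (P 0). inv_into UNIV j (e x) = \<zero>\<^bsub>triv\<^esub>} = d 0 ` carrier (P (Suc 0))"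
      using res by (simp add: projective_resolution_def)
  qed (use res in \<open>simp_all add: projective_resolution_def\<close>)
  then show ?thesis
    using that triv[of 4] n by simp
qed

text \<open>\<open>Ext_self\<close> works with a resolution picked by \<open>SOME\<close>. That the
  pick is a resolution rests on the existence of one in the same universe, supplied by
  \<open>ex\<close>.\<close>

lemma gorenstein_resolution:
  fixes P0 :: "nat \<Rightarrow> ('a, 'u) module"
  assumes ex: "projective_resolution triv P0 d0 e0"
    and gor: "gorenstein TYPE('u) scale gr D"
  obtains P :: "nat \<Rightarrow> ('a, 'u) module" and d e
  where "projective_resolution triv P d e"
    "\<And>i. i \<noteq> D \<Longrightarrow> cocycles P d i \<subseteq> coboundaries P d i"
    "modules_isomorphic
      (quotient_module ((dual_module (P D))\<lparr>carrier := cocycles P d D\<rparr>) (coboundaries P d D))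
      triv"
proof -
  obtain P :: "nat \<Rightarrow> ('a, 'u) module" and d
    where some: "some_projective_resolution triv = (P, d)"
    by (cases "some_projective_resolution triv ::
        (nat \<Rightarrow> ('a, 'u) module) \<times> (nat \<Rightarrow> 'u \<Rightarrow> 'u)")
  have "case (P, d) of (P, d) \<Rightarrow> \<exists>e. projective_resolution triv P d e"
    unfolding some[symmetric] some_projective_resolution_def
    by (rule someI[of _ "(P0, d0)"]) (use ex in auto)
  then obtain e where res: "projective_resolution triv P d e"
    by auto
  have P: "left_module (P i)" and d: "d i \<in> module_homs (P (Suc i)) (P i)" for i
    using res by (simp_all add: projective_resolution_def projective_def)
  have "cocycles P d i \<subseteq> coboundaries P d i" if "i \<noteq> D" for i
  proof
    fix f assume f: "f \<in> cocycles P d i"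
    show "f \<in> coboundaries P d i"
    proof (rule cocycle_is_coboundary[OF P _ zero_in_coboundaries[of P d i, OF P d] f])
      show "carrier (quotient_module (dual_module (P i)\<lparr>carrier := cocycles P d i\<rparr>) (coboundaries P d i)) =
        {coboundaries P d i}"
        using gor that unfolding gorenstein_def Let_def Ext_self_def some
        by (simp add: quotient_module_def)
    qed
  qed
  moreover have "modules_isomorphic
      (quotient_module ((dual_module (P D))\<lparr>carrier := cocycles P d D\<rparr>) (coboundaries P d D))
      triv"
    using gor unfolding gorenstein_def Let_def Ext_self_def some by simp
  ultimately show ?thesis
    using res that by blast
qed

end

section \<open>The free algebra\<close>

lemma poly_mapping_single_induct [consumes 1, case_names zero single_add]:
  assumes "keys p \<subseteq> A"
    and "P 0"
    and "\<And>k c q. k \<in> A \<Longrightarrow> P q \<Longrightarrow> P (single k c + q)"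
  shows "P (p :: 'x \<Rightarrow>\<^sub>0 'b::ab_group_add)"
proof -
  have "P p" if "finite S" "S \<subseteq> A" "keys p \<subseteq> S" for S p
    using that
  proof (induction S arbitrary: p rule: finite_induct)
    case empty
    then show ?case
      using assms(2) by simp
  next
    case (insert k S)
    let ?q = "p - single k (lookup p k)"
    have "keys ?q \<subseteq> S"
      using insert.prems
      by (auto simp: in_keys_iff lookup_minus lookup_single "when_def" split: if_splits)
    then have "P (single k (lookup p k) + ?q)"
      using insert by (intro assms(3)) auto
    then show ?case
      by simp
  qed
  then show ?thesis
    using assms(1) finite_keys by blast
qed

text \<open>Identities between additive maps are checked on monomials; this and the two-variable
  version take the place of computations with convolution sums.\<close>

lemma additive_eqI:
  fixes f g :: "('x \<Rightarrow>\<^sub>0 'b::ab_group_add) \<Rightarrow> 'c::ab_group_add"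
  assumes "\<And>p q. f (p + q) = f p + f q" "\<And>p q. g (p + q) = g p + g q"
    and "\<And>k c. k \<in> A \<Longrightarrow> f (single k c) = g (single k c)"
    and "keys p \<subseteq> A"
  shows "f p = g p"
  using assms(4)
proof (induction p rule: poly_mapping_single_induct)
  case zero
  show ?case
    using assms(1)[of 0 0] assms(2)[of 0 0] by simp
qed (simp add: assms)

lemma biadditive_eqI:
  fixes f g :: "('x \<Rightarrow>\<^sub>0 'b::ab_group_add) \<Rightarrow> ('y \<Rightarrow>\<^sub>0 'd::ab_group_add) \<Rightarrow> 'c::ab_group_add"
  assumes "\<And>p q r. f (p + q) r = f p r + f q r" "\<And>p q r. f r (p + q) = f r p + f r q"
    and "\<And>p q r. g (p + q) r = g p r + g q r" "\<And>p q r. g r (p + q) = g r p + g r q"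
    and "\<And>k c l b. f (single k c) (single l b) =
      g (single k c) (single l b)"
  shows "f p q = g p q"
  by (rule additive_eqI[where A = UNIV], simp_all add: assms)
    (rule additive_eqI[where A = UNIV], simp_all add: assms)

lemma free_algebra_simps [simp]:
  "carrier (free_algebra n) = {p. \<forall>u \<in> keys p. set (letters u) \<subseteq> {..<n}}"
  "add (free_algebra n) = (+)" "zero (free_algebra n) = 0"
  "mult (free_algebra n) = (*)" "one (free_algebra n) = 1"
  by (simp_all add: free_algebra_def)

lemma letters_add [simp]: "letters (u + v) = letters u @ letters v"
  by (simp add: plus_nc_word_def)

lemma letters_zero [simp]: "letters 0 = []"
  by (simp add: zero_nc_word_def)

lemma letters_eq_Nil_iff [simp]: "letters u = [] \<longleftrightarrow> u = 0"
  by (cases u) (simp add: zero_nc_word_def)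

lemma NC_Word_Nil: "NC_Word [] = 0"
  by (simp add: zero_nc_word_def)

lemma ring_free_algebra: "ring (free_algebra n :: (nat nc_word \<Rightarrow>\<^sub>0 'k::field) ring)"
proof (rule ringI)
  show "abelian_group (free_algebra n :: (nat nc_word \<Rightarrow>\<^sub>0 'k) ring)"
  proof (rule abelian_groupI)
    fix p :: "nat nc_word \<Rightarrow>\<^sub>0 'k"
    assume p: "p \<in> carrier (free_algebra n)"
    then show "\<exists>q\<in>carrier (free_algebra n). q \<oplus>\<^bsub>free_algebra n\<^esub> p = \<zero>\<^bsub>free_algebra n\<^esub>"
      by (intro bexI[of _ "- p"]) auto
    fix q :: "nat nc_word \<Rightarrow>\<^sub>0 'k"
    assume "q \<in> carrier (free_algebra n)"
    with p show "p \<oplus>\<^bsub>free_algebra n\<^esub> q \<in> carrier (free_algebra n)"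
      using keys_add[of p q] by auto
  qed (auto simp: algebra_simps)
  show "monoid (free_algebra n :: (nat nc_word \<Rightarrow>\<^sub>0 'k) ring)"
  proof (rule monoidI)
    fix p q :: "nat nc_word \<Rightarrow>\<^sub>0 'k"
    assume "p \<in> carrier (free_algebra n)" "q \<in> carrier (free_algebra n)"
    then show "p \<otimes>\<^bsub>free_algebra n\<^esub> q \<in> carrier (free_algebra n)"
      using keys_mult[of p q] by fastforce
  qed (auto simp: algebra_simps)
qed (auto simp: algebra_simps)

lemma free_algebra_mult:
  fixes p q :: "nat nc_word \<Rightarrow>\<^sub>0 'k::field"
  assumes "p \<in> carrier (free_algebra n)" "q \<in> carrier (free_algebra n)"
  shows "p * q \<in> carrier (free_algebra n)"
  using monoid.m_closed[OF ring.is_monoid[OF ring_free_algebra] assms] by simp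

lemma free_algebra_add:
  fixes p q :: "nat nc_word \<Rightarrow>\<^sub>0 'k::field"
  assumes "p \<in> carrier (free_algebra n)" "q \<in> carrier (free_algebra n)"
  shows "p + q \<in> carrier (free_algebra n)"
  using assms keys_add[of p q] by auto

lemma free_algebra_diff:
  fixes p q :: "nat nc_word \<Rightarrow>\<^sub>0 'k::field"
  assumes "p \<in> carrier (free_algebra n)" "q \<in> carrier (free_algebra n)"
  shows "p - q \<in> carrier (free_algebra n)"
  using assms keys_diff[of p q] by auto

lemma free_algebra_sum:
  fixes f :: "'i \<Rightarrow> nat nc_word \<Rightarrow>\<^sub>0 'k::field"
  assumes "\<And>i. i \<in> S \<Longrightarrow> f i \<in> carrier (free_algebra n)"
  shows "sum f S \<in> carrier (free_algebra n)"
  using assms keys_sum[of f S] by fastforce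

text \<open>Closure under negation comes from multiplication by \<open>- 1\<close>.\<close>

lemma ideal_free_algebraI:
  fixes S :: "(nat nc_word \<Rightarrow>\<^sub>0 'k::field) set"
  assumes "S \<subseteq> carrier (free_algebra n)" "0 \<in> S" "\<And>p q. p \<in> S \<Longrightarrow> q \<in> S \<Longrightarrow> p + q \<in> S"
    and left: "\<And>p q. p \<in> carrier (free_algebra n) \<Longrightarrow> q \<in> S \<Longrightarrow> p * q \<in> S"
    and right: "\<And>p q. p \<in> carrier (free_algebra n) \<Longrightarrow> q \<in> S \<Longrightarrow> q * p \<in> S"
  shows "ideal S (free_algebra n)"
proof (rule idealI[OF ring_free_algebra])
  interpret ring "free_algebra n :: (nat nc_word \<Rightarrow>\<^sub>0 'k) ring"
    by (rule ring_free_algebra)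
  show "subgroup S (add_monoid (free_algebra n))"
  proof (rule add.subgroupI)
    fix p assume p: "p \<in> S"
    have "- 1 \<in> carrier (free_algebra n :: (nat nc_word \<Rightarrow>\<^sub>0 'k) ring)"
      by auto
    then have "(- 1) * p \<in> S"
      using p by (rule left)
    moreover have "\<ominus>\<^bsub>free_algebra n\<^esub> p = - p"
      using assms(1) p \<open>(- 1) * p \<in> S\<close> by (intro minus_equality) auto
    ultimately show "\<ominus>\<^bsub>free_algebra n\<^esub> p \<in> S"
      by simp
  qed (use assms in auto)
qed (use left right in auto)

text \<open>The right derivative \<partial>_i: words ending in \<open>i\<close> lose that letter,
  all others are dropped. \<open>map_key\<close> keeps the support finite because appending a letter
  is injective.\<close>

definition strip :: "'x \<Rightarrow> ('x nc_word \<Rightarrow>\<^sub>0 'k::zero) \<Rightarrow> ('x nc_word \<Rightarrow>\<^sub>0 'k)" where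
  "strip i = Poly_Mapping.map_key (\<lambda>u. NC_Word (letters u @ [i]))"

lemma inj_snoc_word: "inj (\<lambda>u. NC_Word (letters u @ [i]))"
  by (auto simp: inj_def intro: nc_word.expand)

lemma lookup_strip: "lookup (strip i p) u = lookup p (NC_Word (letters u @ [i]))"
  by (simp add: strip_def map_key.rep_eq inj_snoc_word)

lemma strip_zero [simp]: "strip i 0 = 0"
  by (rule poly_mapping_eqI) (simp add: lookup_strip)

lemma strip_add: "strip i (p + q) = strip i p + strip i q"
  by (rule poly_mapping_eqI) (simp add: lookup_strip lookup_add)

lemma strip_diff: "strip i (p - q) = strip i p - strip i q"
  by (rule poly_mapping_eqI) (simp add: lookup_strip lookup_minus)

lemma strip_sum: "strip i (sum f S) = (\<Sum>j\<in>S. strip i (f j))"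
  by (rule poly_mapping_eqI) (simp add: lookup_strip lookup_sum)

lemma strip_single_snoc:
  "strip i (single (NC_Word (u @ [j])) c) = (if i = j then single (NC_Word u) c else 0)"
  by (rule poly_mapping_eqI) (auto simp: lookup_strip lookup_single "when_def")

lemma strip_single_zero [simp]: "strip i (single 0 c) = 0"
  by (rule poly_mapping_eqI) (auto simp: lookup_strip lookup_single "when_def" zero_nc_word_def)

lemma strip_mem_free_algebra:
  fixes p :: "nat nc_word \<Rightarrow>\<^sub>0 'k::field"
  assumes "p \<in> carrier (free_algebra n)"
  shows "strip i p \<in> carrier (free_algebra n)"
proof -
  have "set (letters u) \<subseteq> {..<n}" if "u \<in> keys (strip i p)" for u
  proof -
    have "NC_Word (letters u @ [i]) \<in> keys p"
      using that by (simp add: in_keys_iff lookup_strip)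
    with assms have "set (letters (NC_Word (letters u @ [i]))) \<subseteq> {..<n}"
      by (auto simp del: nc_word.sel)
    then show ?thesis
      by simp
  qed
  then show ?thesis
    by simp
qed

abbreviation letter :: "'x \<Rightarrow> ('x nc_word \<Rightarrow>\<^sub>0 'k::{zero,one})" where
  "letter i \<equiv> single (NC_Word [i]) 1"

lemma nc_word_cases:
  obtains "w = 0" | u i where "w = NC_Word (u @ [i])"
proof (cases w)
  case (NC_Word u)
  then show ?thesis
    using that by (cases u rule: rev_exhaust) (auto simp: NC_Word_Nil)
qed

lemma lookup_mult_zero_word:
  fixes p q :: "'x nc_word \<Rightarrow>\<^sub>0 'k::ring_1"
  shows "lookup (p * q) 0 = lookup p 0 * lookup q 0"
proof (rule biadditive_eqI[where f = "\<lambda>p q. lookup (p * q) 0"])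
  fix k l :: "'x nc_word" and c b :: 'k
  have "k + l = 0 \<longleftrightarrow> k = 0 \<and> l = 0"
    by (metis Nil_is_append_conv letters_add letters_eq_Nil_iff)
  then show "lookup (single k c * single l b) 0 =
    lookup (single k c) 0 * lookup (single l b) 0"
    by (auto simp: mult_single lookup_single "when_def")
qed (simp_all add: lookup_add algebra_simps)

text \<open>A twisted Leibniz rule: the last letter of a product word comes from the right factor
  unless that factor is the empty word, whence the constant term of \<open>q\<close> in the second
  summand.\<close>

lemma strip_mult:
  fixes p q :: "'x nc_word \<Rightarrow>\<^sub>0 'k::ring_1"
  shows "strip i (p * q) = p * strip i q + strip i p * single 0 (lookup q 0)"
proof (rule biadditive_eqI[where f = "\<lambda>p q. strip i (p * q)"])
  fix k l :: "'x nc_word" and c b :: 'k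
  show "strip i (single k c * single l b) =
    single k c * strip i (single l b) +
    strip i (single k c) * single 0 (lookup (single l b) 0)"
  proof (cases l rule: nc_word_cases)
    case 1
    then show ?thesis
      by (cases k rule: nc_word_cases) (auto simp: mult_single strip_single_snoc)
  next
    case (2 v j)
    then have "k + l = NC_Word ((letters k @ v) @ [j])" "k + NC_Word v = NC_Word (letters k @ v)" "l \<noteq> 0"
      by (auto simp: plus_nc_word_def zero_nc_word_def)
    with 2 show ?thesis
      by (simp add: mult_single strip_single_snoc lookup_single "when_def" del: append_assoc)
  qed
qed (simp_all add: strip_add lookup_add single_add algebra_simps)

text \<open>A nonempty word is its initial part times its last letter. The inductions on the degree
  of a polynomial go through this formula.\<close>

lemma strip_expansion:
  fixes p :: "nat nc_word \<Rightarrow>\<^sub>0 'k::field"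
  assumes "p \<in> carrier (free_algebra n)"
  shows "p = single 0 (lookup p 0) + (\<Sum>i<n. strip i p * letter i)"
proof (rule additive_eqI[where f = "\<lambda>p. p" and A = "{u. set (letters u) \<subseteq> {..<n}}"])
  fix k and c :: 'k assume k: "k \<in> {u. set (letters u) \<subseteq> {..<n}}"
  show "single k c = single 0 (lookup (single k c) 0) +
    (\<Sum>i<n. strip i (single k c) * letter i)"
  proof (cases k rule: nc_word_cases)
    case (2 u j)
    with k have "j < n"
      by simp
    have "(\<Sum>i<n. strip i (single k c) * letter i) =
      (\<Sum>i<n. if i = j then single k c else 0)"
      unfolding 2 by (rule sum.cong) (auto simp: strip_single_snoc mult_single plus_nc_word_def)
    moreover have "k \<noteq> 0"
      using 2 by (simp add: zero_nc_word_def)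
    ultimately show ?thesis
      using \<open>j < n\<close> by (simp add: lookup_single)
  qed simp
qed (use assms in \<open>auto simp: strip_add lookup_add single_add algebra_simps sum.distrib\<close>)

section \<open>Homogeneous elements of the free algebra\<close>

lemma homogeneous_zero [simp]: "homogeneous d 0"
  by (simp add: homogeneous_def)

lemma homogeneous_add: "homogeneous d p \<Longrightarrow> homogeneous d q \<Longrightarrow> homogeneous d (p + q)"
  using keys_add[of p q] by (auto simp: homogeneous_def)

lemma homogeneous_diff:
  fixes p q :: "'x nc_word \<Rightarrow>\<^sub>0 'k::ab_group_add"
  shows "homogeneous d p \<Longrightarrow> homogeneous d q \<Longrightarrow> homogeneous d (p - q)"
  by (auto simp: homogeneous_def in_keys_iff lookup_minus)

lemma homogeneous_sum:
  "(\<And>i. i \<in> S \<Longrightarrow> homogeneous d (f i)) \<Longrightarrow> homogeneous d (sum f S)"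
  by (induction S rule: infinite_finite_induct) (simp_all add: homogeneous_add)

lemma homogeneous_single: "length (letters u) = d \<Longrightarrow> homogeneous d (single u c)"
  by (simp add: homogeneous_def)

lemma homogeneous_mult:
  "homogeneous d p \<Longrightarrow> homogeneous d' q \<Longrightarrow> homogeneous (d + d') (p * q)"
  using keys_mult[of p q] by (fastforce simp: homogeneous_def)

lemma homogeneous_strip:
  assumes "homogeneous (Suc d) p"
  shows "homogeneous d (strip i p)"
  unfolding homogeneous_def
proof
  fix u assume "u \<in> keys (strip i p)"
  then have "NC_Word (letters u @ [i]) \<in> keys p"
    by (simp add: in_keys_iff lookup_strip)
  then have "length (letters (NC_Word (letters u @ [i]))) = Suc d"
    using assms by (auto simp: homogeneous_def simp del: nc_word.sel)
  then show "length (letters u) = d"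
    by simp
qed

lemma homogeneous_lookup_zero: "homogeneous (Suc d) p \<Longrightarrow> lookup p 0 = 0"
  by (force simp: homogeneous_def in_keys_iff)

lemma homogeneous_0D:
  assumes "homogeneous 0 p"
  shows "p = single 0 (lookup p 0)"
proof (rule poly_mapping_eqI)
  fix u show "lookup p u = lookup (single 0 (lookup p 0)) u"
    using assms by (cases "u = 0") (auto simp: homogeneous_def in_keys_iff lookup_single "when_def")
qed

definition homogeneous_part :: "nat \<Rightarrow> ('x nc_word \<Rightarrow>\<^sub>0 'k::comm_monoid_add) \<Rightarrow> ('x nc_word \<Rightarrow>\<^sub>0 'k)" where
  "homogeneous_part d p =
    (\<Sum>u | u \<in> keys p \<and> length (letters u) = d. single u (lookup p u))"

lemma lookup_homogeneous_part:
  "lookup (homogeneous_part d p) u = (if length (letters u) = d then lookup p u else 0)"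
proof -
  have "lookup (homogeneous_part d p) u =
    (\<Sum>v | v \<in> keys p \<and> length (letters v) = d. if v = u then lookup p u else 0)"
    unfolding homogeneous_part_def lookup_sum by (rule sum.cong) (auto simp: lookup_single "when_def")
  then show ?thesis
    by (simp add: in_keys_iff)
qed

lemma homogeneous_homogeneous_part: "homogeneous d (homogeneous_part d p)"
  by (auto simp: homogeneous_def in_keys_iff lookup_homogeneous_part split: if_splits)

lemma homogeneous_part_mem:
  fixes p :: "nat nc_word \<Rightarrow>\<^sub>0 'k::field"
  shows "p \<in> carrier (free_algebra n) \<Longrightarrow> homogeneous_part d p \<in> carrier (free_algebra n)"
  by (auto simp: in_keys_iff lookup_homogeneous_part split: if_splits)

lemma sum_homogeneous_part:
  obtains D where "p = (\<Sum>d<D. homogeneous_part d p)"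
proof -
  let ?L = "(\<lambda>u. length (letters u)) ` keys p"
  define D where "D = Suc (Max (insert 0 ?L))"
  have "p = (\<Sum>d<D. homogeneous_part d p)"
  proof (rule poly_mapping_eqI)
    fix u
    have "length (letters u) < D" if "lookup p u \<noteq> 0"
      using that by (auto simp: D_def less_Suc_eq_le in_keys_iff intro!: Max_ge)
    then show "lookup p u = lookup (\<Sum>d<D. homogeneous_part d p) u"
      by (auto simp: lookup_sum lookup_homogeneous_part)
  qed
  then show ?thesis
    by (rule that)
qed

context assoc_algebra
begin

lemma free_eval_superset:
  assumes "finite S" "keys p \<subseteq> S"
  shows "free_eval scale x p = (\<Sum>u\<in>S. scale (lookup p u) (prod_list (map x (letters u))))"
  unfolding free_eval_def using assms by (intro sum.mono_neutral_left) (auto simp: in_keys_iff)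

lemma free_eval_add: "free_eval scale x (p + q) = free_eval scale x p + free_eval scale x q"
proof -
  let ?S = "keys p \<union> keys q"
  show ?thesis
    using keys_add[of p q]
    by (subst (1 2 3) free_eval_superset[of ?S]) (auto simp: lookup_add scale_left_distrib sum.distrib)
qed

lemma free_eval_single [simp]: "free_eval scale x (single u c) = scale c (prod_list (map x (letters u)))"
  by (subst free_eval_superset[of "{u}"]) auto

lemma free_eval_zero [simp]: "free_eval scale x 0 = 0"
  by (simp add: free_eval_def)

lemma free_eval_diff:
  "free_eval scale x (p - q) = free_eval scale x p - free_eval scale x q"
  using free_eval_add[of x "p - q" q] by simp

lemma free_eval_sum: "free_eval scale x (sum f S) = (\<Sum>i\<in>S. free_eval scale x (f i))"
  by (induction S rule: infinite_finite_induct) (simp_all add: free_eval_add)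

lemma free_eval_mult: "free_eval scale x (p * q) = free_eval scale x p * free_eval scale x q"
  by (rule biadditive_eqI[where f = "\<lambda>p q. free_eval scale x (p * q)"])
    (simp_all add: free_eval_add algebra_simps mult_single scale_mult_left[symmetric] scale_mult_right[symmetric])

end

section \<open>Relations and the minimal resolution\<close>

definition tuple :: "'x set \<Rightarrow> ('x \<Rightarrow> 'b::comm_monoid_add) \<Rightarrow> ('x \<Rightarrow>\<^sub>0 'b)" where
  "tuple X f = (\<Sum>i\<in>X. single i (f i))"

lemma lookup_tuple: "finite X \<Longrightarrow> lookup (tuple X f) i = (if i \<in> X then f i else 0)"
  by (simp add: tuple_def lookup_sum lookup_single "when_def")

lemma keys_tuple: "finite X \<Longrightarrow> keys (tuple X f) \<subseteq> X"
  by (auto simp: in_keys_iff lookup_tuple split: if_splits)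

lemma tuple_lookup: "finite X \<Longrightarrow> keys q \<subseteq> X \<Longrightarrow> tuple X (lookup q) = q"
  by (rule poly_mapping_eqI) (auto simp: lookup_tuple in_keys_iff)

lemma tuple_cong: "(\<And>i. i \<in> X \<Longrightarrow> f i = g i) \<Longrightarrow> tuple X f = tuple X g"
  by (simp add: tuple_def)

text \<open>A row times the column \<open>c\<close>. Together with the next lemma this identifies
  homomorphisms from a finitely generated free module to the algebra with columns.\<close>

lemma hom_free_regularI:
  fixes c :: "'x \<Rightarrow> 'a::ring_1"
  shows "(\<lambda>q. \<Sum>j\<in>X. lookup q j * c j) \<in> module_homs (free_module Y) regular_module"
  by (rule module_homsI) (simp_all add: lookup_add algebra_simps sum.distrib sum_distrib_left)

lemma hom_free_regular_eq:
  fixes b :: "('x \<Rightarrow>\<^sub>0 'a::ring_1) \<Rightarrow> 'a"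
  assumes b: "b \<in> module_homs (free_module X) regular_module" and X: "finite X"
    and q: "q \<in> carrier (free_module X)"
  shows "b q = (\<Sum>j\<in>X. lookup q j * b (single j 1))"
proof (rule module_homs_free_eqI[OF left_module_regular_module b hom_free_regularI _ q])
  fix i assume "i \<in> X"
  then show "b (single i 1) =
    (\<Sum>j\<in>X. lookup (single i 1) j * b (single j 1))"
    using X by (simp add: lookup_single "when_def" if_distrib[of "\<lambda>x. x * _"] cong: if_cong)
qed

locale graded_presentation = connected_graded_algebra scale gr
  for scale :: "'k::field \<Rightarrow> 'a::ring_1 \<Rightarrow> 'a" and gr :: "nat \<Rightarrow> 'a set" +
  fixes n :: nat and x :: "nat \<Rightarrow> 'a" and R :: "(nat nc_word \<Rightarrow>\<^sub>0 'k) set"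
  assumes x_mem: "\<And>i. i < n \<Longrightarrow> x i \<in> gr 1"
    and finite_R: "finite R"
    and R_homogeneous: "\<And>p. p \<in> R \<Longrightarrow> \<exists>d\<ge>2. homogeneous d p"
    and presented: "presented_by scale n x R"
begin

abbreviation ev :: "(nat nc_word \<Rightarrow>\<^sub>0 'k) \<Rightarrow> 'a" where
  "ev \<equiv> free_eval scale x"

abbreviation F :: "(nat nc_word \<Rightarrow>\<^sub>0 'k) set" where
  "F \<equiv> carrier (free_algebra n)"

lemma R_subset: "R \<subseteq> F"
  using presented by (simp add: presented_by_def)

lemma kernel_eq: "{p \<in> F. ev p = 0} = Idl\<^bsub>free_algebra n\<^esub> R"
  using presented by (simp add: presented_by_def)

lemma R_ev: "p \<in> R \<Longrightarrow> ev p = 0"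
  using kernel_eq ring.genideal_self[OF ring_free_algebra R_subset] by blast

lemma ev_surj: obtains p where "p \<in> F" "ev p = a"
proof -
  have "a \<in> ev ` F"
    using presented by (simp add: presented_by_def)
  then show ?thesis
    using that by blast
qed

lemma ev_const [simp]: "ev (single 0 c) = scale c 1"
  by simp

lemma ev_expansion:
  assumes "p \<in> F"
  shows "ev p = scale (lookup p 0) 1 + (\<Sum>i<n. ev (strip i p) * x i)"
  by (subst strip_expansion[OF assms]) (simp add: free_eval_add free_eval_sum free_eval_mult)

lemma prod_list_mem_gr: "set u \<subseteq> {..<n} \<Longrightarrow> prod_list (map x u) \<in> gr (length u)"
proof (induction u)
  case Nil
  then show ?case
    by (simp add: one_mem_gr_0)
next
  case (Cons i u)
  then show ?case
    using gr_mult[OF x_mem[of i] Cons.IH] by simp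
qed

lemma ev_mem_gr:
  assumes "p \<in> F" "homogeneous d p"
  shows "ev p \<in> gr d"
  unfolding free_eval_def
proof (rule gr_sum, rule gr_scale)
  fix u assume "u \<in> keys p"
  then show "prod_list (map x (letters u)) \<in> gr d"
    using assms prod_list_mem_gr[of "letters u"] by (auto simp: homogeneous_def)
qed

text \<open>Evaluation respects the gradings because the generators lie in degree 1; this is why
  homogeneous elements have homogeneous lifts.\<close>

lemma component_ev:
  assumes "p \<in> F"
  shows "component (ev p) d = ev (homogeneous_part d p)"
proof -
  obtain D where D: "p = (\<Sum>d<D. homogeneous_part d p)"
    by (rule sum_homogeneous_part)
  have hom: "ev (homogeneous_part d p) \<in> gr d" for d
    by (intro ev_mem_gr homogeneous_part_mem assms homogeneous_homogeneous_part)
  have "component (ev p) d = (\<Sum>e<D. component (ev (homogeneous_part e p)) d)"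
    by (subst D) (simp add: free_eval_sum component_sum)
  also have "\<dots> = (\<Sum>e<D. if e = d then ev (homogeneous_part d p) else 0)"
    by (rule sum.cong) (auto simp: component_homogeneous[OF hom])
  also have "\<dots> = ev (homogeneous_part d p)"
  proof (cases "d < D")
    case False
    have "homogeneous_part d p = 0"
    proof (rule poly_mapping_eqI)
      fix u
      have "lookup p u = 0" if "length (letters u) = d"
        using that False by (subst D) (simp add: lookup_sum lookup_homogeneous_part)
      then show "lookup (homogeneous_part d p) u = lookup 0 u"
        by (simp add: lookup_homogeneous_part)
    qed
    then show ?thesis
      by simp
  qed simp
  finally show ?thesis .
qed

lemma lift_homogeneous:
  assumes "a \<in> gr d"
  obtains p where "p \<in> F" "homogeneous d p" "ev p = a"
proof -
  obtain p where p: "p \<in> F" "ev p = a"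
    by (rule ev_surj)
  then have "ev (homogeneous_part d p) = a"
    using component_ev[OF p(1), of d] assms by (simp add: component_homogeneous)
  then show ?thesis
    using that homogeneous_part_mem[OF p(1)] homogeneous_homogeneous_part by blast
qed

lemma aug_x: "i < n \<Longrightarrow> aug (x i) = 0"
  using x_mem by (intro aug_homogeneous) auto

lemma right_expansion: obtains q where "a = scale (aug a) 1 + (\<Sum>i<n. q i * x i)"
proof -
  obtain p where p: "p \<in> F" "ev p = a"
    by (rule ev_surj)
  have a: "a = scale (lookup p 0) 1 + (\<Sum>i<n. ev (strip i p) * x i)"
    using ev_expansion[OF p(1)] p(2) by simp
  then have "aug a = lookup p 0"
    by (subst a) (simp add: aug_add aug_scale aug_sum aug_mult aug_x)
  then show ?thesis
    using a that by metis
qed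

text \<open>\<open>strip\<close> concerns the last letter, so the first letter is split off word by
  word instead.\<close>

lemma left_expansion: obtains q where "a = scale (aug a) 1 + (\<Sum>i<n. x i * q i)"
proof -
  obtain p where p: "p \<in> F" "ev p = a"
    by (rule ev_surj)
  have "keys p \<subseteq> {u. set (letters u) \<subseteq> {..<n}}"
    using p(1) by auto
  then have "\<exists>c q. ev p = scale c 1 + (\<Sum>i<n. x i * q i)"
  proof (induction p rule: poly_mapping_single_induct)
    case zero
    show ?case
      by (intro exI[of _ 0] exI[of _ "\<lambda>_. 0"]) simp
  next
    case (single_add u c p)
    then obtain c' q where cq: "ev p = scale c' 1 + (\<Sum>i<n. x i * q i)"
      by blast
    show ?case
    proof (cases "letters u")
      case Nil
      then show ?thesis
        using cq by (intro exI[of _ "c + c'"] exI[of _ q])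
          (simp add: free_eval_add scale_left_distrib add.assoc)
    next
      case (Cons i v)
      then have i: "i < n"
        using single_add.hyps by simp
      have "(\<Sum>k<n. x k * (q k + (if k = i then scale c (prod_list (map x v)) else 0))) =
        (\<Sum>k<n. x k * q k) + (\<Sum>k<n. if k = i then x i * scale c (prod_list (map x v)) else 0)"
        unfolding sum.distrib[symmetric] by (rule sum.cong) (auto simp: distrib_left)
      then have "ev (single u c + p) =
        scale c' 1 + (\<Sum>k<n. x k * (q k + (if k = i then scale c (prod_list (map x v)) else 0)))"
        using i Cons cq by (simp add: free_eval_add scale_mult_right add.commute add.left_commute)
      then show ?thesis
        by (intro exI)
    qed
  qed
  then obtain c q where a: "a = scale c 1 + (\<Sum>i<n. x i * q i)"
    using p by blast
  then have "aug a = c"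
    by (subst a) (simp add: aug_add aug_scale aug_sum aug_mult aug_x)
  then show ?thesis
    using a that by metis
qed

definition relation_family :: "nat set \<Rightarrow> (nat \<Rightarrow> nat nc_word \<Rightarrow>\<^sub>0 'k) \<Rightarrow> bool" where
  "relation_family J r \<longleftrightarrow> finite J \<and>
    (\<forall>j\<in>J. r j \<in> F \<and> ev (r j) = 0 \<and> (\<exists>d\<ge>2. homogeneous d (r j))) \<and>
    (\<forall>q. (\<Sum>i<n. q i * x i) = 0 \<longrightarrow> (\<exists>c. \<forall>i<n. q i = (\<Sum>j\<in>J. c j * ev (strip i (r j)))))"

text \<open>The polynomials without constant term whose rows of derivatives are generated by those
  of the relations form a two-sided ideal \<open>S\<close>. It contains \<open>R\<close>, hence the
  kernel of evaluation, and lifting the coefficients of a relation between the \<open>x i\<close>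
  produces an element of that kernel.\<close>

lemma relation_family_exists:
  obtains J r where "relation_family J r"
proof -
  obtain r and m :: nat where R: "R = r ` {..<m}"
    using finite_imp_nat_seg_image_inj_on[OF finite_R] by (auto simp: lessThan_def)
  let ?J = "{..<m}"
  have r: "r j \<in> F" "ev (r j) = 0" "\<exists>d\<ge>2. homogeneous d (r j)" if "j \<in> ?J" for j
    using that R R_subset R_ev R_homogeneous by auto
  have r0: "lookup (r j) 0 = 0" if "j \<in> ?J" for j
    using r(3)[OF that] homogeneous_lookup_zero
    by (metis Suc_le_D Suc_1)
  have evr: "(\<Sum>i<n. ev (strip i (r j)) * x i) = 0" if "j \<in> ?J" for j
    using ev_expansion[OF r(1)[OF that]] r(2)[OF that] r0[OF that] by simp
  define S where "S = {p \<in> F. lookup p 0 = 0 \<and>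
    (\<exists>c. \<forall>i<n. ev (strip i p) = (\<Sum>j\<in>?J. c j * ev (strip i (r j))))}"
  have S_I: "p \<in> S" if "p \<in> F" "lookup p 0 = 0"
    "\<forall>i<n. ev (strip i p) = (\<Sum>j\<in>?J. c j * ev (strip i (r j)))" for p c
    unfolding S_def using that by blast
  have S_F: "p \<in> F" if "p \<in> S" for p
    using that by (simp add: S_def)
  have ev_S: "ev p = 0" if p: "p \<in> S" for p
  proof -
    obtain c where c: "\<forall>i<n. ev (strip i p) = (\<Sum>j\<in>?J. c j * ev (strip i (r j)))"
      using p by (auto simp: S_def)
    have "ev p = (\<Sum>i<n. (\<Sum>j\<in>?J. c j * ev (strip i (r j))) * x i)"
      using ev_expansion[of p] p c by (simp add: S_def)
    also have "\<dots> = (\<Sum>j\<in>?J. c j * (\<Sum>i<n. ev (strip i (r j)) * x i))"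
      by (simp add: sum_distrib_left sum_distrib_right mult.assoc sum.swap[of _ _ ?J])
    also have "\<dots> = 0"
      using evr by simp
    finally show ?thesis .
  qed
  have "ideal S (free_algebra n)"
  proof (rule ideal_free_algebraI)
    show "S \<subseteq> F"
      by (auto simp: S_def)
    show "0 \<in> S"
      by (auto simp: S_def intro!: exI[of _ "\<lambda>_. 0"])
    fix p q assume q: "q \<in> S"
    then obtain c where c: "\<forall>i<n. ev (strip i q) = (\<Sum>j\<in>?J. c j * ev (strip i (r j)))"
      by (auto simp: S_def)
    show "p + q \<in> S" if p: "p \<in> S"
    proof -
      obtain c' where c': "\<forall>i<n. ev (strip i p) = (\<Sum>j\<in>?J. c' j * ev (strip i (r j)))"
        using p by (auto simp: S_def)
      have "\<forall>i<n. ev (strip i (p + q)) = (\<Sum>j\<in>?J. (c' j + c j) * ev (strip i (r j)))"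
        using c c' by (simp add: strip_add free_eval_add distrib_right sum.distrib)
      then show ?thesis
        using p q free_algebra_add[of p n q] by (auto simp: S_def lookup_add)
    qed
    assume p: "p \<in> F"
    have "\<forall>i<n. ev (strip i (p * q)) = (\<Sum>j\<in>?J. (ev p * c j) * ev (strip i (r j)))"
      using c q by (simp add: S_def strip_mult free_eval_add free_eval_mult sum_distrib_left mult.assoc)
    moreover have "lookup (p * q) 0 = 0"
      using q by (simp add: S_def lookup_mult_zero_word)
    ultimately show "p * q \<in> S"
      by (intro S_I free_algebra_mult[OF p S_F[OF q]])
    \<comment> \<open>Here the summand with \<open>strip i p\<close> vanishes because
      \<open>ev q = 0\<close>, and the constant term of \<open>p\<close> acts as a scalar.\<close>
    have "\<forall>i<n. ev (strip i (q * p)) = (\<Sum>j\<in>?J. scale (lookup p 0) (c j) * ev (strip i (r j)))"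
      using c by (simp add: strip_mult free_eval_add free_eval_mult ev_S[OF q] scale_sum_right scale_mult_left)
    moreover have "lookup (q * p) 0 = 0"
      using q by (simp add: S_def lookup_mult_zero_word)
    ultimately show "q * p \<in> S"
      by (intro S_I free_algebra_mult[OF S_F[OF q] p])
  qed
  moreover have "R \<subseteq> S"
  proof
    fix p assume "p \<in> R"
    then obtain j where j: "j \<in> ?J" "p = r j"
      using R by blast
    have "\<forall>i<n. ev (strip i p) = (\<Sum>k\<in>?J. (if k = j then 1 else 0) * ev (strip i (r k)))"
      using j by (simp add: if_distrib[of "\<lambda>x. x * _"] cong: if_cong)
    then show "p \<in> S"
      using r(1)[OF j(1)] r0[OF j(1)] j(2) by (intro S_I) auto
  qed
  ultimately have sub: "{p \<in> F. ev p = 0} \<subseteq> S"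
    unfolding kernel_eq by (rule ring.genideal_minimal[OF ring_free_algebra])
  have "\<exists>c. \<forall>i<n. q i = (\<Sum>j\<in>?J. c j * ev (strip i (r j)))" if q: "(\<Sum>i<n. q i * x i) = 0" for q
  proof -
    have "\<forall>i. \<exists>p. p \<in> F \<and> ev p = q i"
      using ev_surj by (metis (no_types))
    from choice[OF this] obtain p where "\<forall>i. p i \<in> F \<and> ev (p i) = q i" ..
    then have p: "p i \<in> F" "ev (p i) = q i" for i
      by auto
    let ?p = "\<Sum>i<n. p i * letter i"
    have "?p \<in> F"
      by (intro free_algebra_sum free_algebra_mult p) simp
    moreover have "ev ?p = 0"
      using q p(2) by (simp add: free_eval_sum free_eval_mult)
    ultimately have "?p \<in> S"
      using sub by blast
    moreover have "strip i ?p = p i" if i: "i < n" for i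
    proof -
      have "NC_Word [k] \<noteq> 0" for k :: nat
        by (simp add: zero_nc_word_def)
      then have "strip i (p k * letter k) = (if k = i then p i else 0)" for k
        using strip_single_snoc[of i "[]" k "1::'k"] by (simp add: strip_mult NC_Word_Nil lookup_single)
      then show ?thesis
        using i by (simp add: strip_sum)
    qed
    ultimately obtain c where "\<forall>i<n. ev (p i) = (\<Sum>j\<in>?J. c j * ev (strip i (r j)))"
      unfolding S_def by fastforce
    then show ?thesis
      using p(2) by (intro exI[of _ c]) simp
  qed
  with r have "relation_family ?J r"
    unfolding relation_family_def by blast
  then show ?thesis
    by (rule that)
qed

lemma minimal_relation_family_exists:
  obtains J r where "relation_family J r" "\<And>j. j \<in> J \<Longrightarrow> \<not> relation_family (J - {j}) r"
proof -
  obtain J0 r where J0: "relation_family J0 r"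
    by (rule relation_family_exists)
  obtain J where J: "relation_family J r" "\<And>J'. relation_family J' r \<Longrightarrow> card J \<le> card J'"
    using ex_has_least_nat[of "\<lambda>J. relation_family J r" J0 card] J0 by blast
  have "\<not> relation_family (J - {j}) r" if "j \<in> J" for j
    using J(2)[of "J - {j}"] card_Diff1_less[of J j] J(1) that
    unfolding relation_family_def[of J] by (meson leD)
  with J(1) show ?thesis
    by (rule that)
qed

end

locale minimal_graded_presentation = graded_presentation scale gr n x R
  for scale :: "'k::field \<Rightarrow> 'a::ring_1 \<Rightarrow> 'a" and gr n x R +
  fixes J :: "nat set" and r :: "nat \<Rightarrow> nat nc_word \<Rightarrow>\<^sub>0 'k" and dg :: "nat \<Rightarrow> nat"
  assumes family: "relation_family J r"
    and minimal: "\<And>j. j \<in> J \<Longrightarrow> \<not> relation_family (J - {j}) r"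
    and dg: "\<And>j. j \<in> J \<Longrightarrow> 2 \<le> dg j" "\<And>j. j \<in> J \<Longrightarrow> homogeneous (dg j) (r j)"
begin

lemma finite_J [simp]: "finite J"
  using family by (simp add: relation_family_def)

lemma r_mem: "j \<in> J \<Longrightarrow> r j \<in> F"
  using family unfolding relation_family_def by blast

lemma ev_r: "j \<in> J \<Longrightarrow> ev (r j) = 0"
  using family unfolding relation_family_def by blast

lemma generate:
  assumes "(\<Sum>i<n. q i * x i) = 0"
  obtains c where "\<And>i. i < n \<Longrightarrow> q i = (\<Sum>j\<in>J. c j * ev (strip i (r j)))"
  using family assms unfolding relation_family_def by blast

definition M :: "nat \<Rightarrow> nat \<Rightarrow> 'a" where
  "M j i = ev (strip i (r j))"

lemma M_mem: "j \<in> J \<Longrightarrow> M j i \<in> gr (dg j - 1)"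
  unfolding M_def using dg[of j] r_mem[of j]
  by (intro ev_mem_gr strip_mem_free_algebra homogeneous_strip) auto

lemma aug_M: "j \<in> J \<Longrightarrow> aug (M j i) = 0"
  using dg(1)[of j] by (intro aug_homogeneous[OF M_mem]) auto

lemma M_x: "j \<in> J \<Longrightarrow> (\<Sum>i<n. M j i * x i) = 0"
proof -
  assume j: "j \<in> J"
  then have "lookup (r j) 0 = 0"
    using dg[of j] homogeneous_lookup_zero[of "dg j - 1" "r j"] by simp
  then show ?thesis
    using ev_expansion[OF r_mem[OF j]] ev_r[OF j] by (simp add: M_def)
qed

lemma M_generate:
  assumes "(\<Sum>i<n. q i * x i) = 0"
  obtains c where "\<And>i. i < n \<Longrightarrow> q i = (\<Sum>j\<in>J. c j * M j i)"
  using generate[OF assms] unfolding M_def by blast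

text \<open>Row \<open>j\<close> has entries of degree \<open>dg j - 1\<close>, so its coefficient
  contributes in degree \<open>d - dg j\<close>; the condition \<open>d \<ge> 1\<close> keeps the
  truncated subtractions consistent.\<close>

lemma component_combination:
  assumes "d \<ge> 1"
  shows "component (\<Sum>j\<in>J. c j * M j i) (d - 1) =
    (\<Sum>j\<in>J. (if dg j \<le> d then component (c j) (d - dg j) else 0) * M j i)"
  unfolding component_sum
proof (rule sum.cong[OF refl])
  fix j assume j: "j \<in> J"
  then have "dg j - 1 \<le> d - 1 \<longleftrightarrow> dg j \<le> d" "d - 1 - (dg j - 1) = d - dg j"
    using dg(1)[OF j] assms by auto
  then show "component (c j * M j i) (d - 1) = (if dg j \<le> d then component (c j) (d - dg j) else 0) * M j i"
    using component_mult_right[OF M_mem[OF j], of "c j" i "d - 1"] by auto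
qed

text \<open>Minimality of the resolution. In the part of the syzygy of degree \<open>dg j0\<close>
  the coefficient at \<open>j0\<close> is the scalar \<open>aug (c j0)\<close>; were it nonzero, row
  \<open>j0\<close> would be a combination of the others and its relation could be dropped.\<close>

lemma aug_syzygy:
  assumes c: "\<And>i. i < n \<Longrightarrow> (\<Sum>j\<in>J. c j * M j i) = 0" and j0: "j0 \<in> J"
  shows "aug (c j0) = 0"
proof (rule ccontr)
  assume nz: "aug (c j0) \<noteq> 0"
  define c' where "c' j = (if dg j \<le> dg j0 then component (c j) (dg j0 - dg j) else 0)" for j
  have c'0: "(\<Sum>j\<in>J. c' j * M j i) = 0" if "i < n" for i
    using component_combination[of "dg j0" c i] c[OF that] dg(1)[OF j0] by (simp add: c'_def)
  have c'j0: "c' j0 = scale (aug (c j0)) 1"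
    by (simp add: c'_def scale_aug)
  define e where "e j = scale (- inverse (aug (c j0))) (c' j)" for j
  have M0: "M j0 i = (\<Sum>j\<in>J - {j0}. e j * M j i)" if i: "i < n" for i
  proof -
    have "c' j0 * M j0 i + (\<Sum>j\<in>J - {j0}. c' j * M j i) = 0"
      using c'0[OF i] sum.remove[OF finite_J j0, of "\<lambda>j. c' j * M j i"] by simp
    then have "scale (aug (c j0)) (M j0 i) = - (\<Sum>j\<in>J - {j0}. c' j * M j i)"
      by (simp add: c'j0 eq_neg_iff_add_eq_0)
    then have "scale (inverse (aug (c j0))) (scale (aug (c j0)) (M j0 i)) =
      (\<Sum>j\<in>J - {j0}. e j * M j i)"
      by (simp add: e_def scale_sum_right sum_negf scale_mult_left[symmetric])
    then show ?thesis
      using nz by simp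
  qed
  have "relation_family (J - {j0}) r"
    unfolding relation_family_def
  proof (intro conjI allI impI ballI)
    fix q assume "(\<Sum>i<n. q i * x i) = 0"
    then obtain b where b: "\<And>i. i < n \<Longrightarrow> q i = (\<Sum>j\<in>J. b j * M j i)"
      by (rule M_generate) blast
    have "q i = (\<Sum>j\<in>J - {j0}. (b j + b j0 * e j) * M j i)" if i: "i < n" for i
    proof -
      have "q i = (\<Sum>j\<in>J - {j0}. b j * M j i) + b j0 * M j0 i"
        using b[OF i] sum.remove[OF finite_J j0, of "\<lambda>j. b j * M j i"] by (simp add: add.commute)
      also have "\<dots> = (\<Sum>j\<in>J - {j0}. b j * M j i) + b j0 * (\<Sum>j\<in>J - {j0}. e j * M j i)"
        by (simp only: M0[OF i])
      also have "\<dots> = (\<Sum>j\<in>J - {j0}. (b j + b j0 * e j) * M j i)"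
        by (simp only: distrib_right sum.distrib sum_distrib_left mult.assoc)
      finally show ?thesis .
    qed
    then show "\<exists>c. \<forall>i<n. q i = (\<Sum>j\<in>J - {j0}. c j * ev (strip i (r j)))"
      by (intro exI[of _ "\<lambda>j. b j + b j0 * e j"]) (simp add: M_def)
  next
    fix j assume "j \<in> J - {j0}"
    then show "r j \<in> F" "ev (r j) = 0" "\<exists>d\<ge>2. homogeneous d (r j)"
      using r_mem ev_r dg by blast+
  qed simp
  with minimal[OF j0] show False
    by contradiction
qed

section \<open>The explicit complex of free modules\<close>

definition e_map :: "(nat \<Rightarrow>\<^sub>0 'a) \<Rightarrow> 'k" where
  "e_map q = aug (lookup q 0)"

definition d1_map :: "(nat \<Rightarrow>\<^sub>0 'a) \<Rightarrow> (nat \<Rightarrow>\<^sub>0 'a)" where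
  "d1_map q = single 0 (\<Sum>i<n. lookup q i * x i)"

definition d2_map :: "(nat \<Rightarrow>\<^sub>0 'a) \<Rightarrow> (nat \<Rightarrow>\<^sub>0 'a)" where
  "d2_map q = tuple {..<n} (\<lambda>i. \<Sum>j\<in>J. lookup q j * M j i)"

text \<open>Exactness at A is the right expansion of the augmentation ideal, exactness at A^n the
  last clause of \<open>relation_family\<close>.\<close>

lemma free_resolution: "free_resolution triv {0} {..<n} J d1_map d2_map e_map"
proof (rule free_resolution.intro)
  show "left_module triv"
    by (rule left_module_trivial_module)
  show "e_map \<in> module_homs (free_module {0}) triv"
    by (rule module_homsI) (simp_all add: e_map_def lookup_add aug_add aug_mult)
  show "d1_map \<in> module_homs (free_module {..<n}) (free_module {0})"
    by (rule module_homsI)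
      (auto intro!: poly_mapping_eqI simp: d1_map_def lookup_single lookup_add algebra_simps
        sum.distrib sum_distrib_left "when_def")
  show "d2_map \<in> module_homs (free_module J) (free_module {..<n})"
    using keys_tuple[of "{..<n}"]
    by (intro module_homsI)
      (auto intro!: poly_mapping_eqI simp: d2_map_def lookup_tuple lookup_add algebra_simps
        sum.distrib sum_distrib_left in_keys_iff split: if_splits)
  have "c \<in> e_map ` carrier (free_module {0})" for c
    by (rule image_eqI[of _ _ "single 0 (scale c 1)"]) (simp_all add: e_map_def aug_scale)
  then show "e_map ` carrier (free_module {0}) = carrier triv"
    by auto
  have aug_d1: "e_map (d1_map q) = 0" for q
    by (simp add: e_map_def d1_map_def aug_sum aug_mult aug_x)
  have "q \<in> d1_map ` carrier (free_module {..<n})"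
    if q: "q \<in> carrier (free_module {0})" "e_map q = 0" for q
  proof -
    obtain b where "lookup q 0 = scale (aug (lookup q 0)) 1 + (\<Sum>i<n. b i * x i)"
      by (rule right_expansion)
    then have "lookup q 0 = (\<Sum>i<n. b i * x i)"
      using q(2) by (simp add: e_map_def)
    then have "q = d1_map (tuple {..<n} b)"
      using q(1) by (auto intro!: poly_mapping_eqI simp: d1_map_def lookup_tuple lookup_single in_keys_iff subset_iff "when_def")
    then show ?thesis
      using keys_tuple[of "{..<n}" b] by auto
  qed
  then show "{q \<in> carrier (free_module {0}). e_map q = \<zero>\<^bsub>triv\<^esub>} =
    d1_map ` carrier (free_module {..<n})"
    using aug_d1 by (auto simp: d1_map_def split: if_splits)
  have d1_d2: "d1_map (d2_map q) = 0" for q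
  proof -
    have "(\<Sum>i<n. (\<Sum>j\<in>J. lookup q j * M j i) * x i) =
      (\<Sum>j\<in>J. lookup q j * (\<Sum>i<n. M j i * x i))"
      by (simp add: sum_distrib_left sum_distrib_right mult.assoc sum.swap[of _ _ J])
    then show ?thesis
      by (simp add: d1_map_def d2_map_def lookup_tuple M_x)
  qed
  have "q \<in> d2_map ` carrier (free_module J)"
    if q: "q \<in> carrier (free_module {..<n})" "d1_map q = 0" for q
  proof -
    have "(\<Sum>i<n. lookup q i * x i) = 0"
      using q(2) unfolding d1_map_def by (metis lookup_single_eq lookup_zero)
    then obtain c where c: "\<And>i. i < n \<Longrightarrow> lookup q i = (\<Sum>j\<in>J. c j * M j i)"
      by (rule M_generate) blast
    have "q = d2_map (tuple J c)"
      using tuple_lookup[of "{..<n}" q] q(1) c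
      by (simp add: d2_map_def lookup_tuple) (metis (no_types, lifting) lessThan_iff tuple_cong)
    then show ?thesis
      using keys_tuple[of J c] by auto
  qed
  then show "{q \<in> carrier (free_module {..<n}). d1_map q = 0} = d2_map ` carrier (free_module J)"
    using d1_d2 keys_tuple[of "{..<n}"] unfolding d2_map_def by (auto dest: subsetD[OF keys_tuple, rotated])
qed

sublocale res: free_resolution triv "{0}" "{..<n}" J d1_map d2_map e_map
  by (rule free_resolution)

lemma mem_syzygies_iff:
  "q \<in> res.syzygies \<longleftrightarrow> keys q \<subseteq> J \<and> (\<forall>i<n. (\<Sum>j\<in>J. lookup q j * M j i) = 0)"
proof -
  have "d2_map q = 0 \<longleftrightarrow> (\<forall>i<n. (\<Sum>j\<in>J. lookup q j * M j i) = 0)"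
    by (simp add: d2_map_def poly_mapping_eq_iff fun_eq_iff lookup_tuple)
  then show ?thesis
    by (simp add: res.syzygies_def)
qed

end

section \<open>The third syzygies of a Gorenstein algebra of dimension 3\<close>

text \<open>A basis of \<open>U\<close> stays independent when \<open>c\<close> is added, so the
  values on it can be prescribed.\<close>

lemma (in vector_space) exists_functional:
  assumes "subspace U" "c \<notin> U"
  obtains lf where "Vector_Spaces.linear scale (*) lf" "lf c = 1" "\<And>u. u \<in> U \<Longrightarrow> lf u = 0"
proof -
  interpret pair: vector_space_pair scale "(*) :: 'a \<Rightarrow> 'a \<Rightarrow> 'a"
    by unfold_locales (simp_all add: algebra_simps)
  obtain B where B: "B \<subseteq> U" "independent B" "U \<subseteq> span B"
    by (rule maximal_independent_subset)
  then have span: "span B = U"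
    using assms(1) span_minimal by blast
  then have "independent (insert c B)"
    using B(2) assms(2) by (simp add: independent_insertI)
  then obtain lf where l: "Vector_Spaces.linear scale (*) lf" "\<forall>y\<in>insert c B. lf y = (if y = c then 1 else 0)"
    using pair.linear_independent_extend[of "insert c B" "\<lambda>y. if y = c then 1 else 0"] by blast
  have "lf u = 0" if "u \<in> U" for u
  proof (rule pair.linear_eq_0_on_span[OF l(1)])
    show "u \<in> span B"
      using that span by simp
    show "lf y = 0" if "y \<in> B" for y
      using l(2) that assms(2) B(1) by auto
  qed
  then show ?thesis
    using l that by simp
qed

text \<open>The lowest nonzero component of \<open>a\<close> survives multiplication by
  \<open>u\<close>, whose component of degree 0 is the unit.\<close>

lemma (in connected_graded_algebra) mult_eq_0_if_aug_1:
  assumes "a * u = 0" "aug u = 1"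
  shows "a = 0"
proof (rule ccontr)
  assume "a \<noteq> 0"
  then have "\<exists>m. component a m \<noteq> 0"
    using component_eqI[of a 0] by auto
  define m where "m = (LEAST m. component a m \<noteq> 0)"
  have m: "component a m \<noteq> 0"
    unfolding m_def using \<open>\<exists>m. component a m \<noteq> 0\<close> by (rule LeastI_ex)
  have less: "component a i = 0" if "i < m" for i
    using that not_less_Least unfolding m_def by blast
  have "component (a * u) m = (\<Sum>i\<le>m. if i = m then component a m * component u 0 else 0)"
    unfolding component_mult by (rule sum.cong) (auto simp: less)
  also have "\<dots> = component a m"
    using assms(2) scale_aug[of u] by simp
  finally show False
    using m assms(1) by simp
qed

locale gorenstein_presentation = minimal_graded_presentation scale gr n x R J r dg
  for scale :: "'k::field \<Rightarrow> 'a::ring_1 \<Rightarrow> 'a" and gr n x R J r dg +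
  fixes P P' :: "nat \<Rightarrow> ('a, 'u) module"
    and d eP f0 f1 f2 g0 g1 g2 h0 h1 d' eP' f0' f1' f2' g0' g1' g2' h0' h1'
  assumes comparison: "resolution_comparison triv {0} {..<n} J d1_map d2_map e_map
      P d eP f0 f1 f2 g0 g1 g2 h0 h1"
    and Ext_vanish: "\<And>i. i \<noteq> 3 \<Longrightarrow> cocycles P d i \<subseteq> coboundaries P d i"
    and Ext_3: "modules_isomorphic
      (quotient_module ((dual_module (P 3))\<lparr>carrier := cocycles P d 3\<rparr>) (coboundaries P d 3)) triv"
    and short_comparison: "resolution_comparison triv {0} {..<n} J d1_map d2_map e_map
      P' d' eP' f0' f1' f2' g0' g1' g2' h0' h1'"
    and short_length: "carrier (P' 4) = {\<zero>\<^bsub>P' 4\<^esub>}"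
begin

interpretation cmp: resolution_comparison triv "{0}" "{..<n}" J d1_map d2_map e_map
  P d eP f0 f1 f2 g0 g1 g2 h0 h1
  by (rule comparison)

interpretation short: resolution_comparison triv "{0}" "{..<n}" J d1_map d2_map e_map
  P' d' eP' f0' f1' f2' g0' g1' g2' h0' h1'
  by (rule short_comparison)

section \<open>The Ext groups in coordinates\<close>

lemma ext_vanish:
  "cocycles P d 0 \<subseteq> coboundaries P d 0" "cocycles P d 1 \<subseteq> coboundaries P d 1"
  "cocycles P d 2 \<subseteq> coboundaries P d 2"
  by (simp_all add: Ext_vanish del: coboundaries.simps)

lemma ext0:
  assumes "\<And>i. i < n \<Longrightarrow> x i * a = 0"
  shows "a = 0"
proof -
  let ?b = "\<lambda>q. \<Sum>j\<in>{0::nat}. lookup q j * a"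
  have bd: "?b (d1_map q) = 0" for q
    using assms by (simp add: d1_map_def sum_distrib_right mult.assoc)
  from cmp.hom_free_zero[OF ext_vanish(1) hom_free_regularI bd, of "single 0 1"] show ?thesis
    by simp
qed

text \<open>Vanishing of Ext^1 with columns in place of homomorphisms: \<open>?b\<close> multiplies
  a row by the column \<open>b\<close>, and a homomorphism from A is right multiplication by its
  value at the unit.\<close>

lemma ext1:
  assumes "\<And>j. j \<in> J \<Longrightarrow> (\<Sum>i<n. M j i * b i) = 0"
  obtains a where "\<And>i. i < n \<Longrightarrow> b i = x i * a"
proof -
  let ?b = "\<lambda>q. \<Sum>i<n. lookup q i * b i"
  have bd: "?b (d2_map q) = 0" for q
  proof -
    have "(\<Sum>i<n. (\<Sum>j\<in>J. lookup q j * M j i) * b i) =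
      (\<Sum>j\<in>J. lookup q j * (\<Sum>i<n. M j i * b i))"
      by (simp add: sum_distrib_left sum_distrib_right mult.assoc sum.swap[of _ _ J])
    then show ?thesis
      using assms by (simp add: d2_map_def lookup_tuple)
  qed
  from cmp.hom_free_factor1[OF ext_vanish(2) hom_free_regularI bd] obtain b' where
    b': "b' \<in> module_homs (free_module {0}) regular_module"
      "\<And>q. q \<in> carrier (free_module {..<n}) \<Longrightarrow> ?b q = b' (d1_map q)"
    by blast
  have "b i = x i * b' (single 0 1)" if i: "i < n" for i
  proof -
    have "?b (single i 1) = b i"
      using i by (simp add: lookup_single "when_def" if_distrib[of "\<lambda>x. x * _"] cong: if_cong)
    moreover have "d1_map (single i 1) = single 0 (x i)"
      using i by (simp add: d1_map_def lookup_single "when_def" if_distrib[of "\<lambda>x. x * _"] cong: if_cong)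
    moreover have "b' (single 0 (x i)) = x i * b' (single 0 1)"
      using hom_free_regular_eq[OF b'(1), of "single 0 (x i)"] by simp
    ultimately show ?thesis
      using b'(2)[of "single i 1"] i by simp
  qed
  then show ?thesis
    by (rule that)
qed

text \<open>Vanishing of Ext^2: a column orthogonal to all of \<Omega> is a cocycle, hence a right
  combination of the columns of \<open>M\<close>.\<close>

lemma ext2:
  assumes "\<And>q. q \<in> res.syzygies \<Longrightarrow> (\<Sum>j\<in>J. lookup q j * b j) = 0"
  obtains c where "\<And>j. j \<in> J \<Longrightarrow> b j = (\<Sum>i<n. M j i * c i)"
proof -
  let ?b = "\<lambda>q. \<Sum>j\<in>J. lookup q j * b j"
  from cmp.hom_free_factor2[OF ext_vanish(3) hom_free_regularI assms] obtain b' where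
    b': "b' \<in> module_homs (free_module {..<n}) regular_module"
      "\<And>q. q \<in> carrier (free_module J) \<Longrightarrow> ?b q = b' (d2_map q)"
    by blast
  have "b j = (\<Sum>i<n. M j i * b' (single i 1))" if j: "j \<in> J" for j
  proof -
    have "?b (single j 1) = b j"
      using j by (simp add: lookup_single "when_def" if_distrib[of "\<lambda>x. x * _"] cong: if_cong)
    moreover have "d2_map (single j 1) = tuple {..<n} (M j)"
      using j by (simp add: d2_map_def lookup_single "when_def" if_distrib[of "\<lambda>x. x * _"] cong: if_cong)
    moreover have "b' (tuple {..<n} (M j)) = (\<Sum>i<n. M j i * b' (single i 1))"
      using hom_free_regular_eq[OF b'(1), of "tuple {..<n} (M j)"] keys_tuple[of "{..<n}" "M j"]
      by (simp add: lookup_tuple)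
    ultimately show ?thesis
      using b'(2)[of "single j 1"] j by simp
  qed
  then show ?thesis
    by (rule that)
qed

lemma ext3:
  obtains \<Phi> :: "((nat \<Rightarrow>\<^sub>0 'a) \<Rightarrow> 'a) \<Rightarrow> 'k" where
    "\<And>b b'. b \<in> module_homs res.syzygy_module regular_module \<Longrightarrow>
      b' \<in> module_homs res.syzygy_module regular_module \<Longrightarrow> \<Phi> (\<lambda>q. b q + b' q) = \<Phi> b + \<Phi> b'"
    "\<And>b a. b \<in> module_homs res.syzygy_module regular_module \<Longrightarrow> \<Phi> (\<lambda>q. b q * a) = aug a * \<Phi> b"
    "\<And>b. b \<in> module_homs res.syzygy_module regular_module \<Longrightarrow> \<Phi> b = 0 \<Longrightarrow>
      \<exists>c. \<forall>q\<in>res.syzygies. b q = (\<Sum>j\<in>J. lookup q j * c j)"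
proof -
  show ?thesis
  proof (rule cmp.syzygy_class_map[OF left_module_trivial_module Ext_3])
    fix \<Phi> :: "((nat \<Rightarrow>\<^sub>0 'a) \<Rightarrow> 'a) \<Rightarrow> 'k"
    assume add: "\<And>b b'. b \<in> module_homs res.syzygy_module regular_module \<Longrightarrow>
        b' \<in> module_homs res.syzygy_module regular_module \<Longrightarrow>
        \<Phi> (\<lambda>q. b q + b' q) = \<Phi> b \<oplus>\<^bsub>triv\<^esub> \<Phi> b'"
      and smult: "\<And>b a. b \<in> module_homs res.syzygy_module regular_module \<Longrightarrow>
        \<Phi> (\<lambda>q. b q * a) = a \<odot>\<^bsub>triv\<^esub> \<Phi> b"
      and zero: "\<And>b. b \<in> module_homs res.syzygy_module regular_module \<Longrightarrow>
        \<Phi> b = \<zero>\<^bsub>triv\<^esub> \<Longrightarrow>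
        \<exists>b'\<in>module_homs (free_module J) regular_module. \<forall>q\<in>res.syzygies. b' q = b q"
    show ?thesis
    proof (rule that[of \<Phi>])
      fix b assume b: "b \<in> module_homs res.syzygy_module regular_module"
      show "\<Phi> (\<lambda>q. b q + b' q) = \<Phi> b + \<Phi> b'"
        if "b' \<in> module_homs res.syzygy_module regular_module" for b'
        using add[OF b that] by simp
      show "\<Phi> (\<lambda>q. b q * a) = aug a * \<Phi> b" for a
        using smult[OF b] by simp
      assume "\<Phi> b = 0"
      then obtain b' where b': "b' \<in> module_homs (free_module J) regular_module" "\<forall>q\<in>res.syzygies. b' q = b q"
        using zero[OF b] by auto
      have "b q = (\<Sum>j\<in>J. lookup q j * b' (single j 1))" if "q \<in> res.syzygies" for q
        using hom_free_regular_eq[OF b'(1) finite_J, of q] subsetD[OF cmp.syzygies_subset that] b'(2) that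
        by simp
      then show "\<exists>c. \<forall>q\<in>res.syzygies. b q = (\<Sum>j\<in>J. lookup q j * c j)"
        by (intro exI[of _ "\<lambda>j. b' (single j 1)"]) blast
    qed
  qed
qed

lemma syzygies_lift:
  assumes "\<phi> \<in> module_homs res.syzygy_module triv"
  obtains \<psi> where "\<psi> \<in> module_homs res.syzygy_module regular_module"
    "\<And>q. q \<in> res.syzygies \<Longrightarrow> aug (\<psi> q) = \<phi> q"
  by (rule short.syzygies_lift[OF short_length left_module_trivial_module aug_module_hom _ assms])
    (use aug_surj that in auto)

section \<open>The grading of the syzygies and their generator\<close>

abbreviation smul :: "'a \<Rightarrow> (nat \<Rightarrow>\<^sub>0 'a) \<Rightarrow> (nat \<Rightarrow>\<^sub>0 'a)" where
  "smul a \<equiv> Poly_Mapping.map ((*) a)"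

lemma smul_zero: "smul 0 q = 0"
  by (rule poly_mapping_eqI) (simp only: lookup_map_mult mult_zero_left lookup_zero)

lemma syzygies_zero: "0 \<in> res.syzygies"
  by (simp add: mem_syzygies_iff)

lemma aug_lookup_syzygy: "q \<in> res.syzygies \<Longrightarrow> aug (lookup q j) = 0"
proof -
  assume q: "q \<in> res.syzygies"
  have "lookup q j = 0" if "j \<notin> J"
    using q that by (auto simp: mem_syzygies_iff in_keys_iff subset_iff)
  then show ?thesis
    using aug_syzygy[of "lookup q" j] q by (cases "j \<in> J") (auto simp: mem_syzygies_iff)
qed

text \<open>The grading of the free module for which the syzygies are a graded submodule: the basis element
  belonging to a relation has the degree of the relation.\<close>

definition part :: "nat \<Rightarrow> (nat \<Rightarrow>\<^sub>0 'a) \<Rightarrow> (nat \<Rightarrow>\<^sub>0 'a)" where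
  "part D q = tuple J (\<lambda>j. if dg j \<le> D then component (lookup q j) (D - dg j) else 0)"

lemma lookup_part:
  "lookup (part D q) j =
    (if j \<in> J \<and> dg j \<le> D then component (lookup q j) (D - dg j) else 0)"
  by (simp add: part_def lookup_tuple)

lemma part_mem: "q \<in> res.syzygies \<Longrightarrow> part D q \<in> res.syzygies"
proof -
  assume q: "q \<in> res.syzygies"
  have "(\<Sum>j\<in>J. lookup (part D q) j * M j i) = 0" if i: "i < n" for i
  proof (cases "D = 0")
    \<comment> \<open>All relations have degree at least 2, so nothing lives in degree 0.\<close>
    case True
    then have "lookup (part D q) j = 0" for j
      using dg(1)[of j] by (auto simp: lookup_part)
    then show ?thesis
      by simp
  next
    case False
    then have "(\<Sum>j\<in>J. lookup (part D q) j * M j i) =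
      component (\<Sum>j\<in>J. lookup q j * M j i) (D - 1)"
      by (subst component_combination) (auto simp: lookup_part intro!: sum.cong)
    then show ?thesis
      using q i by (simp add: mem_syzygies_iff)
  qed
  then show ?thesis
    by (auto simp: mem_syzygies_iff part_def dest: subsetD[OF keys_tuple, rotated])
qed

lemma part_add: "part D (q + q') = part D q + part D q'"
  by (rule poly_mapping_eqI) (simp add: lookup_part lookup_add component_add)

lemma part_part: "part D (part D' q) = (if D = D' then part D q else 0)"
proof (rule poly_mapping_eqI)
  fix j
  show "lookup (part D (part D' q)) j = lookup (if D = D' then part D q else 0) j"
    using component_mem by (auto simp: lookup_part component_homogeneous[OF component_mem])
qed

text \<open>The Cauchy product in each coordinate; the shift by \<open>dg j\<close> only decides
  which terms are cut off.\<close>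

lemma part_smul: "part D (smul a q) = (\<Sum>i\<le>D. smul (component a i) (part (D - i) q))"
proof (rule poly_mapping_eqI)
  fix j
  show "lookup (part D (smul a q)) j =
    lookup (\<Sum>i\<le>D. smul (component a i) (part (D - i) q)) j"
  proof (cases "j \<in> J \<and> dg j \<le> D")
    case True
    have "component (a * lookup q j) (D - dg j) =
      (\<Sum>i\<le>D - dg j. component a i * component (lookup q j) (D - dg j - i))"
      by (rule component_mult)
    also have "\<dots> = (\<Sum>i\<le>D. if dg j \<le> D - i then component a i * component (lookup q j) (D - i - dg j) else 0)"
      using True by (intro sum.mono_neutral_cong_left) (auto simp: diff_right_commute add.commute)
    finally show ?thesis
      using True by (auto simp: lookup_part lookup_sum if_distrib[of "\<lambda>y. _ * y"] cong: if_cong)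
  next
    case False
    then have "\<not> (j \<in> J \<and> dg j \<le> D - i)" for i
      by auto
    with False show ?thesis
      by (simp only: lookup_part lookup_sum lookup_map_mult if_False) simp
  qed
qed

lemma sum_part:
  assumes "q \<in> res.syzygies"
  obtains B where "q = (\<Sum>D<B. part D q)"
proof -
  define A where "A = (\<Union>j\<in>J. (\<lambda>m. m + dg j) ` {m. component (lookup q j) m \<noteq> 0})"
  have "finite A"
    unfolding A_def by (intro finite_UN_I finite_J finite_imageI finite_component)
  define B where "B = Suc (Max (insert 0 A))"
  have "q = (\<Sum>D<B. part D q)"
  proof (rule poly_mapping_eqI)
    fix j
    show "lookup q j = lookup (\<Sum>D<B. part D q) j"
    proof (cases "j \<in> J")
      case True
      let ?a = "lookup q j"
      let ?S = "{m. component ?a m \<noteq> 0}"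
      have less: "m + dg j < B" if "component ?a m \<noteq> 0" for m
      proof -
        have "m + dg j \<in> A"
          using True that by (auto simp: A_def)
        then show ?thesis
          unfolding B_def less_Suc_eq_le using \<open>finite A\<close> by (intro Max_ge) auto
      qed
      have "lookup (\<Sum>D<B. part D q) j =
        (\<Sum>D<B. if dg j \<le> D then component ?a (D - dg j) else 0)"
        using True by (simp add: lookup_sum lookup_part)
      also have "\<dots> = (\<Sum>D\<in>(\<lambda>m. m + dg j) ` ?S. component ?a (D - dg j))"
        using less by (intro sum.mono_neutral_cong_right) (auto simp: image_iff, metis le_add_diff_inverse2)
      also have "\<dots> = (\<Sum>m\<in>?S. component ?a m)"
        by (subst sum.reindex) auto
      finally show ?thesis
        using sum_component[of ?a] by simp
    next
      case False
      then show ?thesis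
        using assms by (auto simp: lookup_sum lookup_part mem_syzygies_iff in_keys_iff subset_iff)
    qed
  qed
  then show ?thesis
    by (rule that)
qed

text \<open>A homogeneous syzygy of minimal degree outside a submodule survives modulo the augmentation
  ideal and the submodule.\<close>

lemma separating_functional:
  assumes c: "c \<in> res.syzygies" "part D c = c" "c \<notin> U"
    and U: "0 \<in> U" "\<And>q q'. q \<in> U \<Longrightarrow> q' \<in> U \<Longrightarrow> q + q' \<in> U" "\<And>a q. q \<in> U \<Longrightarrow> smul a q \<in> U"
    and small: "\<And>D' q. D' < D \<Longrightarrow> q \<in> res.syzygies \<Longrightarrow> part D' q = q \<Longrightarrow> q \<in> U"
  obtains \<phi> where "\<phi> \<in> module_homs res.syzygy_module triv" "\<phi> c = 1"
    "\<And>D' u. u \<in> U \<Longrightarrow> part D' u = u \<Longrightarrow> \<phi> u = 0"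
proof -
  \<comment> \<open>The field acts through the multiples of the unit. The functional
    \<open>lf\<close> is linear over the field; composing it with the projection to degree
    \<open>D\<close> makes it linear over the algebra, acting by the augmentation.\<close>
  define s where "s k q = smul (scale k 1) q" for k q
  interpret V: vector_space s
    by unfold_locales
      (auto intro!: poly_mapping_eqI
        simp: s_def lookup_add scale_left_distrib scale_right_distrib distrib_right)
  have "V.subspace U"
    using U unfolding V.subspace_def s_def by blast
  from V.exists_functional[OF this c(3)] obtain lf where
    l: "Vector_Spaces.linear s (*) lf" "lf c = 1" "\<And>u. u \<in> U \<Longrightarrow> lf u = 0"
    by blast
  interpret l: Vector_Spaces.linear s "(*)" lf
    by (rule l(1))
  have hom: "(\<lambda>q. lf (part D q)) \<in> module_homs res.syzygy_module triv"
  proof (rule module_homsI)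
    fix q q' :: "nat \<Rightarrow>\<^sub>0 'a" and a assume q: "q \<in> carrier res.syzygy_module"
    show "lf (part D (q \<oplus>\<^bsub>res.syzygy_module\<^esub> q')) =
      lf (part D q) \<oplus>\<^bsub>triv\<^esub> lf (part D q')"
      by (simp add: part_add l.add)
    have "lf (smul (component a i) (part (D - i) q)) = (if i = 0 then aug a * lf (part D q) else 0)"
      if "i \<le> D" for i
    proof (cases "i = 0")
      case True
      have "smul (component a 0) (part D q) = s (aug a) (part D q)"
        by (simp add: s_def scale_aug)
      then show ?thesis
        using True by (simp add: l.scale)
    next
      case False
      \<comment> \<open>A coefficient of positive degree multiplies a syzygy of degree below
        \<open>D\<close>, and such syzygies lie in \<open>U\<close> by \<open>small\<close>.\<close>
      then have "part (D - i) q \<in> U"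
        using that q by (intro small[of "D - i"] part_mem) (auto simp: part_part)
      then show ?thesis
        using False U(3) l(3) by simp
    qed
    then show "lf (part D (a \<odot>\<^bsub>res.syzygy_module\<^esub> q)) = a \<odot>\<^bsub>triv\<^esub> lf (part D q)"
      by (simp add: part_smul l.sum)
  qed simp
  show ?thesis
  proof (rule that[OF hom])
    show "lf (part D c) = 1"
      using c(2) l(2) by simp
    \<comment> \<open>For homogeneous \<open>u\<close> the part of degree \<open>D\<close> is
      \<open>u\<close> or zero and so stays in \<open>U\<close>; for other elements of
      \<open>U\<close> it could leave \<open>U\<close>.\<close>
    fix D' u assume u: "u \<in> U" "part D' u = u"
    have "part D u = (if D = D' then u else 0)"
      using part_part[of D D' u] u(2) by auto
    then show "lf (part D u) = 0"
      using l(3) u(1) U(1) by auto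
  qed
qed

text \<open>Otherwise the dual complex collapses: by \<open>ext2\<close> unit columns are
  combinations of columns of \<open>M\<close>, whose entries have augmentation 0, so there are no
  relations; by \<open>ext1\<close> then \<open>1\<close> is a multiple of each \<open>x i\<close>,
  so there are no generators; and \<open>ext0\<close> gives \<open>1 = 0\<close>.\<close>

lemma syzygies_nontrivial: "res.syzygies \<noteq> {0}"
proof
  assume triv: "res.syzygies = {0}"
  have "J = {}"
  proof (rule ccontr)
    assume "J \<noteq> {}"
    then obtain j where j: "j \<in> J"
      by blast
    have "(\<Sum>k\<in>J. lookup q k * (if k = j then 1 else 0)) = 0" if "q \<in> res.syzygies" for q
      using that triv by simp
    then show False
    proof (rule ext2)
      fix c assume c: "\<And>k. k \<in> J \<Longrightarrow> (if k = j then 1 else 0) = (\<Sum>i<n. M k i * c i)"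
      have "aug 1 = aug (\<Sum>i<n. M j i * c i)"
        using arg_cong[OF c[OF j], of aug] by simp
      then show False
        using j by (simp add: aug_sum aug_mult aug_M)
    qed
  qed
  then obtain a where a: "\<And>i. i < n \<Longrightarrow> 1 = x i * a"
    using ext1[of "\<lambda>_. 1"] by auto
  have "n = 0"
  proof (rule ccontr)
    assume "n \<noteq> 0"
    then have "aug 1 = aug (x 0 * a)"
      using arg_cong[OF a[of 0], of aug] by blast
    then show False
      using \<open>n \<noteq> 0\<close> by (simp add: aug_mult aug_x)
  qed
  then have "x i * 1 = 0" if "i < n" for i
    using that by simp
  from ext0[OF this] have "(1::'a) = 0"
    by simp
  then show False
    by simp
qed

text \<open>Two independent generators of the syzygies would give two independent classes in
  $\mathrm{Ext}^3$.\<close>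

lemma syzygy_generator:
  obtains D v where "v \<in> res.syzygies" "part D v = v" "\<And>q. q \<in> res.syzygies \<Longrightarrow> \<exists>a. q = smul a v"
    "\<And>a. smul a v = 0 \<Longrightarrow> a = 0"
    "\<And>a. aug a = 0 \<Longrightarrow> \<exists>c. a = (\<Sum>j\<in>J. lookup v j * c j)"
proof -
  obtain \<Phi> :: "((nat \<Rightarrow>\<^sub>0 'a) \<Rightarrow> 'a) \<Rightarrow> 'k" where Phi:
    "\<And>b b'. b \<in> module_homs res.syzygy_module regular_module \<Longrightarrow>
      b' \<in> module_homs res.syzygy_module regular_module \<Longrightarrow> \<Phi> (\<lambda>q. b q + b' q) = \<Phi> b + \<Phi> b'"
    "\<And>b a. b \<in> module_homs res.syzygy_module regular_module \<Longrightarrow> \<Phi> (\<lambda>q. b q * a) = aug a * \<Phi> b"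
    "\<And>b. b \<in> module_homs res.syzygy_module regular_module \<Longrightarrow> \<Phi> b = 0 \<Longrightarrow>
      \<exists>c. \<forall>q\<in>res.syzygies. b q = (\<Sum>j\<in>J. lookup q j * c j)"
    by (rule ext3) blast
  \<comment> \<open>A homomorphism with zero class extends to the free module, and the coordinates
    of syzygies have augmentation 0, so its values on \<Omega> do too. Hence a lift of a nonzero
    functional has nonzero class.\<close>
  have Phi_aug: "aug (b q) = 0"
    if b: "b \<in> module_homs res.syzygy_module regular_module" "\<Phi> b = 0" and q: "q \<in> res.syzygies" for b q
  proof -
    obtain c where "b q = (\<Sum>j\<in>J. lookup q j * c j)"
      using Phi(3)[OF b] q by blast
    then show ?thesis
      using q by (simp add: aug_sum aug_mult aug_lookup_syzygy)
  qed
  obtain q0 where q0: "q0 \<in> res.syzygies" "q0 \<noteq> 0"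
    using syzygies_nontrivial syzygies_zero by blast
  obtain B where B: "q0 = (\<Sum>D<B. part D q0)"
    by (rule sum_part[OF q0(1)])
  have "\<exists>D. part D q0 \<noteq> 0"
  proof (rule ccontr)
    assume "\<nexists>D. part D q0 \<noteq> 0"
    with B q0(2) show False
      by simp
  qed
  then have ex: "\<exists>D v. v \<in> res.syzygies \<and> part D v = v \<and> v \<noteq> 0"
    using part_mem[OF q0(1)] part_part[of _ _ q0] by metis
  \<comment> \<open>In the lowest degree a nonzero \<open>v\<close> survives modulo the augmentation
    ideal: \<open>separating_functional\<close> applies to it with the zero submodule.\<close>
  define D where "D = (LEAST D. \<exists>v. v \<in> res.syzygies \<and> part D v = v \<and> v \<noteq> 0)"
  obtain v where v: "v \<in> res.syzygies" "part D v = v" "v \<noteq> 0"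
    using LeastI_ex[OF ex] unfolding D_def by blast
  have D_min: "q = 0" if "D' < D" "q \<in> res.syzygies" "part D' q = q" for D' q
    using not_less_Least[of D' "\<lambda>D. \<exists>v. v \<in> res.syzygies \<and> part D v = v \<and> v \<noteq> 0"] that
    unfolding D_def by blast
  obtain \<phi>1 where phi1: "\<phi>1 \<in> module_homs res.syzygy_module triv" "\<phi>1 v = 1"
    by (rule separating_functional[OF v(1,2), of "{0}"]) (use v(3) D_min in auto)
  obtain \<psi>1 where psi1: "\<psi>1 \<in> module_homs res.syzygy_module regular_module"
    "\<And>q. q \<in> res.syzygies \<Longrightarrow> aug (\<psi>1 q) = \<phi>1 q"
    by (rule syzygies_lift[OF phi1(1)]) blast
  have Phi1: "\<Phi> \<psi>1 \<noteq> 0"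
    using Phi_aug[OF psi1(1) _ v(1)] psi1(2)[OF v(1)] phi1(2) by auto
  let ?U = "range (\<lambda>a. smul a v)"
  have smul_add: "smul a v + smul b v = smul (a + b) v" for a b
    by (rule poly_mapping_eqI) (simp add: lookup_add distrib_right)
  have smul_smul: "smul a (smul b q) = smul (a * b) q" for a b q
    by (rule poly_mapping_eqI) (simp add: mult.assoc)
  \<comment> \<open>Graded Nakayama: induction on the degree provides \<open>small\<close> for the
    submodule generated by \<open>v\<close>, and an element \<open>c\<close> outside it yields a
    functional \<open>\<phi>2\<close> with value 1 at \<open>c\<close> and 0 at
    \<open>v\<close>.\<close>
  have hom_gen: "c \<in> ?U" if "c \<in> res.syzygies" "part D' c = c" for D' c
    using that
  proof (induction D' arbitrary: c rule: less_induct)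
    case (less D')
    show ?case
    proof (rule ccontr)
      assume nmem: "c \<notin> ?U"
      obtain \<phi>2 where phi2: "\<phi>2 \<in> module_homs res.syzygy_module triv" "\<phi>2 c = 1"
        "\<And>D'' u. u \<in> ?U \<Longrightarrow> part D'' u = u \<Longrightarrow> \<phi>2 u = 0"
      proof (rule separating_functional[OF less.prems nmem])
        show "0 \<in> ?U"
          by (rule range_eqI[of _ _ 0]) (simp only: smul_zero lessThan_0 sum.empty)
        show "q + q' \<in> ?U" if "q \<in> ?U" "q' \<in> ?U" for q q'
          using that smul_add by auto
        show "smul a q \<in> ?U" if "q \<in> ?U" for a q
          using that smul_smul by auto
      qed (use less.IH in blast)+
      obtain \<psi>2 where psi2: "\<psi>2 \<in> module_homs res.syzygy_module regular_module"
        "\<And>q. q \<in> res.syzygies \<Longrightarrow> aug (\<psi>2 q) = \<phi>2 q"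
        by (rule syzygies_lift[OF phi2(1)]) blast
      have "v \<in> ?U"
        by (rule range_eqI[of _ _ 1]) (auto intro: poly_mapping_eqI)
      then have phi2v: "\<phi>2 v = 0"
        using phi2(3) v(2) by blast
      \<comment> \<open>The scalars make the two classes cancel in the one-dimensional Ext^3, so the
        combination has augmentation 0 on \<Omega>. Evaluation at \<open>v\<close> gives
        \<open>\<Phi> \<psi>2 = 0\<close>, and evaluation at \<open>c\<close> then
        \<open>\<Phi> \<psi>1 = 0\<close>.\<close>
      let ?b1 = "\<lambda>q. \<psi>1 q * scale (\<Phi> \<psi>2) 1" and ?b2 = "\<lambda>q. \<psi>2 q * scale (- \<Phi> \<psi>1) 1"
      have homs: "?b1 \<in> module_homs res.syzygy_module regular_module"
        "?b2 \<in> module_homs res.syzygy_module regular_module"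
        "(\<lambda>q. ?b1 q + ?b2 q) \<in> module_homs res.syzygy_module regular_module"
        by (intro module_homs_add_regular module_homs_mult_regular psi1(1) psi2(1))+
      have "\<Phi> (\<lambda>q. ?b1 q + ?b2 q) = \<Phi> ?b1 + \<Phi> ?b2"
        by (rule Phi(1)[OF homs(1,2)])
      also have "\<dots> = aug (scale (\<Phi> \<psi>2) 1) * \<Phi> \<psi>1 + aug (scale (- \<Phi> \<psi>1) 1) * \<Phi> \<psi>2"
        by (simp only: Phi(2)[OF psi1(1)] Phi(2)[OF psi2(1)])
      also have "\<dots> = 0"
        by (simp add: aug_scale del: scale_minus_left)
      finally have aug_b: "aug (?b1 q + ?b2 q) = 0" if "q \<in> res.syzygies" for q
        using Phi_aug[OF homs(3)] that by blast
      have rel: "\<phi>1 q * \<Phi> \<psi>2 = \<phi>2 q * \<Phi> \<psi>1" if "q \<in> res.syzygies" for q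
        using aug_b[OF that] psi1(2)[OF that] psi2(2)[OF that]
        by (simp add: aug_add aug_scale mult.commute del: scale_minus_left)
      have "\<Phi> \<psi>2 = 0"
        using rel[OF v(1)] phi1(2) phi2v by simp
      then have "\<Phi> \<psi>1 = 0"
        using rel[OF less.prems(1)] phi2(2) by simp
      with Phi1 show False
        by contradiction
    qed
  qed
  have gen: "\<exists>a. q = smul a v" if q: "q \<in> res.syzygies" for q
  proof -
    obtain B where B: "q = (\<Sum>D<B. part D q)"
      by (rule sum_part[OF q])
    have "(\<Sum>D<B'. part D q) \<in> ?U" for B'
    proof (induction B')
      case 0
      show ?case
        by (rule range_eqI[of _ _ 0]) (simp only: smul_zero lessThan_0 sum.empty)
    next
      case (Suc B')
      have "part B' q \<in> ?U"
        by (rule hom_gen[of _ B'], rule part_mem[OF q]) (simp add: part_part)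
      with Suc show ?case
        using smul_add by auto
    qed
    then show ?thesis
      using B by (metis (no_types, lifting) rangeE)
  qed
  \<comment> \<open>\<open>\<psi>1\<close> sends \<open>v\<close> to an element of augmentation 1,
    and right multiplication by such an element is injective.\<close>
  have free: "a = 0" if "smul a v = 0" for a
  proof (rule mult_eq_0_if_aug_1)
    have "\<psi>1 0 = 0"
      using module_homsD(3)[OF psi1(1), of 0 0] syzygies_zero by simp
    then show "a * \<psi>1 v = 0"
      using module_homsD(3)[OF psi1(1), of v a] v(1) that by simp
    show "aug (\<psi>1 v) = 1"
      using psi1(2)[OF v(1)] phi1(2) by simp
  qed
  have inj: "a = b" if "smul a v = smul b v" for a b
  proof -
    have "smul (a - b) v = smul a v - smul b v"
      by (rule poly_mapping_eqI) (simp add: lookup_minus left_diff_distrib)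
    then show ?thesis
      using free[of "a - b"] that by simp
  qed
  \<comment> \<open>The coordinate with respect to \<open>v\<close>. If \<open>aug a = 0\<close>,
    then \<open>\<theta>\<close> times \<open>a\<close> has zero class, since A acts on Ext^3
    through the augmentation; its extension to the free module, evaluated at \<open>v\<close>,
    expresses \<open>a\<close> by the entries of \<open>v\<close>.\<close>
  define \<theta> where "\<theta> q = (THE a. q = smul a v)" for q
  have theta [simp]: "\<theta> (smul a v) = a" for a
    unfolding \<theta>_def by (rule the_equality) (auto intro: inj)
  have theta_hom: "\<theta> \<in> module_homs res.syzygy_module regular_module"
  proof (rule module_homsI)
    fix q q' a assume "q \<in> carrier res.syzygy_module"
    then obtain b where b: "q = smul b v"
      using gen by auto
    show "\<theta> (a \<odot>\<^bsub>res.syzygy_module\<^esub> q) = a \<odot>\<^bsub>regular_module\<^esub> \<theta> q"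
      by (simp add: b smul_smul)
    assume "q' \<in> carrier res.syzygy_module"
    then obtain b' where b': "q' = smul b' v"
      using gen by auto
    show "\<theta> (q \<oplus>\<^bsub>res.syzygy_module\<^esub> q') = \<theta> q \<oplus>\<^bsub>regular_module\<^esub> \<theta> q'"
      by (simp add: b b' smul_add)
  qed simp
  have "\<exists>c. a = (\<Sum>j\<in>J. lookup v j * c j)" if a: "aug a = 0" for a
  proof -
    have "(\<lambda>q. \<theta> q * a) \<in> module_homs res.syzygy_module regular_module"
      by (rule module_homs_mult_regular[OF theta_hom])
    moreover have "\<Phi> (\<lambda>q. \<theta> q * a) = 0"
      using Phi(2)[OF theta_hom, of a] a by simp
    ultimately obtain c where "\<forall>q\<in>res.syzygies. \<theta> q * a = (\<Sum>j\<in>J. lookup q j * c j)"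
      using Phi(3) by blast
    moreover have "smul 1 v = v"
      by (rule poly_mapping_eqI) simp
    then have "\<theta> v = 1"
      using theta[of 1] by simp
    ultimately show ?thesis
      using v(1) by (metis mult_1)
  qed
  with v(1,2) gen free show ?thesis
    by (rule that)
qed

end

section \<open>Passage to as many relations as generators\<close>

context minimal_graded_presentation
begin

text \<open>A scalar relation between the \<open>x i\<close> is a combination of rows of
  \<open>M\<close>, whose entries have augmentation 0 because the relations have degree at least
  2.\<close>

lemma x_independent:
  assumes "(\<Sum>i<n. scale (k i) (x i)) = 0" "i < n"
  shows "k i = 0"
proof -
  have "(\<Sum>i<n. scale (k i) 1 * x i) = 0"
    using assms(1) by simp
  then obtain c where "\<And>i. i < n \<Longrightarrow> scale (k i) 1 = (\<Sum>j\<in>J. c j * M j i)"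
    by (rule M_generate) blast
  from arg_cong[OF this[OF assms(2)], of aug] show ?thesis
    by (simp add: aug_scale aug_sum aug_mult aug_M)
qed

lemma gr_1_expansion:
  assumes "a \<in> gr 1"
  obtains k where "a = (\<Sum>i<n. scale (k i) (x i))"
proof -
  obtain q where q: "a = scale (aug a) 1 + (\<Sum>i<n. q i * x i)"
    by (rule right_expansion)
  have "a = component a 1"
    using assms by (simp add: component_homogeneous)
  also have "\<dots> = (\<Sum>i<n. component (q i * x i) 1)"
    by (subst q) (simp add: component_add component_sum component_homogeneous[OF scale_one_mem_gr_0])
  also have "\<dots> = (\<Sum>i<n. scale (aug (q i)) (x i))"
    by (rule sum.cong) (auto simp: component_mult_right[OF x_mem] simp flip: scale_aug)
  finally show ?thesis
    by (rule that)
qed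

end

text \<open>What remains of the homological hypotheses: a resolution 0 \<rightarrow> A \<rightarrow>
  A^n \<rightarrow> A^n \<rightarrow> A \<rightarrow> K whose maps from and to A are given by the
  \<open>x i\<close> and whose middle matrix holds the derivatives of the \<open>s i\<close>.
  \<open>exact1\<close> to \<open>exact3\<close> are exactness from right to left,
  \<open>x_s\<close> says that the first two maps compose to zero, and \<open>dual_exact1\<close>
  keeps duality for scalar columns.\<close>

locale symmetric_presentation = graded_presentation scale gr n x R
  for scale :: "'k::field \<Rightarrow> 'a::ring_1 \<Rightarrow> 'a" and gr n x R +
  fixes N :: nat and s :: "nat \<Rightarrow> nat nc_word \<Rightarrow>\<^sub>0 'k"
  assumes N: "2 \<le> N"
    and x_independent: "\<And>k i. (\<Sum>i<n. scale (k i) (x i)) = 0 \<Longrightarrow> i < n \<Longrightarrow> k i = 0"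
    and gr_1_expansion: "\<And>a. a \<in> gr 1 \<Longrightarrow> \<exists>k. a = (\<Sum>i<n. scale (k i) (x i))"
    and s_mem: "\<And>i. i < n \<Longrightarrow> s i \<in> carrier (free_algebra n)"
    and s_homogeneous: "\<And>i. i < n \<Longrightarrow> homogeneous N (s i)"
    and ev_s: "\<And>i. i < n \<Longrightarrow> ev (s i) = 0"
    and exact1: "\<And>q. (\<Sum>i<n. q i * x i) = 0 \<Longrightarrow> \<exists>c. \<forall>l<n. q l = (\<Sum>i<n. c i * ev (strip l (s i)))"
    and exact2: "\<And>c. (\<And>l. l < n \<Longrightarrow> (\<Sum>i<n. c i * ev (strip l (s i))) = 0) \<Longrightarrow> \<exists>a. \<forall>i<n. c i = a * x i"
    and exact3: "\<And>a. (\<And>i. i < n \<Longrightarrow> a * x i = 0) \<Longrightarrow> a = 0"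
    and x_s: "\<And>l. l < n \<Longrightarrow> (\<Sum>i<n. x i * ev (strip l (s i))) = 0"
    and dual_exact1: "\<And>k l. (\<And>i. i < n \<Longrightarrow> (\<Sum>l<n. scale (k l) (ev (strip l (s i)))) = 0) \<Longrightarrow> l < n \<Longrightarrow> k l = 0"

context gorenstein_presentation
begin

text \<open>Exactness of the dual complex makes the entries of the generator of the syzygies a minimal set
  of generators of the augmentation ideal as a right ideal, hence a basis of the degree-1 part.\<close>

lemma symmetric_presentation_exists:
  obtains N s where "symmetric_presentation scale gr n x R N s"
proof -
  obtain D v where v: "v \<in> res.syzygies" "part D v = v"
    and gen: "\<And>q. q \<in> res.syzygies \<Longrightarrow> \<exists>a. q = smul a v"
    and free: "\<And>a. smul a v = 0 \<Longrightarrow> a = 0"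
    and aug_ideal: "\<And>a. aug a = 0 \<Longrightarrow> \<exists>c. a = (\<Sum>j\<in>J. lookup v j * c j)"
    by (rule syzygy_generator) blast
  let ?v = "lookup v"
  have v_mem: "?v j \<in> gr (D - dg j)" and v_zero: "\<not> dg j \<le> D \<Longrightarrow> ?v j = 0" if "j \<in> J" for j
  proof -
    have "?v j = (if j \<in> J \<and> dg j \<le> D then component (?v j) (D - dg j) else 0)"
      by (subst lookup_part[symmetric]) (simp add: v(2))
    then show "?v j \<in> gr (D - dg j)" "\<not> dg j \<le> D \<Longrightarrow> ?v j = 0"
      using component_mem[of "?v j" "D - dg j"] by (auto split: if_splits)
  qed
  have aug_v: "aug (?v j) = 0" for j
    by (rule aug_lookup_syzygy[OF v(1)])
  \<comment> \<open>Every syzygy is a left multiple of \<open>v\<close>, so a column killed by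
    \<open>v\<close> is killed by all of \<Omega>, and \<open>ext2\<close> writes it by columns of
    \<open>M\<close>.\<close>
  have independent: "aug (c j) = 0" if "(\<Sum>j\<in>J. ?v j * c j) = 0" "j \<in> J" for c j
  proof -
    have "(\<Sum>j\<in>J. lookup q j * c j) = 0" if "q \<in> res.syzygies" for q
    proof -
      obtain a where "q = smul a v"
        using gen \<open>q \<in> res.syzygies\<close> by blast
      then have "(\<Sum>j\<in>J. lookup q j * c j) = a * (\<Sum>j\<in>J. ?v j * c j)"
        by (simp add: sum_distrib_left mult.assoc)
      then show ?thesis
        using \<open>(\<Sum>j\<in>J. ?v j * c j) = 0\<close> by simp
    qed
    then show ?thesis
    proof (rule ext2)
      fix c' assume "\<And>j. j \<in> J \<Longrightarrow> c j = (\<Sum>i<n. M j i * c' i)"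
      then show ?thesis
        using that(2) by (simp add: aug_sum aug_mult aug_M)
    qed
  qed
  \<comment> \<open>The indices at which the entry of \<open>v\<close> has degree 1; no others
    contribute to the degree-1 component of a combination of the entries.\<close>
  define J1 where "J1 = {j \<in> J. dg j + 1 = D}"
  have "\<exists>k. x i = (\<Sum>j\<in>J1. scale (k j) (?v j))" if i: "i < n" for i
  proof -
    obtain c where c: "x i = (\<Sum>j\<in>J. ?v j * c j)"
      using aug_ideal[OF aug_x[OF i]] by blast
    have "component (?v j * c j) 1 = (if j \<in> J1 then scale (aug (c j)) (?v j) else 0)" if j: "j \<in> J" for j
    proof (cases "dg j \<le> D")
      case True
      consider "D - dg j = 0" | "D - dg j = 1" | "D - dg j \<ge> 2"
        by linarith
      then show ?thesis
      proof cases
        \<comment> \<open>An entry of degree 0 is a scalar, and it has augmentation 0.\<close>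
        case 1
        then have "?v j = 0"
          using v_mem[OF j] aug_v[of j] mem_gr_0[of "?v j"] by simp
        then show ?thesis
          by simp
      next
        case 2
        then have "?v j \<in> gr 1" "j \<in> J1"
          using v_mem[OF j] j by (auto simp: J1_def)
        then show ?thesis
          by (simp add: component_mult_left flip: scale_aug)
      next
        case 3
        then show ?thesis
          using component_mult_left[OF v_mem[OF j], of "c j" 1] by (auto simp: J1_def)
      qed
    next
      case False
      then show ?thesis
        using v_zero[OF j] by simp
    qed
    moreover have "x i = component (x i) 1"
      using x_mem[OF i] by (simp add: component_homogeneous)
    ultimately have "x i = (\<Sum>j\<in>J. if j \<in> J1 then scale (aug (c j)) (?v j) else 0)"
      by (subst (asm) c) (simp add: component_sum)
    also have "\<dots> = (\<Sum>j\<in>J \<inter> J1. scale (aug (c j)) (?v j))"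
      by (simp add: sum.inter_restrict)
    also have "J \<inter> J1 = J1"
      by (auto simp: J1_def)
    finally show ?thesis
      by (intro exI)
  qed
  then obtain k where k: "\<And>i. i < n \<Longrightarrow> x i = (\<Sum>j\<in>J1. scale (k i j) (?v j))"
    by metis
  \<comment> \<open>The entries with index in \<open>J1\<close> generate the \<open>x i\<close> and
    so the augmentation ideal. Any other entry would give a relation between the entries with
    coefficient 1, against \<open>independent\<close>.\<close>
  have J1: "J1 = J"
  proof (rule ccontr)
    assume "J1 \<noteq> J"
    then obtain j0 where j0: "j0 \<in> J" "j0 \<notin> J1"
      by (auto simp: J1_def)
    obtain q where "?v j0 = scale (aug (?v j0)) 1 + (\<Sum>i<n. x i * q i)"
      by (rule left_expansion)
    then have "?v j0 = (\<Sum>i<n. x i * q i)"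
      by (simp add: aug_v)
    also have "\<dots> = (\<Sum>i<n. \<Sum>j\<in>J1. ?v j * scale (k i j) (q i))"
      by (rule sum.cong) (simp_all add: k sum_distrib_right flip: scale_mult_left scale_mult_right)
    also have "\<dots> = (\<Sum>j\<in>J1. ?v j * (\<Sum>i<n. scale (k i j) (q i)))"
      by (simp add: sum_distrib_left sum.swap[of _ J1])
    also have "\<dots> = (\<Sum>j\<in>J. ?v j * (if j \<in> J1 then \<Sum>i<n. scale (k i j) (q i) else 0))"
      by (rule sum.mono_neutral_cong_left) (auto simp: J1_def)
    finally have eq: "?v j0 = (\<Sum>j\<in>J. ?v j * (if j \<in> J1 then \<Sum>i<n. scale (k i j) (q i) else 0))" .
    let ?c = "\<lambda>j. (if j = j0 then 1 else 0) - (if j \<in> J1 then \<Sum>i<n. scale (k i j) (q i) else 0)"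
    have "(\<Sum>j\<in>J. ?v j * (if j = j0 then 1 else 0)) = ?v j0"
      using j0(1) by (simp add: if_distrib[of "\<lambda>y. _ * y"] cong: if_cong)
    then have "(\<Sum>j\<in>J. ?v j * ?c j) = 0"
      using eq by (simp only: right_diff_distrib sum_subtractf) simp
    then have "aug (?c j0) = 0"
      using j0(1) by (rule independent)
    then show False
      using j0(2) by simp
  qed
  define N where "N = D - 1"
  have dg_N: "dg j = N" "D = N + 1" if "j \<in> J" for j
    using that J1 by (auto simp: J1_def N_def)
  have v_gr1: "?v j \<in> gr 1" if "j \<in> J" for j
    using v_mem[OF that] dg_N[OF that] by simp
  have "J \<noteq> {}"
  proof
    have "keys v \<subseteq> J"
      using v(1) unfolding mem_syzygies_iff by blast
    moreover assume "J = {}"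
    ultimately have "v = 0"
      by simp
    then have "smul 1 v = 0"
      by simp
    then have "(1::'a) = 0"
      by (rule free)
    then show False
      by simp
  qed
  then have N: "2 \<le> N"
    using dg(1) dg_N by (metis ex_in_conv)
  have "\<forall>j\<in>J. \<exists>p. ?v j = (\<Sum>i<n. scale (p i) (x i))"
    using gr_1_expansion[OF v_gr1] by metis
  from bchoice[OF this] obtain p' where p': "\<forall>j\<in>J. ?v j = (\<Sum>i<n. scale (p' j i) (x i))" ..
  define p where "p i j = p' j i" for i j
  have p: "?v j = (\<Sum>i<n. scale (p i j) (x i))" if "j \<in> J" for j
    using p' that unfolding p_def by blast
  \<comment> \<open>\<open>k\<close> and \<open>p\<close> are the base changes between the
    \<open>x i\<close> and the entries of \<open>v\<close>; independence on either side makes them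
    inverse to each other.\<close>
  have kp: "(\<Sum>j\<in>J. k i j * p i' j) = (if i = i' then 1 else 0)" if i: "i < n" "i' < n" for i i'
  proof -
    have "x i = (\<Sum>j\<in>J. scale (k i j) (\<Sum>i'<n. scale (p i' j) (x i')))"
      using k[OF i(1)] p by (simp add: J1)
    also have "\<dots> = (\<Sum>i'<n. scale (\<Sum>j\<in>J. k i j * p i' j) (x i'))"
      by (simp add: scale_sum_right scale_sum_left sum.swap[of _ J])
    finally have "(\<Sum>i'<n. scale ((\<Sum>j\<in>J. k i j * p i' j) - (if i = i' then 1 else 0)) (x i')) = 0"
      using i by (simp add: scale_left_diff_distrib sum_subtractf if_distrib[of "\<lambda>c. scale c _"] cong: if_cong)
    from x_independent[OF this i(2)] show ?thesis
      by simp
  qed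
  have pk: "(\<Sum>i<n. p i j * k i j') = (if j = j' then 1 else 0)" if j: "j \<in> J" "j' \<in> J" for j j'
  proof -
    have "?v j = (\<Sum>i<n. scale (p i j) (\<Sum>j'\<in>J. scale (k i j') (?v j')))"
      using p[OF j(1)] k by (simp add: J1)
    also have "\<dots> = (\<Sum>j'\<in>J. scale (\<Sum>i<n. p i j * k i j') (?v j'))"
      by (simp add: scale_sum_right scale_sum_left sum.swap[of _ _ J])
    finally have "(\<Sum>j'\<in>J. scale ((\<Sum>i<n. p i j * k i j') - (if j = j' then 1 else 0)) (?v j')) = 0"
      using j by (simp add: scale_left_diff_distrib sum_subtractf if_distrib[of "\<lambda>c. scale c _"] cong: if_cong)
    then have "(\<Sum>j'\<in>J. ?v j' * scale ((\<Sum>i<n. p i j * k i j') - (if j = j' then 1 else 0)) 1) = 0"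
      by simp
    from independent[OF this j(2)] show ?thesis
      by (simp add: aug_scale)
  qed
  \<comment> \<open>The relations are recombined by \<open>p\<close> so that the syzygy with entries
    \<open>v\<close> turns into one with entries \<open>x i\<close>.\<close>
  define s where "s i = (\<Sum>j\<in>J. single 0 (p i j) * r j)" for i
  have strip_const: "strip l (single 0 c * q) = single 0 c * strip l q" for c l and q :: "nat nc_word \<Rightarrow>\<^sub>0 'k"
    by (simp add: strip_mult)
  have M_s: "ev (strip l (s i)) = (\<Sum>j\<in>J. scale (p i j) (M j l))" for i l
    by (simp add: s_def strip_sum strip_const free_eval_sum free_eval_mult M_def)
  have s_M: "M j l = (\<Sum>i<n. scale (k i j) (ev (strip l (s i))))" if j: "j \<in> J" for j l
  proof -
    have "(\<Sum>i<n. scale (k i j) (ev (strip l (s i)))) = (\<Sum>j'\<in>J. scale (\<Sum>i<n. p i j' * k i j) (M j' l))"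
      by (simp add: M_s scale_sum_right scale_sum_left sum.swap[of _ _ J] mult.commute)
    also have "\<dots> = (\<Sum>j'\<in>J. if j' = j then M j l else 0)"
      using j by (intro sum.cong) (auto simp: pk)
    finally show ?thesis
      using j by simp
  qed
  have "symmetric_presentation scale gr n x R N s"
  proof (unfold_locales)
    show "2 \<le> N"
      by (rule N)
    show "k' i = 0" if "(\<Sum>i<n. scale (k' i) (x i)) = 0" "i < n" for k' i
      using that by (rule x_independent)
    show "\<exists>k. a = (\<Sum>i<n. scale (k i) (x i))" if "a \<in> gr 1" for a
      using gr_1_expansion[OF that] by metis
    fix i assume "i < n"
    show "s i \<in> F"
      unfolding s_def by (intro free_algebra_sum free_algebra_mult r_mem) auto
    show "homogeneous N (s i)"
      unfolding s_def
    proof (rule homogeneous_sum)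
      fix j assume j: "j \<in> J"
      have "homogeneous (0 + N) (single 0 (p i j) * r j)"
        using dg(2)[OF j] dg_N[OF j] by (intro homogeneous_mult homogeneous_single) auto
      then show "homogeneous N (single 0 (p i j) * r j)"
        by simp
    qed
    show "ev (s i) = 0"
      by (simp add: s_def free_eval_sum free_eval_mult ev_r)
  next
    fix q assume "(\<Sum>i<n. q i * x i) = 0"
    then obtain c where c: "\<And>l. l < n \<Longrightarrow> q l = (\<Sum>j\<in>J. c j * M j l)"
      by (rule M_generate) blast
    have "q l = (\<Sum>i<n. (\<Sum>j\<in>J. scale (k i j) (c j)) * ev (strip l (s i)))" if "l < n" for l
    proof -
      have "q l = (\<Sum>j\<in>J. \<Sum>i<n. scale (k i j) (c j) * ev (strip l (s i)))"
        using c[OF that] by (simp add: s_M sum_distrib_left flip: scale_mult_left scale_mult_right)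
      then show ?thesis
        by (simp add: sum_distrib_right sum.swap[of _ J])
    qed
    then show "\<exists>c. \<forall>l<n. q l = (\<Sum>i<n. c i * ev (strip l (s i)))"
      by (intro exI[of _ "\<lambda>i. \<Sum>j\<in>J. scale (k i j) (c j)"]) blast
  next
    fix c assume c: "(\<Sum>i<n. c i * ev (strip l (s i))) = 0" if "l < n" for l
    \<comment> \<open>A syzygy of the new relations is rewritten for the old ones, where it is a
      multiple of \<open>v\<close>, and transformed back by \<open>k\<close>.\<close>
    let ?q = "tuple J (\<lambda>j. \<Sum>i<n. scale (p i j) (c i))"
    have "(\<Sum>j\<in>J. (\<Sum>i<n. scale (p i j) (c i)) * M j l) = 0" if "l < n" for l
    proof -
      have "(\<Sum>j\<in>J. (\<Sum>i<n. scale (p i j) (c i)) * M j l) = (\<Sum>i<n. c i * ev (strip l (s i)))"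
        by (simp add: M_s sum_distrib_left sum_distrib_right sum.swap[of _ J] flip: scale_mult_left scale_mult_right)
      then show ?thesis
        using c[OF that] by simp
    qed
    then have "?q \<in> res.syzygies"
      using keys_tuple[OF finite_J] by (simp add: mem_syzygies_iff lookup_tuple)
    then obtain a where a: "?q = smul a v"
      using gen by blast
    have eq: "(\<Sum>i<n. scale (p i j) (c i)) = a * ?v j" if "j \<in> J" for j
      using arg_cong[OF a, of "\<lambda>q. lookup q j"] that by (simp add: lookup_tuple)
    have "c i = a * x i" if i: "i < n" for i
    proof -
      have "(\<Sum>j\<in>J. scale (k i j) (\<Sum>i'<n. scale (p i' j) (c i'))) = a * x i"
        using k[OF i] by (simp add: eq J1 sum_distrib_left scale_mult_right)
      moreover have "(\<Sum>j\<in>J. scale (k i j) (\<Sum>i'<n. scale (p i' j) (c i'))) =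
        (\<Sum>i'<n. scale (\<Sum>j\<in>J. k i j * p i' j) (c i'))"
        by (simp add: scale_sum_right scale_sum_left sum.swap[of _ J])
      moreover have "\<dots> = (\<Sum>i'<n. if i' = i then c i else 0)"
        using i by (intro sum.cong) (auto simp: kp)
      ultimately show ?thesis
        using i by simp
    qed
    then show "\<exists>a. \<forall>i<n. c i = a * x i"
      by blast
  next
    fix a assume a: "a * x i = 0" if "i < n" for i
    have "a * ?v j = 0" if "j \<in> J" for j
      using a by (simp add: p[OF that] sum_distrib_left flip: scale_mult_right)
    moreover have "?v j = 0" if "j \<notin> J" for j
      using v(1) that by (auto simp: mem_syzygies_iff in_keys_iff subset_iff)
    ultimately have "smul a v = 0"
      by (intro poly_mapping_eqI) (metis lookup_map_mult lookup_zero mult_zero_right)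
    then show "a = 0"
      by (rule free)
  next
    fix l assume l: "l < n"
    have "(\<Sum>i<n. x i * ev (strip l (s i))) = (\<Sum>j\<in>J. (\<Sum>i<n. scale (p i j) (x i)) * M j l)"
      by (simp add: M_s sum_distrib_left sum_distrib_right sum.swap[of _ J] flip: scale_mult_left scale_mult_right)
    also have "\<dots> = (\<Sum>j\<in>J. ?v j * M j l)"
      by (simp add: p)
    finally show "(\<Sum>i<n. x i * ev (strip l (s i))) = 0"
      using v(1) l by (simp add: mem_syzygies_iff)
  next
    fix c l assume c: "(\<Sum>l<n. scale (c l) (ev (strip l (s i)))) = 0" if "i < n" for i
    assume l: "l < n"
    \<comment> \<open>By \<open>ext1\<close> a scalar column killed by the matrix is a right
      multiple of the column \<open>x\<close>, so its augmentation is zero.\<close>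
    have "(\<Sum>l<n. M j l * scale (c l) 1) = 0" if j: "j \<in> J" for j
    proof -
      have "(\<Sum>l<n. M j l * scale (c l) 1) = (\<Sum>i<n. scale (k i j) (\<Sum>l<n. scale (c l) (ev (strip l (s i)))))"
        unfolding scale_sum_right by (subst sum.swap) (simp add: s_M[OF j] scale_sum_right mult.commute)
      then show ?thesis
        by (simp add: c)
    qed
    then show "c l = 0"
    proof (rule ext1)
      fix a assume "\<And>i. i < n \<Longrightarrow> scale (c i) 1 = x i * a"
      from arg_cong[OF this[OF l], of aug] show "c l = 0"
        using l by (simp add: aug_scale aug_mult aug_x)
    qed
  qed
  then show ?thesis
    by (rule that)
qed

end

section \<open>Multilinear forms from tensors of coefficients\<close>

text \<open>Contraction of the tensor \<open>W\<close> with the vectors, slot by slot from the left,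
  so that properties of the form follow by induction on the list.\<close>

fun tensor_form :: "nat \<Rightarrow> (nat list \<Rightarrow> 'k::field) \<Rightarrow> 'k vec list \<Rightarrow> 'k" where
  "tensor_form n W [] = W []"
| "tensor_form n W (v # vs) = (\<Sum>i<n. v $ i * tensor_form n (\<lambda>u. W (i # u)) vs)"

lemma tensor_form_cong:
  assumes "\<And>u. length u = length vs \<Longrightarrow> set u \<subseteq> {..<n} \<Longrightarrow> W u = W' u"
  shows "tensor_form n W vs = tensor_form n W' vs"
  using assms
proof (induction vs arbitrary: W W')
  case (Cons v vs)
  have "tensor_form n (\<lambda>u. W (i # u)) vs = tensor_form n (\<lambda>u. W' (i # u)) vs" if "i < n" for i
    using Cons.prems that by (intro Cons.IH) auto
  then show ?case
    by simp
qed simp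

lemma tensor_form_sum:
  "tensor_form n (\<lambda>u. \<Sum>j\<in>S. c j * W j u) vs = (\<Sum>j\<in>S. c j * tensor_form n (W j) vs)"
proof (induction vs arbitrary: W)
  case (Cons v vs)
  have "tensor_form n (\<lambda>u. \<Sum>j\<in>S. c j * W j u) (v # vs) =
    (\<Sum>i<n. \<Sum>j\<in>S. v $ i * (c j * tensor_form n (\<lambda>u. W j (i # u)) vs))"
    by (simp add: Cons.IH sum_distrib_left)
  also have "\<dots> = (\<Sum>j\<in>S. c j * tensor_form n (W j) (v # vs))"
    by (subst sum.swap) (simp add: sum_distrib_left mult.left_commute)
  finally show ?case .
qed simp

text \<open>The recursion opens the first slot, while cyclicity concerns the last one.\<close>

lemma tensor_form_snoc:
  "tensor_form n W (vs @ [v]) = (\<Sum>k<n. v $ k * tensor_form n (\<lambda>u. W (u @ [k])) vs)"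
proof (induction vs arbitrary: W)
  case (Cons v' vs)
  have "tensor_form n W ((v' # vs) @ [v]) =
    (\<Sum>i<n. \<Sum>k<n. v' $ i * (v $ k * tensor_form n (\<lambda>u. W (i # u @ [k])) vs))"
    by (simp add: Cons.IH sum_distrib_left)
  also have "\<dots> = (\<Sum>k<n. v $ k * tensor_form n (\<lambda>u. W (u @ [k])) (v' # vs))"
    by (subst sum.swap) (simp add: sum_distrib_left mult.left_commute)
  finally show ?case .
qed simp

lemma tensor_form_unit_vec:
  "set u \<subseteq> {..<n} \<Longrightarrow> tensor_form n W (map (unit_vec n) u) = W u"
proof (induction u arbitrary: W)
  case (Cons j u)
  have "(\<Sum>i<n. unit_vec n j $ i * tensor_form n (\<lambda>u. W (i # u)) (map (unit_vec n) u)) =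
    (\<Sum>i<n. if i = j then W (j # u) else 0)"
    using Cons by (intro sum.cong) auto
  then show ?case
    using Cons.prems by simp
qed simp

lemma multilinear_form_tensor_form: "multilinear_form n m (tensor_form n W)"
proof -
  have "tensor_form n W (us @ (a \<cdot>\<^sub>v x + b \<cdot>\<^sub>v y) # vs) =
    a * tensor_form n W (us @ x # vs) + b * tensor_form n W (us @ y # vs)"
    if "x \<in> carrier_vec n" "y \<in> carrier_vec n" for W us x y vs a b
    using that
  proof (induction us arbitrary: W)
    case Nil
    then show ?case
      by (auto simp: sum_distrib_left algebra_simps simp flip: sum.distrib intro!: sum.cong)
  next
    case (Cons u us)
    then show ?case
      by (simp add: sum_distrib_left algebra_simps sum.distrib)
  qed
  then show ?thesis
    unfolding multilinear_form_def by blast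
qed

lemma invertible_matI:
  fixes A :: "'k::field mat"
  assumes A: "A \<in> carrier_mat n n"
    and inj: "\<And>v. v \<in> carrier_vec n \<Longrightarrow> A *\<^sub>v v = 0\<^sub>v n \<Longrightarrow> v = 0\<^sub>v n"
  shows "invertible_mat A"
proof -
  have "det A \<noteq> 0"
    using inj det_0_iff_vec_prod_zero_field[OF A] by blast
  then have "A \<in> Units (ring_mat TYPE('k) n undefined)"
    by (rule det_non_zero_imp_unit[OF A])
  then obtain B where "B \<in> carrier_mat n n" "A * B = 1\<^sub>m n" "B * A = 1\<^sub>m n"
    by (auto simp: Units_def ring_mat_def)
  then show ?thesis
    using A unfolding invertible_mat_def inverts_mat_def by auto
qed

section \<open>The form of a symmetric presentation\<close>

lemma lookup_const_mult:
  "lookup (single 0 (c :: 'k::field) * p) w = c * lookup p w"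
  by (simp flip: mult_map_scale_conv_mult)

lemma lookup_letter_mult:
  fixes p :: "'x nc_word \<Rightarrow>\<^sub>0 'k::field"
  shows "lookup (letter i * p) (NC_Word (j # u)) =
    (if i = j then lookup p (NC_Word u) else 0)"
proof (rule additive_eqI[where A = UNIV and f = "\<lambda>p. lookup (letter i * p) (NC_Word (j # u))"])
  fix w :: "'x nc_word" and c :: 'k
  show "lookup (letter i * single w c) (NC_Word (j # u)) =
    (if i = j then lookup (single w c) (NC_Word u) else 0)"
    by (cases w) (auto simp: mult_single lookup_single "when_def" plus_nc_word_def)
qed (simp_all add: lookup_add distrib_left)

lemma homogeneous_eqI:
  fixes p q :: "nat nc_word \<Rightarrow>\<^sub>0 'k::field"
  assumes "p \<in> carrier (free_algebra n)" "q \<in> carrier (free_algebra n)"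
    and "homogeneous d p" "homogeneous d q"
    and "\<And>u. length u = d \<Longrightarrow> set u \<subseteq> {..<n} \<Longrightarrow> lookup p (NC_Word u) = lookup q (NC_Word u)"
  shows "p = q"
proof (rule poly_mapping_eqI)
  fix w
  have "lookup f w = 0" if "f \<in> carrier (free_algebra n)" "homogeneous d f"
    "\<not> (length (letters w) = d \<and> set (letters w) \<subseteq> {..<n})" for f :: "nat nc_word \<Rightarrow>\<^sub>0 'k"
    using that by (auto simp: homogeneous_def in_keys_iff)
  then show "lookup p w = lookup q w"
    using assms(5)[of "letters w"] assms(1-4) by (metis nc_word.collapse)
qed

lemma homogeneous_const_mult:
  "homogeneous d p \<Longrightarrow> homogeneous d (single 0 (c :: 'k::field) * p)"
  using homogeneous_mult[of 0 "single 0 c" d p] by (simp add: homogeneous_single)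

lemma free_algebra_const_mult:
  fixes p :: "nat nc_word \<Rightarrow>\<^sub>0 'k::field"
  shows "p \<in> carrier (free_algebra n) \<Longrightarrow> single 0 c * p \<in> carrier (free_algebra n)"
  by (rule free_algebra_mult) auto

context symmetric_presentation
begin

section \<open>The kernel of the evaluation, degree by degree\<close>

abbreviation S :: "nat \<Rightarrow> nat \<Rightarrow> 'a" where
  "S i l \<equiv> ev (strip l (s i))"

lemma S_mem: "i < n \<Longrightarrow> S i l \<in> gr (N - 1)"
  using N s_mem s_homogeneous by (intro ev_mem_gr strip_mem_free_algebra homogeneous_strip) auto

text \<open>The derivatives of a kernel element form a relation between the \<open>x i\<close>,
  which \<open>exact1\<close> expresses by the rows of \<open>S\<close>; homogeneity lets the
  coefficients be replaced by their components of degree \<open>Suc d - N\<close>. Below degree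
  \<open>N\<close> nothing is left.\<close>

lemma kernel_strip:
  assumes p: "p \<in> F" "ev p = 0" "homogeneous (Suc d) p"
  obtains c where "\<And>l. l < n \<Longrightarrow>
    ev (strip l p) = (\<Sum>i<n. (if N \<le> Suc d then component (c i) (Suc d - N) else 0) * S i l)"
proof -
  have "(\<Sum>l<n. ev (strip l p) * x l) = 0"
    using ev_expansion[OF p(1)] p(2) homogeneous_lookup_zero[OF p(3)] by simp
  from exact1[OF this] obtain c where c: "\<forall>l<n. ev (strip l p) = (\<Sum>i<n. c i * S i l)"
    by blast
  have "ev (strip l p) = (\<Sum>i<n. (if N \<le> Suc d then component (c i) (Suc d - N) else 0) * S i l)"
    if l: "l < n" for l
  proof -
    have "ev (strip l p) = component (ev (strip l p)) d"
      using ev_mem_gr[OF strip_mem_free_algebra[OF p(1)] homogeneous_strip[OF p(3)], of l]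
      by (simp add: component_homogeneous)
    also have "\<dots> = (\<Sum>i<n. component (c i * S i l) d)"
      using c l by (simp add: component_sum)
    also have "\<dots> = (\<Sum>i<n. (if N \<le> Suc d then component (c i) (Suc d - N) else 0) * S i l)"
    proof (rule sum.cong[OF refl])
      fix i assume "i \<in> {..<n}"
      moreover have "N - 1 \<le> d \<longleftrightarrow> N \<le> Suc d" "d - (N - 1) = Suc d - N"
        using N by auto
      ultimately show "component (c i * S i l) d =
        (if N \<le> Suc d then component (c i) (Suc d - N) else 0) * S i l"
        using component_mult_right[OF S_mem, of i "c i" l d] by simp
    qed
    finally show ?thesis .
  qed
  then show ?thesis
    by (rule that)
qed

lemma strip_eq_zero_imp:
  assumes "p \<in> F" "lookup p 0 = 0" "\<And>l. l < n \<Longrightarrow> strip l p = 0"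
  shows "p = 0"
  using strip_expansion[OF assms(1)] assms(2,3) by simp

text \<open>The derivatives lie in the kernel as well, one degree lower, and the induction ends at
  the constants.\<close>

lemma kernel_low_degree:
  assumes "p \<in> F" "ev p = 0" "homogeneous d p" "d < N"
  shows "p = 0"
  using assms
proof (induction d arbitrary: p)
  case 0
  have p: "p = single 0 (lookup p 0)"
    by (rule homogeneous_0D[OF 0(3)])
  then have "scale (lookup p 0) 1 = 0"
    using 0(2) ev_const by metis
  then have "lookup p 0 = 0"
    using scale_one_inject[of _ 0] by simp
  then show ?case
    using p by simp
next
  case (Suc d)
  obtain c where c: "\<And>l. l < n \<Longrightarrow>
    ev (strip l p) = (\<Sum>i<n. (if N \<le> Suc d then component (c i) (Suc d - N) else 0) * S i l)"
    by (rule kernel_strip[OF Suc.prems(1-3)]) blast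
  show ?case
  proof (rule strip_eq_zero_imp[OF Suc.prems(1) homogeneous_lookup_zero[OF Suc.prems(3)]])
    fix l assume "l < n"
    then show "strip l p = 0"
      using c Suc.prems by (intro Suc.IH strip_mem_free_algebra homogeneous_strip) auto
  qed
qed

text \<open>The \<open>f i\<close> are homogeneous lifts of the coefficients in
  \<open>kernel_strip\<close>. Subtracting the combination brings the derivatives into the kernel,
  where an induction on the degree can continue.\<close>

lemma kernel_reduction:
  assumes p: "p \<in> F" "ev p = 0" "homogeneous (N + e) p"
  obtains f where "\<And>i. i < n \<Longrightarrow> f i \<in> F" "\<And>i. i < n \<Longrightarrow> homogeneous e (f i)"
    "\<And>l. l < n \<Longrightarrow> ev (strip l (p - (\<Sum>i<n. f i * s i))) = 0"
proof -
  obtain d where d: "N + e = Suc d"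
    using N by (cases "N + e") auto
  obtain c where c: "\<And>l. l < n \<Longrightarrow>
    ev (strip l p) = (\<Sum>i<n. (if N \<le> Suc d then component (c i) (Suc d - N) else 0) * S i l)"
    by (rule kernel_strip[OF p(1,2) p(3)[unfolded d]]) blast
  have "\<exists>f. f \<in> F \<and> homogeneous e f \<and> ev f = component (c i) e" for i
    using lift_homogeneous[OF component_mem] by metis
  then obtain f where f: "\<And>i. f i \<in> F \<and> homogeneous e (f i) \<and> ev (f i) = component (c i) e"
    by metis
  have "ev (strip l (p - (\<Sum>i<n. f i * s i))) = 0" if l: "l < n" for l
  proof -
    have "lookup (s i) 0 = 0" if "i < n" for i
      using s_homogeneous[OF that] N homogeneous_lookup_zero[of "N - 1" "s i"] by simp
    then have "ev (strip l (\<Sum>i<n. f i * s i)) = (\<Sum>i<n. component (c i) e * S i l)"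
      using f by (simp add: strip_sum free_eval_sum strip_mult free_eval_add free_eval_mult)
    moreover have "N \<le> Suc d" "Suc d - N = e"
      using d by auto
    ultimately show ?thesis
      using c[OF l] by (simp add: strip_diff free_eval_diff)
  qed
  with f show ?thesis
    by (intro that[of f]) auto
qed

lemma reduction_mem:
  assumes "p \<in> F" "ev p = 0" "homogeneous (N + e) p"
    and f: "\<And>i. i < n \<Longrightarrow> f i \<in> F" "\<And>i. i < n \<Longrightarrow> homogeneous e (f i)"
  shows "p - (\<Sum>i<n. f i * s i) \<in> F" "homogeneous (N + e) (p - (\<Sum>i<n. f i * s i))"
proof -
  show "p - (\<Sum>i<n. f i * s i) \<in> F"
    by (intro free_algebra_diff free_algebra_sum free_algebra_mult assms s_mem) auto
  show "homogeneous (N + e) (p - (\<Sum>i<n. f i * s i))"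
  proof (intro homogeneous_diff homogeneous_sum assms)
    fix i assume "i \<in> {..<n}"
    then show "homogeneous (N + e) (f i * s i)"
      using homogeneous_mult[OF f(2) s_homogeneous, of i i] by (simp add: add.commute)
  qed
qed

text \<open>After the reduction with \<open>e = 0\<close> the derivatives vanish by
  \<open>kernel_low_degree\<close>, and the \<open>f i\<close>, being of degree 0, are
  constants.\<close>

lemma kernel_degree_N:
  assumes p: "p \<in> F" "ev p = 0" "homogeneous N p"
  obtains k where "p = (\<Sum>i<n. single 0 (k i) * s i)"
proof -
  have p': "homogeneous (N + 0) p"
    using p(3) by simp
  obtain f where f: "\<And>i. i < n \<Longrightarrow> f i \<in> F" "\<And>i. i < n \<Longrightarrow> homogeneous 0 (f i)"
    "\<And>l. l < n \<Longrightarrow> ev (strip l (p - (\<Sum>i<n. f i * s i))) = 0"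
    by (rule kernel_reduction[OF p(1,2) p']) blast
  let ?q = "p - (\<Sum>i<n. f i * s i)"
  have q: "?q \<in> F" "homogeneous (Suc (N - 1)) ?q"
    using reduction_mem[OF p(1,2) p' f(1,2)] N by simp_all
  have "?q = 0"
  proof (rule strip_eq_zero_imp[OF q(1) homogeneous_lookup_zero[OF q(2)]])
    fix l assume "l < n"
    then show "strip l ?q = 0"
      using N q f(3)
      by (intro kernel_low_degree[of _ "N - 1"] strip_mem_free_algebra homogeneous_strip) auto
  qed
  then have "p = (\<Sum>i<n. f i * s i)"
    by simp
  also have "\<dots> = (\<Sum>i<n. single 0 (lookup (f i) 0) * s i)"
    using homogeneous_0D[OF f(2)] by (intro sum.cong) auto
  finally show ?thesis
    by (rule that)
qed

lemma s_image_subset: "s ` {..<n} \<subseteq> F"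
  using s_mem by blast

lemma ideal_s: "ideal (Idl\<^bsub>free_algebra n\<^esub> (s ` {..<n})) (free_algebra n)"
  by (rule ring.genideal_ideal[OF ring_free_algebra s_image_subset])

text \<open>After the reduction the derivatives are in the ideal by induction, and the difference is
  the sum of its derivatives times the letters.\<close>

lemma kernel_in_ideal:
  assumes "p \<in> F" "ev p = 0" "homogeneous d p"
  shows "p \<in> Idl\<^bsub>free_algebra n\<^esub> (s ` {..<n})" (is "_ \<in> ?I")
  using assms
proof (induction d arbitrary: p)
  have zero: "0 \<in> ?I"
    using additive_subgroup.zero_closed[OF ideal.axioms(1)[OF ideal_s]] by simp
  {
    case 0
    then have "p = 0"
      using kernel_low_degree[of p 0] N by simp
    then show ?case
      using zero by simp
  next
    case (Suc d)
    interpret ideal ?I "free_algebra n"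
      by (rule ideal_s)
    have add: "p + q \<in> ?I" if "p \<in> ?I" "q \<in> ?I" for p q
      using additive_subgroup.a_closed[OF ideal.axioms(1)[OF ideal_s] that] by simp
    have sum: "(\<Sum>i<n. g i) \<in> ?I" if "\<And>i. i < n \<Longrightarrow> g i \<in> ?I" for g
    proof -
      have "(\<Sum>i<m. g i) \<in> ?I" if "m \<le> n" for m
        using that by (induction m) (auto simp: zero intro!: add \<open>\<And>i. i < n \<Longrightarrow> g i \<in> ?I\<close>)
      then show ?thesis
        by blast
    qed
    show ?case
    proof (cases "Suc d < N")
      case True
      then show ?thesis
        using kernel_low_degree[OF Suc.prems] zero by simp
    next
      case False
      then obtain e where e: "Suc d = N + e"
        by (metis le_Suc_ex not_less)
      obtain f where f: "\<And>i. i < n \<Longrightarrow> f i \<in> F" "\<And>i. i < n \<Longrightarrow> homogeneous e (f i)"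
        "\<And>l. l < n \<Longrightarrow> ev (strip l (p - (\<Sum>i<n. f i * s i))) = 0"
        by (rule kernel_reduction[OF Suc.prems(1,2) Suc.prems(3)[unfolded e]]) blast
      let ?q = "p - (\<Sum>i<n. f i * s i)"
      have q: "?q \<in> F" "homogeneous (Suc d) ?q"
        using reduction_mem[OF Suc.prems(1,2) Suc.prems(3)[unfolded e] f(1,2)] by (simp_all add: e)
      have "strip l ?q \<in> ?I" if "l < n" for l
        by (rule Suc.IH[OF strip_mem_free_algebra[OF q(1)] f(3)[OF that] homogeneous_strip[OF q(2)]])
      then have "strip l ?q * letter l \<in> ?I" if "l < n" for l
        using I_r_closed[of "strip l ?q" "letter l"] that by simp
      then have "(\<Sum>l<n. strip l ?q * letter l) \<in> ?I"
        by (rule sum)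
      then have "?q \<in> ?I"
        using strip_expansion[OF q(1)] homogeneous_lookup_zero[OF q(2)] by simp
      moreover have "(\<Sum>i<n. f i * s i) \<in> ?I"
      proof (rule sum)
        fix i assume i: "i < n"
        then have "s i \<in> ?I"
          using ring.genideal_self[OF ring_free_algebra s_image_subset] by blast
        then show "f i * s i \<in> ?I"
          using I_l_closed[of "s i" "f i"] f(1)[OF i] by simp
      qed
      ultimately have "?q + (\<Sum>i<n. f i * s i) \<in> ?I"
        by (rule add)
      then show ?thesis
        by simp
    qed
  }
qed

lemma presented_by_s: "presented_by scale n x (s ` {..<n})"
  unfolding presented_by_def
proof (intro conjI s_image_subset)
  show "ev ` F = UNIV"
    using presented by (simp add: presented_by_def)
  show "{p \<in> F. ev p = 0} = Idl\<^bsub>free_algebra n\<^esub> (s ` {..<n})"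
  proof (intro equalityI subsetI)
    fix p assume "p \<in> {p \<in> F. ev p = 0}"
    then have p: "p \<in> F" "ev p = 0"
      by auto
    obtain D where D: "p = (\<Sum>d<D. homogeneous_part d p)"
      by (rule sum_homogeneous_part)
    have "homogeneous_part d p \<in> Idl\<^bsub>free_algebra n\<^esub> (s ` {..<n})" for d
      using component_ev[OF p(1), of d] p(2)
      by (intro kernel_in_ideal[of _ d] homogeneous_part_mem p homogeneous_homogeneous_part) simp
    then have "(\<Sum>d<D'. homogeneous_part d p) \<in> Idl\<^bsub>free_algebra n\<^esub> (s ` {..<n})" for D'
    proof (induction D')
      case 0
      show ?case
        using additive_subgroup.zero_closed[OF ideal.axioms(1)[OF ideal_s]] by simp
    next
      case (Suc D')
      then show ?case
        using additive_subgroup.a_closed[OF ideal.axioms(1)[OF ideal_s],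
            of "\<Sum>d<D'. homogeneous_part d p" "homogeneous_part D' p"] by simp
    qed
    then show "p \<in> Idl\<^bsub>free_algebra n\<^esub> (s ` {..<n})"
      using D by metis
  next
    fix p assume "p \<in> Idl\<^bsub>free_algebra n\<^esub> (s ` {..<n})"
    moreover have "ideal {p \<in> F. ev p = 0} (free_algebra n)"
      using kernel_eq ring.genideal_ideal[OF ring_free_algebra R_subset] by simp
    moreover have "s ` {..<n} \<subseteq> {p \<in> F. ev p = 0}"
      using s_mem ev_s by blast
    ultimately show "p \<in> {p \<in> F. ev p = 0}"
      using ring.genideal_minimal[OF ring_free_algebra] by blast
  qed
qed

section \<open>Regularity of the form\<close>

definition W :: "nat list \<Rightarrow> 'k" where
  "W u = lookup (s (hd u)) (NC_Word (tl u))"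

lemma W_Cons [simp]: "W (i # u) = lookup (s i) (NC_Word u)"
  by (simp add: W_def)

text \<open>A scalar relation between the \<open>s i\<close> is a scalar row killed by
  \<open>S\<close>; by \<open>exact2\<close> it is a multiple of the row of the \<open>x i\<close>
  and has augmentation 0.\<close>

lemma W_nondegenerate:
  assumes "\<And>u. length u = N \<Longrightarrow> set u \<subseteq> {..<n} \<Longrightarrow> (\<Sum>i<n. k i * W (i # u)) = 0" "i < n"
  shows "k i = 0"
proof -
  have zero: "(\<Sum>i<n. single 0 (k i) * s i) = 0"
    by (rule homogeneous_eqI[of _ n _ N])
      (use assms(1) s_mem s_homogeneous in
        \<open>auto simp del: free_algebra_simps simp: lookup_sum lookup_const_mult
          intro!: homogeneous_sum homogeneous_const_mult free_algebra_sum free_algebra_const_mult\<close>, simp)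
  have "(\<Sum>i<n. scale (k i) 1 * S i l) = 0" for l
    using arg_cong[OF zero, of "\<lambda>p. ev (strip l p)"]
    by (simp add: strip_sum strip_mult free_eval_sum free_eval_mult)
  from exact2[OF this] obtain a where "\<forall>i<n. scale (k i) 1 = a * x i"
    by blast
  then have "aug (scale (k i) 1) = aug (a * x i)"
    using assms(2) by metis
  then show ?thesis
    using assms(2) by (simp add: aug_scale aug_mult aug_x)
qed

lemma W_cyclic:
  obtains Q where "\<And>i l u. i < n \<Longrightarrow> l < n \<Longrightarrow> length u = N - 1 \<Longrightarrow> set u \<subseteq> {..<n} \<Longrightarrow>
    W (i # u @ [l]) = (\<Sum>j<n. Q j l * W (j # i # u))"
proof -
  have "\<exists>q. \<forall>i u. i < n \<longrightarrow> length u = N - 1 \<longrightarrow> set u \<subseteq> {..<n} \<longrightarrow>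
    W (i # u @ [l]) = (\<Sum>j<n. q j * W (j # i # u))" if l: "l < n" for l
  proof -
    \<comment> \<open>\<open>x_s\<close> lifted to the free algebra: a kernel element of degree
      \<open>N\<close>, hence a scalar combination of the \<open>s j\<close>. The scalars are column
      \<open>l\<close> of the twist.\<close>
    let ?p = "\<Sum>i<n. letter i * strip l (s i)"
    have F: "?p \<in> F"
      by (intro free_algebra_sum free_algebra_mult strip_mem_free_algebra s_mem) auto
    have "homogeneous N (letter i * strip l (s i))" if "i < n" for i
    proof -
      have "homogeneous (1 + (N - 1)) (letter i * strip l (s i))"
        using s_homogeneous[OF that] N by (intro homogeneous_mult homogeneous_single homogeneous_strip) auto
      then show ?thesis
        using N by simp
    qed
    then have hom: "homogeneous N ?p"
      by (intro homogeneous_sum) auto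
    have "ev ?p = 0"
      using x_s[OF l] by (simp add: free_eval_sum free_eval_mult)
    from kernel_degree_N[OF F this hom] obtain q where q: "?p = (\<Sum>j<n. single 0 (q j) * s j)"
      by blast
    have "W (i # u @ [l]) = (\<Sum>j<n. q j * W (j # i # u))" if "i < n" for i u
      using arg_cong[OF q, of "\<lambda>p. lookup p (NC_Word (i # u))"] that
      by (simp add: lookup_sum lookup_letter_mult lookup_const_mult lookup_strip)
    then show ?thesis
      by blast
  qed
  then obtain Q where "\<forall>l<n. \<forall>i u. i < n \<longrightarrow> length u = N - 1 \<longrightarrow> set u \<subseteq> {..<n} \<longrightarrow>
    W (i # u @ [l]) = (\<Sum>j<n. Q l j * W (j # i # u))"
    by metis
  then show ?thesis
    by (intro that[of "\<lambda>j l. Q l j"]) blast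
qed

text \<open>Contracting the last slot with \<open>k\<close> gives scalar combinations of the
  derivatives of each \<open>s i\<close>, to whose evaluations \<open>dual_exact1\<close>
  applies.\<close>

lemma snoc_nondegenerate:
  assumes "\<And>i u. i < n \<Longrightarrow> length u = N - 1 \<Longrightarrow> set u \<subseteq> {..<n} \<Longrightarrow> (\<Sum>l<n. k l * W (i # u @ [l])) = 0"
    and "l < n"
  shows "k l = 0"
proof (rule dual_exact1[OF _ assms(2)])
  fix i assume i: "i < n"
  have "(\<Sum>l<n. single 0 (k l) * strip l (s i)) = 0"
  proof (rule homogeneous_eqI[of _ n _ "N - 1"])
    show "(\<Sum>l<n. single 0 (k l) * strip l (s i)) \<in> F"
      by (intro free_algebra_sum free_algebra_const_mult strip_mem_free_algebra s_mem i)
    show "homogeneous (N - 1) (\<Sum>l<n. single 0 (k l) * strip l (s i))"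
      using s_homogeneous[OF i] N by (intro homogeneous_sum homogeneous_const_mult homogeneous_strip) simp
    fix u assume "length u = N - 1" "set u \<subseteq> {..<n}"
    then show "lookup (\<Sum>l<n. single 0 (k l) * strip l (s i)) (NC_Word u) =
      lookup 0 (NC_Word u)"
      using assms(1)[OF i] by (simp add: lookup_sum lookup_const_mult lookup_strip)
  qed simp_all
  from arg_cong[OF this, of ev] show "(\<Sum>l<n. scale (k l) (S i l)) = 0"
    by (simp add: free_eval_sum free_eval_mult)
qed

text \<open>With a single generator, \<open>s 0\<close> is its derivative times the letter, so
  \<open>exact3\<close> makes the derivative evaluate to zero, against \<open>dual_exact1\<close>.
  Without generators \<open>exact3\<close> gives \<open>1 = 0\<close>.\<close>

lemma n_ge_2: "2 \<le> n"
proof (rule ccontr)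
  assume "\<not> 2 \<le> n"
  then consider "n = 0" | "n = 1"
    by linarith
  then show False
  proof cases
    case 1
    then have "(1::'a) = 0"
      using exact3[of 1] by simp
    then show False
      by simp
  next
    case 2
    have "lookup (s 0) 0 = 0"
      using s_homogeneous[of 0] N homogeneous_lookup_zero[of "N - 1" "s 0"] 2 by simp
    then have "S 0 0 * x 0 = 0"
      using ev_expansion[OF s_mem[of 0]] ev_s[of 0] 2 by simp
    then have "S 0 0 = 0"
      using exact3[of "S 0 0"] 2 by simp
    then show False
      using dual_exact1[of "\<lambda>_. 1" 0] 2 by simp
  qed
qed

abbreviation w :: "'k vec list \<Rightarrow> 'k" where
  "w \<equiv> tensor_form n W"

lemma set_map_unit_vec: "set (map (unit_vec n :: nat \<Rightarrow> 'k vec) u) \<subseteq> carrier_vec n"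
  by auto

lemma preregular_w: "preregular n (N + 1) w"
proof -
  have nondeg: "v = 0\<^sub>v n" if v: "v \<in> carrier_vec n"
    and zero: "\<forall>us. length us = N + 1 - 1 \<and> set us \<subseteq> carrier_vec n \<longrightarrow> w (v # us) = 0" for v
  proof (rule eq_vecI)
    have "(\<Sum>i<n. v $ i * W (i # u)) = 0" if "length u = N" "set u \<subseteq> {..<n}" for u
      using zero[rule_format, of "map (unit_vec n) u"] that set_map_unit_vec[of u]
      by (simp add: tensor_form_unit_vec)
    then show "v $ i = 0\<^sub>v n $ i" if "i < dim_vec (0\<^sub>v n :: 'k vec)" for i
      using W_nondegenerate[of "\<lambda>i. v $ i" i] that by simp
  qed (use v in simp)
  obtain Q0 where Q0: "\<And>i l u. i < n \<Longrightarrow> l < n \<Longrightarrow> length u = N - 1 \<Longrightarrow> set u \<subseteq> {..<n} \<Longrightarrow>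
    W (i # u @ [l]) = (\<Sum>j<n. Q0 j l * W (j # i # u))"
    by (rule W_cyclic) blast
  define Q where "Q = mat n n (\<lambda>(j, l). Q0 j l)"
  have Q: "Q \<in> carrier_mat n n"
    by (simp add: Q_def)
  have Q_nth: "(Q *\<^sub>v v) $ j = (\<Sum>l<n. Q0 j l * v $ l)" if "j < n" "v \<in> carrier_vec n" for j v
    using that by (simp add: Q_def scalar_prod_def lessThan_atLeast0)
  \<comment> \<open>By cyclicity the form vanishes whenever its last argument is killed by
    \<open>Q\<close>.\<close>
  have "invertible_mat Q"
  proof (rule invertible_matI[OF Q])
    fix v assume v: "v \<in> carrier_vec n" "Q *\<^sub>v v = 0\<^sub>v n"
    have Qv: "(\<Sum>l<n. Q0 j l * v $ l) = 0" if "j < n" for j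
      using Q_nth[OF that v(1)] v(2) that by simp
    have "(\<Sum>l<n. v $ l * W (i # u @ [l])) = 0"
      if "i < n" "length u = N - 1" "set u \<subseteq> {..<n}" for i u
    proof -
      have "(\<Sum>l<n. v $ l * W (i # u @ [l])) = (\<Sum>l<n. \<Sum>j<n. v $ l * Q0 j l * W (j # i # u))"
        by (intro sum.cong refl) (simp only: lessThan_iff Q0[OF that(1) _ that(2,3)] sum_distrib_left mult.assoc)
      also have "\<dots> = (\<Sum>j<n. (\<Sum>l<n. Q0 j l * v $ l) * W (j # i # u))"
        by (subst sum.swap) (simp add: sum_distrib_left sum_distrib_right ac_simps)
      finally show ?thesis
        using Qv by simp
    qed
    then have "v $ l = 0" if "l < n" for l
      using snoc_nondegenerate[of "\<lambda>l. v $ l" l] that by blast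
    then show "v = 0\<^sub>v n"
      using v(1) by (intro eq_vecI) auto
  qed
  moreover have "w (us @ [v]) = w ((Q *\<^sub>v v) # us)"
    if us: "length us = N" and v: "v \<in> carrier_vec n" for us v
  proof -
    have "w (us @ [v]) = (\<Sum>l<n. v $ l * tensor_form n (\<lambda>u. W (u @ [l])) us)"
      by (rule tensor_form_snoc)
    also have "\<dots> = (\<Sum>l<n. v $ l * (\<Sum>j<n. Q0 j l * tensor_form n (\<lambda>u. W (j # u)) us))"
    proof (rule sum.cong[OF refl])
      fix l assume l: "l \<in> {..<n}"
      have "tensor_form n (\<lambda>u. W (u @ [l])) us = tensor_form n (\<lambda>u. \<Sum>j<n. Q0 j l * W (j # u)) us"
      proof (rule tensor_form_cong)
        fix u assume u: "length u = length us" "set u \<subseteq> {..<n}"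
        then obtain i u' where "u = i # u'"
          using us N by (cases u) auto
        then show "W (u @ [l]) = (\<Sum>j<n. Q0 j l * W (j # u))"
          using Q0[of i l u'] u l us by simp
      qed
      then show "v $ l * tensor_form n (\<lambda>u. W (u @ [l])) us =
        v $ l * (\<Sum>j<n. Q0 j l * tensor_form n (\<lambda>u. W (j # u)) us)"
        by (simp add: tensor_form_sum)
    qed
    also have "\<dots> = (\<Sum>j<n. (\<Sum>l<n. Q0 j l * v $ l) * tensor_form n (\<lambda>u. W (j # u)) us)"
      by (simp only: sum_distrib_left sum_distrib_right) (subst sum.swap, simp add: ac_simps)
    also have "\<dots> = w ((Q *\<^sub>v v) # us)"
      using Q_nth[OF _ v] by simp
    finally show ?thesis .
  qed
  ultimately show ?thesis
    unfolding preregular_def using n_ge_2 N multilinear_form_tensor_form nondeg Q by auto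
qed

lemma mult_mat_unit_vec:
  "A \<in> carrier_mat n n \<Longrightarrow> i < n \<Longrightarrow> j < n \<Longrightarrow> (A *\<^sub>v unit_vec n i) $ j = (A $$ (j, i) :: 'k)"
  by (simp add: mat_vec_as_mat_mat_mult scalar_prod_right_unit)

text \<open>Cyclicity turns the hypothesis on the first two slots into the statement that
  \<open>L1\<close>, contracted with the \<open>x i\<close>, is a row killed by \<open>S\<close>. By
  \<open>exact2\<close> this row is a left multiple of the row of the \<open>x j\<close>, in degree
  1 a scalar one, so \<open>L1\<close> is scalar; nondegeneracy then determines
  \<open>L0\<close>.\<close>

lemma three_regular_w: "three_regular n N w"
  unfolding three_regular_def
proof (intro conjI N preregular_w ballI impI)
  fix L0 L1 :: "'k mat"
  assume L: "L0 \<in> carrier_mat n n" "L1 \<in> carrier_mat n n"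
    and eq: "\<forall>x0 \<in> carrier_vec n. \<forall>x1 \<in> carrier_vec n. \<forall>us.
        length us = N - 1 \<and> set us \<subseteq> carrier_vec n \<longrightarrow>
        w ((L0 *\<^sub>v x0) # x1 # us) = w (x0 # (L1 *\<^sub>v x1) # us)"
  have W_eq: "(\<Sum>j<n. L0 $$ (j, i) * W (j # k # u)) = (\<Sum>j<n. L1 $$ (j, k) * W (i # j # u))"
    if i: "i < n" and k: "k < n" and u: "length u = N - 1" "set u \<subseteq> {..<n}" for i k u
  proof -
    let ?us = "map (unit_vec n) u :: 'k vec list"
    have "w ((L0 *\<^sub>v unit_vec n i) # unit_vec n k # ?us) = w (unit_vec n i # (L1 *\<^sub>v unit_vec n k) # ?us)"
      using eq u set_map_unit_vec[of u] by auto
    moreover have "w ((L0 *\<^sub>v unit_vec n i) # unit_vec n k # ?us) = (\<Sum>j<n. L0 $$ (j, i) * W (j # k # u))"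
      using tensor_form_unit_vec[of "k # u" n "\<lambda>u. W (_ # u)"] k u mult_mat_unit_vec[OF L(1) i]
      by (subst tensor_form.simps(2)) (auto intro!: sum.cong)
    moreover have "w (unit_vec n i # (L1 *\<^sub>v unit_vec n k) # ?us) = (\<Sum>j<n. L1 $$ (j, k) * W (i # j # u))"
    proof -
      have "w (unit_vec n i # (L1 *\<^sub>v unit_vec n k) # ?us) =
        (\<Sum>i'<n. if i' = i then \<Sum>j<n. L1 $$ (j, k) * W (i # j # u) else 0)"
        unfolding tensor_form.simps(2)[of n W] using i k u mult_mat_unit_vec[OF L(2) k]
        by (intro sum.cong) (auto simp: tensor_form_unit_vec intro!: sum.cong)
      then show ?thesis
        using i by simp
    qed
    ultimately show ?thesis
      by simp
  qed
  obtain Q where Q: "\<And>i l u. i < n \<Longrightarrow> l < n \<Longrightarrow> length u = N - 1 \<Longrightarrow> set u \<subseteq> {..<n} \<Longrightarrow>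
    W (i # u @ [l]) = (\<Sum>j<n. Q j l * W (j # i # u))"
    by (rule W_cyclic) blast
  have "(\<Sum>j<n. (\<Sum>i<n. scale (L1 $$ (j, i)) (x i)) * S j l) = 0" if l: "l < n" for l
  proof -
    \<comment> \<open>\<open>?p\<close> lifts the claimed zero to the free algebra. Moving the last
      letter to the front by \<open>Q\<close> and exchanging \<open>L1\<close> for \<open>L0\<close>
      identifies it with \<open>?q\<close>, a scalar combination of relations.\<close>
    let ?p = "\<Sum>j<n. \<Sum>i<n. single 0 (L1 $$ (j, i)) * (letter i * strip l (s j))"
    let ?q = "\<Sum>j<n. single 0 (\<Sum>k<n. L0 $$ (j, k) * Q k l) * s j"
    have "?p = ?q"
    proof (rule homogeneous_eqI[of _ n _ N])
      show "?p \<in> F"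
        by (intro free_algebra_sum free_algebra_const_mult free_algebra_mult strip_mem_free_algebra s_mem) auto
      show "?q \<in> F"
        by (intro free_algebra_sum free_algebra_const_mult s_mem) auto
      show "homogeneous N ?q"
        by (intro homogeneous_sum homogeneous_const_mult s_homogeneous) auto
      show "homogeneous N ?p"
      proof (intro homogeneous_sum homogeneous_const_mult)
        fix j i assume "j \<in> {..<n}"
        then have "homogeneous (1 + (N - 1)) (letter i * strip l (s j))"
          using s_homogeneous[of j] N by (intro homogeneous_mult homogeneous_single homogeneous_strip) auto
        then show "homogeneous N (letter i * strip l (s j))"
          using N by simp
      qed
      fix u' assume u': "length u' = N" "set u' \<subseteq> {..<n}"
      then obtain i u where u: "u' = i # u" "i < n" "length u = N - 1" "set u \<subseteq> {..<n}"
        using N by (cases u') auto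
      have "lookup ?p (NC_Word u') = (\<Sum>j<n. L1 $$ (j, i) * W (j # u @ [l]))"
        using u(2) by (simp add: u(1) lookup_sum lookup_const_mult lookup_letter_mult lookup_strip
            if_distrib[of "\<lambda>y. _ * y"] cong: if_cong)
      also have "\<dots> = (\<Sum>j<n. \<Sum>k<n. L1 $$ (j, i) * (Q k l * W (k # j # u)))"
        using u l by (intro sum.cong) (simp_all only: Q lessThan_iff sum_distrib_left)
      also have "\<dots> = (\<Sum>k<n. Q k l * (\<Sum>j<n. L1 $$ (j, i) * W (k # j # u)))"
        by (subst sum.swap) (simp add: sum_distrib_left mult.left_commute)
      also have "\<dots> = (\<Sum>k<n. Q k l * (\<Sum>j<n. L0 $$ (j, k) * W (j # i # u)))"
        using u by (intro sum.cong) (simp_all only: W_eq lessThan_iff)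
      also have "\<dots> = (\<Sum>j<n. (\<Sum>k<n. L0 $$ (j, k) * Q k l) * W (j # i # u))"
        by (simp only: sum_distrib_left sum_distrib_right) (subst sum.swap, simp add: ac_simps)
      also have "\<dots> = lookup ?q (NC_Word u')"
        by (simp add: u(1) lookup_sum lookup_const_mult)
      finally show "lookup ?p (NC_Word u') = lookup ?q (NC_Word u')" .
    qed
    from arg_cong[OF this, of ev] show ?thesis
      by (simp add: free_eval_sum free_eval_mult ev_s sum_distrib_right scale_mult_left)
  qed
  from exact2[OF this] obtain a where a: "\<And>j. j < n \<Longrightarrow> (\<Sum>i<n. scale (L1 $$ (j, i)) (x i)) = a * x j"
    by blast
  define c where "c = aug a"
  have L1: "L1 $$ (j, i) = (if i = j then c else 0)" if j: "j < n" and i: "i < n" for i j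
  proof -
    have "(\<Sum>i<n. scale (L1 $$ (j, i)) (x i)) \<in> gr 1"
      by (intro gr_sum gr_scale x_mem) auto
    \<comment> \<open>The product has degree 1, so only the degree-0 component of \<open>a\<close>
      contributes.\<close>
    then have "a * x j = component (a * x j) 1"
      using a[OF j] by (simp add: component_homogeneous)
    also have "\<dots> = scale c (x j)"
      using component_mult_right[OF x_mem[OF j], of a 1] by (simp add: c_def flip: scale_aug)
    finally have "(\<Sum>i<n. scale (L1 $$ (j, i)) (x i)) = (\<Sum>i<n. scale (if i = j then c else 0) (x i))"
      using a[OF j] j by (simp add: if_distrib[of "\<lambda>y. scale y _"] cong: if_cong)
    then have "(\<Sum>i<n. scale (L1 $$ (j, i) - (if i = j then c else 0)) (x i)) = 0"
      by (simp only: scale_left_diff_distrib sum_subtractf) simp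
    from x_independent[OF this i] show ?thesis
      by simp
  qed
  have L0: "L0 $$ (j, i) = (if j = i then c else 0)" if j: "j < n" and i: "i < n" for i j
  proof -
    have "(\<Sum>j<n. (L0 $$ (j, i) - (if j = i then c else 0)) * W (j # u')) = 0"
      if u': "length u' = N" "set u' \<subseteq> {..<n}" for u'
    proof -
      obtain k u where u: "u' = k # u" "k < n" "length u = N - 1" "set u \<subseteq> {..<n}"
        using N u' by (cases u') auto
      have "(\<Sum>j<n. L0 $$ (j, i) * W (j # u')) = (\<Sum>j<n. L1 $$ (j, k) * W (i # j # u))"
        using W_eq[OF i u(2-4)] u(1) by simp
      also have "\<dots> = (\<Sum>j<n. if j = k then c * W (i # u') else 0)"
        using u by (intro sum.cong) (auto simp: L1)
      also have "\<dots> = (\<Sum>j<n. if j = i then c * W (j # u') else 0)"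
        using i u(2) by simp
      also have "\<dots> = (\<Sum>j<n. (if j = i then c else 0) * W (j # u'))"
        by (rule sum.cong) auto
      finally show ?thesis
        by (simp only: left_diff_distrib sum_subtractf) simp
    qed
    from W_nondegenerate[OF this j] show ?thesis
      by simp
  qed
  show "\<exists>c. L0 = c \<cdot>\<^sub>m 1\<^sub>m n \<and> L1 = c \<cdot>\<^sub>m 1\<^sub>m n"
    using L by (intro exI[of _ c] conjI eq_matI) (auto simp: L0 L1)
qed

text \<open>On basis vectors the form returns \<open>W\<close>, so the sum lists the terms of
  \<open>s l\<close>, all of whose words have length \<open>N\<close>.\<close>

lemma form_relation_w:
  assumes "l < n"
  shows "form_relation n N w l = s l"
proof (rule poly_mapping_eqI)
  fix v
  have fin: "finite {u. length u = N \<and> set u \<subseteq> {..<n}}"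
    using finite_lists_length_eq[of "{..<n}" N] by (simp add: conj_commute)
  have "lookup (form_relation n N w l) v =
    (\<Sum>u | length u = N \<and> set u \<subseteq> {..<n}. if u = letters v then lookup (s l) v else 0)"
    unfolding form_relation_def lookup_sum
  proof (rule sum.cong[OF refl])
    fix u assume "u \<in> {u. length u = N \<and> set u \<subseteq> {..<n}}"
    then have "w (map (unit_vec n) (l # u)) = W (l # u)"
      using assms by (intro tensor_form_unit_vec) auto
    then show "lookup (single (NC_Word u) (w (map (unit_vec n) (l # u)))) v =
      (if u = letters v then lookup (s l) v else 0)"
      by (cases v) (auto simp: lookup_single "when_def")
  qed
  also have "\<dots> = (if length (letters v) = N \<and> set (letters v) \<subseteq> {..<n} then lookup (s l) v else 0)"
    using fin by (simp add: sum.delta)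
  also have "\<dots> = lookup (s l) v"
    using s_mem[OF assms] s_homogeneous[OF assms] by (auto simp: homogeneous_def in_keys_iff)
  finally show "lookup (form_relation n N w l) v = lookup (s l) v" .
qed

lemma x_inj: "inj_on x {..<n}"
proof (rule inj_onI)
  fix i j assume ij: "i \<in> {..<n}" "j \<in> {..<n}" and eq: "x i = x j"
  have "(\<Sum>l<n. scale ((if l = i then 1 else 0) - (if l = j then 1 else 0)) (x l)) =
    (\<Sum>l<n. if l = i then x i else 0) - (\<Sum>l<n. if l = j then x j else 0)"
    unfolding sum_subtractf[symmetric] by (rule sum.cong) (auto simp: eq)
  also have "\<dots> = 0"
    using ij eq by simp
  finally have "(if i = i then 1 else 0) - (if i = j then 1 else (0::'k)) = 0"
    using ij by (intro x_independent) auto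
  then show "i = j"
    by (auto split: if_splits)
qed

lemma x_basis: "independent (x ` {..<n})" "span (x ` {..<n}) = gr 1"
proof -
  show "independent (x ` {..<n})"
  proof (rule independent_if_scalars_zero)
    fix f y assume sum: "(\<Sum>y\<in>x ` {..<n}. scale (f y) y) = 0" and y: "y \<in> x ` {..<n}"
    have "(\<Sum>i<n. scale (f (x i)) (x i)) = 0"
      using sum by (simp add: sum.reindex[OF x_inj])
    then show "f y = 0"
      using y x_independent[of "\<lambda>i. f (x i)"] by blast
  qed simp
  show "span (x ` {..<n}) = gr 1"
  proof
    show "span (x ` {..<n}) \<subseteq> gr 1"
      using x_mem gr_subspace by (intro span_minimal) auto
    show "gr 1 \<subseteq> span (x ` {..<n})"
    proof
      fix a assume "a \<in> gr 1"
      then obtain k where k: "a = (\<Sum>i<n. scale (k i) (x i))"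
        using gr_1_expansion by blast
      show "a \<in> span (x ` {..<n})"
        unfolding k by (intro span_sum span_scale span_base) auto
    qed
  qed
qed

lemma dim_gr_1: "dim (gr 1) = n"
proof -
  have "span (x ` {..<n}) = span (gr 1)"
    unfolding x_basis(2)[symmetric] by (rule span_span[symmetric])
  from dim_eq_card[OF this x_basis(1)] show ?thesis
    by (simp add: card_image[OF x_inj])
qed

lemma is_form_algebra_w: "is_form_algebra scale gr n N w"
proof -
  have "form_relation n N w ` {..<n} = s ` {..<n}"
    using form_relation_w by (intro image_cong) auto
  then show ?thesis
    unfolding is_form_algebra_def using x_inj x_basis presented_by_s by auto
qed

end

theorem theorem5:
  fixes scale :: "'k::{alg_closed_field, field_char_0} \<Rightarrow> 'a::ring_1 \<Rightarrow> 'a"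
    and gr :: "nat \<Rightarrow> 'a set"
    and emb :: "'a \<Rightarrow> 'u"
  assumes "connected_graded_algebra scale gr"
    and "finitely_presented_in_degree_one scale gr"
    and "inj emb" \<comment> \<open>the universe \<^typ>\<open>'u\<close> of modules is large enough\<close>
    and "left_global_dimension TYPE('a) TYPE('u) = 3"
    and "gorenstein TYPE('u) scale gr 3"
  shows "\<exists>N\<ge>2. \<exists>s w. s + 1 = vector_space.dim scale (gr 1) \<and>
    three_regular (s + 1) N w \<and> is_form_algebra scale gr (s + 1) N w"
proof -
  obtain n x R where nxR: "\<forall>i<n. x i \<in> gr 1" "finite R" "\<forall>r\<in>R. \<exists>d\<ge>2. homogeneous d r"
    "presented_by scale n x R"
    using assms(2) unfolding finitely_presented_in_degree_one_def by blast
  interpret pres: graded_presentation scale gr n x R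
    using assms(1) nxR by (intro graded_presentation.intro graded_presentation_axioms.intro) auto
  obtain J r where J: "pres.relation_family J r" "\<And>j. j \<in> J \<Longrightarrow> \<not> pres.relation_family (J - {j}) r"
    by (rule pres.minimal_relation_family_exists) blast
  have "\<forall>j\<in>J. \<exists>d. 2 \<le> d \<and> homogeneous d (r j)"
    using J(1) unfolding pres.relation_family_def by blast
  from bchoice[OF this] obtain dg where dg: "\<forall>j\<in>J. 2 \<le> dg j \<and> homogeneous (dg j) (r j)" ..
  interpret min: minimal_graded_presentation scale gr n x R J r dg
    using J dg by unfold_locales auto
  \<comment> \<open>The short resolution also witnesses that the choice inside
    \<open>Ext_self\<close> yields a resolution.\<close>
  obtain P' :: "nat \<Rightarrow> ('a, 'u) module" and d' eP' where
    P': "projective_resolution pres.triv P' d' eP'" "carrier (P' 4) = {\<zero>\<^bsub>P' 4\<^esub>}"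
    using pres.short_projective_resolution[OF assms(3)] assms(4) by (metis order_refl)
  obtain P :: "nat \<Rightarrow> ('a, 'u) module" and d eP where
    P: "projective_resolution pres.triv P d eP"
      "\<And>i. i \<noteq> 3 \<Longrightarrow> cocycles P d i \<subseteq> coboundaries P d i"
      "modules_isomorphic
        (quotient_module ((dual_module (P 3))\<lparr>carrier := cocycles P d 3\<rparr>) (coboundaries P d 3)) pres.triv"
    using pres.gorenstein_resolution[OF P'(1) assms(5)] by metis
  obtain f0' f1' f2' g0' g1' g2' h0' h1' where cmp':
    "resolution_comparison pres.triv {0} {..<n} J min.d1_map min.d2_map min.e_map
      P' d' eP' f0' f1' f2' g0' g1' g2' h0' h1'"
    by (rule min.res.comparison_exists[OF P'(1)])
  obtain f0 f1 f2 g0 g1 g2 h0 h1 where cmp: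
    "resolution_comparison pres.triv {0} {..<n} J min.d1_map min.d2_map min.e_map
      P d eP f0 f1 f2 g0 g1 g2 h0 h1"
    by (rule min.res.comparison_exists[OF P(1)])
  interpret gor: gorenstein_presentation scale gr n x R J r dg P P'
    d eP f0 f1 f2 g0 g1 g2 h0 h1 d' eP' f0' f1' f2' g0' g1' g2' h0' h1'
    by (intro gorenstein_presentation.intro gorenstein_presentation_axioms.intro
        min.minimal_graded_presentation_axioms cmp cmp' P P')
  obtain N s where "symmetric_presentation scale gr n x R N s"
    by (rule gor.symmetric_presentation_exists)
  then interpret sym: symmetric_presentation scale gr n x R N s .
  \<comment> \<open>The witness for the dimension \<open>s + 1\<close> is \<open>s = n - 1\<close>,
    which is safe from truncation as there are at least two generators.\<close>
  have "n - 1 + 1 = n"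
    using sym.n_ge_2 by simp
  then show ?thesis
    using sym.N sym.dim_gr_1 sym.three_regular_w sym.is_form_algebra_w
    by (intro exI[of _ N] conjI exI[of _ "n - 1"] exI[of _ sym.w]) simp_all
qed

end
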